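(* Let $n$ be even, and let $\Omega$ be a relatively compact domain with smooth strictly convex boundary $M$ in an oriented locally flat projective manifold $N$ of dimension $n+1$. Then the conformal Codazzi GJMS operator $P_{n/2+2}:\mathcal{E}[2]\to\mathcal{E}[-n-2]$ on $M$, defined using a strict Fefferman defining density $\boldsymbol\rho$ of $\Omega$, is independent of the choice of the strict Fefferman defining density.
   Context: **Projective densities.** $N$ is an oriented smooth manifold of dimension $n+1$ with a locally flat projective structure $[\nabla]$ (a class of torsion-free affine connections having the same unparametrized geodesics). $\mathcal{E}(w)=(\wedge^{n+1}T^*N)^{-w/(n+2)}$ is the projective density bundle of weight $w$; the same symbol denotes its smooth sections. A projective scale is a positive section $\tau\in\mathcal{E}(1)$; it determines the unique $\nabla\in[\nabla]$ with $\nabla\tau=0$. Only such connections are used. $P_{ij}=\frac1n\mathrm{Ric}_{ij}$ is the projective Schouten tensor of $\nabla$. Locally flat means that near each point there is an affine scale, i.e. a projective scale whose connection is flat. **Ambient space.** $\widetilde N$ is the $\mathbb{R}_+$-bundle over $N$ of positive elements of $\mathcal{E}(-1)$. A density $f\in\mathcal{E}(w)$ is identified with the function $v\mapsto f v^{w}$ on $\widetilde N$, homogeneous of degree $w$. A scale $\tau$ gives the fibre coordinate $t\in\mathbb{R}_+$ on $\widetilde N$ by $v=t\,\tau^{-1}$. $\widetilde N$ carries a canonical flat connection $D_I$: for a local affine scale $\tau$ and affine coordinates $x^i$ with $\tau^{-(n+2)}=dx^1\wedge\dots\wedge dx^{n+1}$, the functions $\xi^0=t$, $\xi^i=t x^i$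 are affine coordinates, $D_I=\partial/\partial\xi^I$. For $\boldsymbol\rho\in\mathcal{E}(2)$ set $\mathcal{J}[\boldsymbol\rho]=\det(D_ID_J\boldsymbol\rho)$ (determinant in the coordinates $\xi^I$); in an arbitrary projective scale this is the determinant of $\begin{pmatrix}2\boldsymbol\rho&\nabla_j\boldsymbol\rho\\ \nabla_i\boldsymbol\rho&\nabla_i\nabla_j\boldsymbol\rho+2\boldsymbol\rho P_{ij}\end{pmatrix}$, a function on $N$ via $(\wedge^{n+1}T^*N)^{2}=\mathcal{E}(-2n-4)$. **Strictly convex domains.** For a relatively compact domain $\Omega\subset N$ with smooth boundary $M$, $M$ is strictly convex if $\nabla_i\nabla_j\rho|_{TM}$ is positive definite for a (equivalently any) $\nabla\in[\nabla]$ and a (any) defining function $\rho$ negative in $\Omega$. A defining density is $\boldsymbol\rho\in\mathcal{E}(2)$ such that $\tau^{-2}\boldsymbol\rho$ is a smooth defining function of $\Omega=\{\boldsymbol\rho<0\}$. $O(\boldsymbol\rho^k)$ denotes a term bounded by a constant times $|\boldsymbol\rho|^k$ near $M$ after trivializing densities by a projective scale on $N$. For $n$ even, a Fefferman defining density is a defining density with $\mathcal{J}[\boldsymbol\rho]=-1+\mathcal{O}\boldsymbol\rho^{n/2+1}$, $\mathcal{O}\in\mathcal{E}(-n-2)$ smooth. Its ambient metric is $\widetilde g_{IJ}=D_ID_J\boldsymbol\rho$, a Lorentz metric on $\widetilde N$ near $M$, with Levi-Civita connection $\widetilde\nabla$ and Laplacian $\widetilde\Delta=-\widetilde g^{IJ}\widetilde\nabla_I\widetilde\nabla_J$.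 It is a strict Fefferman defining density if moreover $\widetilde\Delta\mathcal{O}=O(\boldsymbol\rho)$. **Conformal densities on $M$.** Given a scale $\tau$ with connection $\nabla$, the affine normal field $\xi$ is the unique transverse vector field along $M$ with $d\rho(\xi)>0$ such that $\nabla_XY=\nabla^\xi_XY-h(X,Y)\xi$ and $\nabla_X\xi\in TM$ for $X,Y$ tangent to $M$ (with $\nabla^\xi_XY$ tangent to $M$), and such that the Riemannian metric $h$ (the affine metric) satisfies $(\xi\lrcorner\,\tau^{-(n+2)})|_{TM}=vol_h$. $\mathcal{E}[w]=(\wedge^nT^*M)^{-w/n}$, and $\mathcal{E}(w)|_M$ is identified with $\mathcal{E}[w]$ via $\tau|_M\mapsto(vol_h)^{-1/n}$. **GJMS operator.** For $f\in\mathcal{E}[2]$, $P_{n/2+2}f=\widetilde\Delta^{n/2+2}\widetilde f\,|_M$, where $\widetilde f\in\mathcal{E}(2)$ is any smooth extension of $f$ (the result does not depend on the extension). *)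

theory Defs
  imports "HOL-Analysis.Analysis"
begin

section \<open>Smooth maps, charts and oriented manifolds\<close>

text \<open>These are only meant for open \<open>S\<close>, where \<open>differentiable_on\<close> is differentiability in the
  usual two-sided sense.\<close>

primrec Ck_on :: "nat \<Rightarrow> 'a::real_normed_vector set \<Rightarrow> ('a \<Rightarrow> 'b::real_normed_vector) \<Rightarrow> bool" where
  "Ck_on 0 S f \<longleftrightarrow> continuous_on S f"
| "Ck_on (Suc k) S f \<longleftrightarrow>
     f differentiable_on S \<and> (\<forall>v. Ck_on k S (\<lambda>x. frechet_derivative f (at x) v))"

definition smooth_on :: "'a::real_normed_vector set \<Rightarrow> ('a \<Rightarrow> 'b::real_normed_vector) \<Rightarrow> bool" where
  "smooth_on S f \<longleftrightarrow> (\<forall>k. Ck_on k S f)"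

definition deriv2 ::
    "('a::real_normed_vector \<Rightarrow> 'b::real_normed_vector) \<Rightarrow> 'a \<Rightarrow> 'a \<Rightarrow> 'a \<Rightarrow> 'b" where
  "deriv2 f x u v = frechet_derivative (\<lambda>z. frechet_derivative f (at z) v) (at x) u"

text \<open>A chart is a pair of its domain and a coordinate map; the values of the coordinate map
  outside the domain are irrelevant.\<close>

type_synonym ('a, 'k) chart = "'a set \<times> ('a \<Rightarrow> real ^ 'k)"

definition chart_on :: "'a::topological_space set \<Rightarrow> ('a, 'k::finite) chart \<Rightarrow> bool" where
  "chart_on X c \<longleftrightarrow> openin (top_of_set X) (fst c) \<and> open (snd c ` fst c) \<and>
     (\<exists>g. homeomorphism (fst c) (snd c ` fst c) (snd c) g)"

definition coord_inv :: "('a, 'k) chart \<Rightarrow> real ^ 'k \<Rightarrow> 'a" where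
  "coord_inv c = inv_into (fst c) (snd c)"

text \<open>The charts \<open>c\<close> and \<open>c'\<close> may have different dimensions; for a chart \<open>c\<close> of a submanifold
  the transition map is the local parametrisation of the submanifold in the coordinates \<open>c'\<close>.\<close>

definition transition :: "('a, 'k) chart \<Rightarrow> ('a, 'l) chart \<Rightarrow> real ^ 'k \<Rightarrow> real ^ 'l" where
  "transition c c' = snd c' \<circ> coord_inv c"

definition overlap :: "('a, 'k) chart \<Rightarrow> ('a, 'l) chart \<Rightarrow> (real ^ 'k) set" where
  "overlap c c' = snd c ` (fst c \<inter> fst c')"

definition dtrans ::
    "('a, 'k::finite) chart \<Rightarrow> ('a, 'l::finite) chart \<Rightarrow> 'a \<Rightarrow> real ^ 'k \<Rightarrow> real ^ 'l" where
  "dtrans c c' p = frechet_derivative (transition c c') (at (snd c p))"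

definition jac :: "('a, 'k::finite) chart \<Rightarrow> ('a, 'k) chart \<Rightarrow> 'a \<Rightarrow> real" where
  "jac c c' p = det (matrix (dtrans c c' p))"

definition compatible :: "('a, 'k::finite) chart \<Rightarrow> ('a, 'k) chart \<Rightarrow> bool" where
  "compatible c c' \<longleftrightarrow> smooth_on (overlap c c') (transition c c') \<and>
     (\<forall>p \<in> fst c \<inter> fst c'. jac c c' p > 0)"

text \<open>\<open>A\<close> is a maximal oriented smooth atlas of \<open>X\<close>, i.e. the set of all positively oriented
  smooth charts.\<close>

definition oriented_manifold :: "'a::topological_space set \<Rightarrow> ('a, 'k::finite) chart set \<Rightarrow> bool" where
  "oriented_manifold X A \<longleftrightarrow> (\<Union>c\<in>A. fst c) = X \<and>
     (\<forall>c. c \<in> A \<longleftrightarrow> chart_on X c \<and> (\<forall>c'\<in>A. compatible c c' \<and> compatible c' c))"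

text \<open>The oriented charts of the open submanifold \<open>U\<close>.\<close>

definition restrict_atlas :: "('a, 'k) chart set \<Rightarrow> 'a set \<Rightarrow> ('a, 'k) chart set" where
  "restrict_atlas A U = {c \<in> A. fst c \<subseteq> U}"

definition smooth_fun :: "('a, 'k::finite) chart set \<Rightarrow> ('a \<Rightarrow> real) \<Rightarrow> bool" where
  "smooth_fun A r \<longleftrightarrow> (\<forall>c\<in>A. smooth_on (snd c ` fst c) (r \<circ> coord_inv c))"

text \<open>The real power of exponent \<open>s\<close> of the oriented line of top degree forms at \<open>p\<close>: an element \<open>v\<close>
  is given by its components, \<open>v = v c \<cdot> (dx\<^sup>1 \<and> \<dots> \<and> dx\<^sup>k)\<^sup>s\<close> in every oriented chart \<open>c = (x\<^sup>i)\<close>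
  around \<open>p\<close>.\<close>

definition density_fibre :: "('a, 'k::finite) chart set \<Rightarrow> real \<Rightarrow> 'a \<Rightarrow> (('a, 'k) chart \<Rightarrow> real) set" where
  "density_fibre A s p = {v.
     (\<forall>c\<in>A. \<forall>c'\<in>A. p \<in> fst c \<inter> fst c' \<longrightarrow> v c = jac c c' p powr s * v c') \<and>
     (\<forall>c. \<not> (c \<in> A \<and> p \<in> fst c) \<longrightarrow> v c = 0)}"

definition density_sections ::
    "('a, 'k::finite) chart set \<Rightarrow> real \<Rightarrow> ('a \<Rightarrow> ('a, 'k) chart \<Rightarrow> real) set" where
  "density_sections A s = {f. (\<forall>p. f p \<in> density_fibre A s p) \<and>
     (\<forall>c\<in>A. smooth_on (snd c ` fst c) (\<lambda>x. f (coord_inv c x) c))}"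


section \<open>Affine connections and projective structures\<close>

text \<open>\<open>\<Gamma> c p\<close> is the Christoffel form of the connection in the chart \<open>c\<close>:
  \<open>\<nabla>\<^sub>X Y = D Y (X) + \<Gamma> c p X Y\<close>.\<close>

type_synonym ('a, 'k) conn = "('a, 'k) chart \<Rightarrow> 'a \<Rightarrow> real ^ 'k \<Rightarrow> real ^ 'k \<Rightarrow> real ^ 'k"

definition torsion_free_connections :: "('a, 'k::finite) chart set \<Rightarrow> ('a, 'k) conn set" where
  "torsion_free_connections A = {\<Gamma>.
     (\<forall>c\<in>A. \<forall>p\<in>fst c. bilinear (\<Gamma> c p) \<and> (\<forall>u v. \<Gamma> c p u v = \<Gamma> c p v u)) \<and>
     (\<forall>c\<in>A. \<forall>u v. smooth_on (snd c ` fst c) (\<lambda>x. \<Gamma> c (coord_inv c x) u v)) \<and>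
     (\<forall>c\<in>A. \<forall>c'\<in>A. \<forall>p \<in> fst c \<inter> fst c'. \<forall>u v.
        \<Gamma> c' p (dtrans c c' p u) (dtrans c c' p v) =
        dtrans c c' p (\<Gamma> c p u v) - deriv2 (transition c c') (snd c p) u v)}"

text \<open>A regular curve \<open>\<gamma>\<close> with \<open>\<nabla>\<^bsub>\<gamma>'\<^esub> \<gamma>'\<close> proportional to \<open>\<gamma>'\<close>, i.e. a geodesic up to
  reparametrisation.\<close>

definition unparametrized_geodesic ::
    "('a::topological_space, 'k::finite) chart set \<Rightarrow> ('a, 'k) conn \<Rightarrow> real \<Rightarrow> real \<Rightarrow> (real \<Rightarrow> 'a) \<Rightarrow> bool" where
  "unparametrized_geodesic A \<Gamma> a b \<gamma> \<longleftrightarrow>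
     continuous_on {a<..<b} \<gamma> \<and> \<gamma> ` {a<..<b} \<subseteq> (\<Union>c\<in>A. fst c) \<and>
     (\<forall>c\<in>A. let J = {s \<in> {a<..<b}. \<gamma> s \<in> fst c}; x = snd c \<circ> \<gamma>;
                 x' = (\<lambda>s. vector_derivative x (at s)) in
        smooth_on J x \<and>
        (\<forall>t\<in>J. x' t \<noteq> 0 \<and>
           (\<exists>\<mu>. vector_derivative x' (at t) + \<Gamma> c (\<gamma> t) (x' t) (x' t) = \<mu> *\<^sub>R x' t)))"

definition projectively_equivalent ::
    "('a::topological_space, 'k::finite) chart set \<Rightarrow> ('a, 'k) conn \<Rightarrow> ('a, 'k) conn \<Rightarrow> bool" where
  "projectively_equivalent A \<Gamma> \<Gamma>' \<longleftrightarrow>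
     (\<forall>a b \<gamma>. unparametrized_geodesic A \<Gamma> a b \<gamma> \<longleftrightarrow> unparametrized_geodesic A \<Gamma>' a b \<gamma>)"

definition projective_structure ::
    "('a::topological_space, 'k::finite) chart set \<Rightarrow> ('a, 'k) conn set \<Rightarrow> bool" where
  "projective_structure A S \<longleftrightarrow> S \<noteq> {} \<and> S \<subseteq> torsion_free_connections A \<and>
     (\<forall>\<Gamma>\<in>S. S = {\<Gamma>' \<in> torsion_free_connections A. projectively_equivalent A \<Gamma> \<Gamma>'})"

text \<open>The projective structure induced on the open submanifold \<open>U\<close>.\<close>

definition local_class ::
    "('a::topological_space, 'k::finite) chart set \<Rightarrow> ('a, 'k) conn set \<Rightarrow> 'a set \<Rightarrow> ('a, 'k) conn set" where
  "local_class A S U = {\<Gamma>' \<in> torsion_free_connections (restrict_atlas A U).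
     \<exists>\<Gamma>\<in>S. projectively_equivalent (restrict_atlas A U) \<Gamma> \<Gamma>'}"


section \<open>Projective densities and scales\<close>

text \<open>\<open>\<E>(w)\<close> is the power \<open>-w/(n+2)\<close> of the top degree forms, where \<open>n + 1 = CARD('k)\<close> is the
  dimension of the manifold.\<close>

definition proj_exponent :: "('a, 'k::finite) chart set \<Rightarrow> real \<Rightarrow> real" where
  "proj_exponent A w = - w / (real CARD('k) + 1)"

definition proj_densities ::
    "('a, 'k::finite) chart set \<Rightarrow> real \<Rightarrow> ('a \<Rightarrow> ('a, 'k) chart \<Rightarrow> real) set" where
  "proj_densities A w = density_sections A (proj_exponent A w)"

definition scales :: "('a, 'k::finite) chart set \<Rightarrow> ('a \<Rightarrow> ('a, 'k) chart \<Rightarrow> real) set" where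
  "scales A = {\<tau> \<in> proj_densities A 1. \<forall>c\<in>A. \<forall>p\<in>fst c. \<tau> p c > 0}"

text \<open>\<open>\<nabla>\<tau> = 0\<close> for \<open>\<tau> \<in> \<E>(1)\<close>. The connection acts on \<open>(dx)\<^sup>s\<close> by
  \<open>\<nabla>\<^sub>v (dx)\<^sup>s = - s tr(\<Gamma>(v, \<cdot>)) (dx)\<^sup>s\<close>.\<close>

definition parallel_scale ::
    "('a, 'k::finite) chart set \<Rightarrow> ('a, 'k) conn \<Rightarrow> ('a \<Rightarrow> ('a, 'k) chart \<Rightarrow> real) \<Rightarrow> bool" where
  "parallel_scale A \<Gamma> \<tau> \<longleftrightarrow> (\<forall>c\<in>A. \<forall>p\<in>fst c. \<forall>v.
     frechet_derivative (\<lambda>x. \<tau> (coord_inv c x) c) (at (snd c p)) v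
       - proj_exponent A 1 * trace (matrix (\<Gamma> c p v)) * \<tau> p c = 0)"

text \<open>A torsion-free connection is flat if it admits affine coordinates near every point.\<close>

definition flat_connection :: "('a, 'k::finite) chart set \<Rightarrow> ('a, 'k) conn \<Rightarrow> bool" where
  "flat_connection A \<Gamma> \<longleftrightarrow>
     (\<forall>p \<in> (\<Union>c\<in>A. fst c). \<exists>c\<in>A. p \<in> fst c \<and> (\<forall>q\<in>fst c. \<forall>u v. \<Gamma> c q u v = 0))"

text \<open>\<open>\<tau>\<close> is an affine scale on the open set \<open>U\<close> and \<open>\<Gamma>\<close> is its connection.\<close>

definition affine_scale ::
    "('a::topological_space, 'k::finite) chart set \<Rightarrow> ('a, 'k) conn set \<Rightarrow> 'a set \<Rightarrow>
     ('a \<Rightarrow> ('a, 'k) chart \<Rightarrow> real) \<Rightarrow> ('a, 'k) conn \<Rightarrow> bool" where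
  "affine_scale A S U \<tau> \<Gamma> \<longleftrightarrow> open U \<and> \<tau> \<in> scales (restrict_atlas A U) \<and>
     \<Gamma> \<in> local_class A S U \<and> parallel_scale (restrict_atlas A U) \<Gamma> \<tau> \<and>
     flat_connection (restrict_atlas A U) \<Gamma>"

definition locally_flat ::
    "('a::topological_space, 'k::finite) chart set \<Rightarrow> ('a, 'k) conn set \<Rightarrow> bool" where
  "locally_flat A S \<longleftrightarrow> (\<forall>p \<in> (\<Union>c\<in>A. fst c). \<exists>U \<tau> \<Gamma>. p \<in> U \<and> affine_scale A S U \<tau> \<Gamma>)"

text \<open>The coordinates \<open>c = (x\<^sup>i)\<close> are affine coordinates for an affine scale \<open>\<tau>\<close> on their domain, with
  \<open>\<tau>\<^bsup>-(n+2)\<^esup> = dx\<^sup>1 \<and> \<dots> \<and> dx\<^bsup>n+1\<^esup>\<close>; the last condition says that the component of \<open>\<tau>\<close> in \<open>c\<close> is 1.\<close>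

definition affine_coords ::
    "('a::topological_space, 'k::finite) chart set \<Rightarrow> ('a, 'k) conn set \<Rightarrow> ('a, 'k) chart \<Rightarrow> bool" where
  "affine_coords A S c \<longleftrightarrow> c \<in> A \<and> (\<exists>\<tau> \<Gamma>. affine_scale A S (fst c) \<tau> \<Gamma> \<and>
     (\<forall>p\<in>fst c. (\<forall>u v. \<Gamma> c p u v = 0) \<and> \<tau> p c = 1))"


section \<open>The ambient space\<close>

text \<open>The part over \<open>U\<close> of the \<open>\<real>\<^sub>+\<close>-bundle of positive elements of \<open>\<E>(-1)\<close>.\<close>

definition ambient_space ::
    "('a, 'k::finite) chart set \<Rightarrow> 'a set \<Rightarrow> ('a \<times> (('a, 'k) chart \<Rightarrow> real)) set" where
  "ambient_space A U = {(p, v). p \<in> U \<and> v \<in> density_fibre A (proj_exponent A (-1)) p \<and>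
     (\<forall>c\<in>A. p \<in> fst c \<longrightarrow> v c > 0)}"

text \<open>The function \<open>v \<mapsto> f v\<^sup>w\<close> of a density \<open>f \<in> \<E>(w)\<close>; the product may be computed in any
  chart.\<close>

definition density_fun ::
    "('a, 'k::finite) chart set \<Rightarrow> real \<Rightarrow> ('a \<Rightarrow> ('a, 'k) chart \<Rightarrow> real) \<Rightarrow>
     'a \<times> (('a, 'k) chart \<Rightarrow> real) \<Rightarrow> real" where
  "density_fun A w f = (\<lambda>(p, v). let c = (SOME c. c \<in> A \<and> p \<in> fst c) in f p c * v c powr w)"

text \<open>The section \<open>\<tau>\<^bsup>-1\<^esup>\<close> of the ambient space. Composing with it trivialises densities:
  \<open>density_fun A w f (scale_point \<tau> p)\<close> is the function \<open>\<tau>\<^bsup>-w\<^esup> f\<close>.\<close>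

definition scale_point ::
    "('a \<Rightarrow> ('a, 'k) chart \<Rightarrow> real) \<Rightarrow> 'a \<Rightarrow> 'a \<times> (('a, 'k) chart \<Rightarrow> real)" where
  "scale_point \<tau> p = (p, \<lambda>c. inverse (\<tau> p c))"

text \<open>The coordinates \<open>\<xi>\<^sup>0 = t\<close>, \<open>\<xi>\<^sup>i = t x\<^sup>i\<close> of affine coordinates \<open>c = (x\<^sup>i)\<close>; the index 0 is
  \<open>None\<close>. As \<open>\<tau>\<close> has component 1 in \<open>c\<close>, the fibre coordinate \<open>t\<close> of \<open>v = t \<tau>\<^bsup>-1\<^esup>\<close> is the component
  \<open>v c\<close>.\<close>

definition ambient_coords ::
    "('a, 'k::finite) chart \<Rightarrow> 'a \<times> (('a, 'k) chart \<Rightarrow> real) \<Rightarrow> real ^ ('k option)" where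
  "ambient_coords c = (\<lambda>(p, v). \<chi> I. case I of None \<Rightarrow> v c | Some i \<Rightarrow> v c * snd c p $ i)"

definition ambient_expr ::
    "('a, 'k::finite) chart set \<Rightarrow> ('a, 'k) chart \<Rightarrow>
     ('a \<times> (('a, 'k) chart \<Rightarrow> real) \<Rightarrow> real) \<Rightarrow> real ^ ('k option) \<Rightarrow> real" where
  "ambient_expr A c F = F \<circ> inv_into (ambient_space A (fst c)) (ambient_coords c)"

definition pderiv_at :: "'m \<Rightarrow> (real ^ 'm \<Rightarrow> real) \<Rightarrow> real ^ 'm::finite \<Rightarrow> real" where
  "pderiv_at I F x = frechet_derivative F (at x) (axis I 1)"

definition hessian :: "(real ^ 'm::finite \<Rightarrow> real) \<Rightarrow> real ^ 'm \<Rightarrow> real ^ 'm ^ 'm" where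
  "hessian F x = (\<chi> I J. pderiv_at I (pderiv_at J F) x)"

text \<open>\<open>\<Gamma>\<^sup>K\<^sub>I\<^sub>J\<close> of the Levi-Civita connection of the metric \<open>g\<close>, and the Laplacian
  \<open>-g\<^sup>I\<^sup>J \<nabla>\<^sub>I \<nabla>\<^sub>J\<close> on functions.\<close>

definition christoffel :: "(real ^ 'm::finite \<Rightarrow> real ^ 'm ^ 'm) \<Rightarrow> real ^ 'm \<Rightarrow> 'm \<Rightarrow> 'm \<Rightarrow> 'm \<Rightarrow> real" where
  "christoffel g x K I J = (\<Sum>L\<in>UNIV. matrix_inv (g x) $ K $ L / 2 *
     (pderiv_at I (\<lambda>y. g y $ J $ L) x + pderiv_at J (\<lambda>y. g y $ I $ L) x
        - pderiv_at L (\<lambda>y. g y $ I $ J) x))"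

definition laplacian ::
    "(real ^ 'm::finite \<Rightarrow> real ^ 'm ^ 'm) \<Rightarrow> (real ^ 'm \<Rightarrow> real) \<Rightarrow> real ^ 'm \<Rightarrow> real" where
  "laplacian g F x = - (\<Sum>I\<in>UNIV. \<Sum>J\<in>UNIV. matrix_inv (g x) $ I $ J *
     (pderiv_at I (pderiv_at J F) x - (\<Sum>K\<in>UNIV. christoffel g x K I J * pderiv_at K F x)))"

text \<open>\<open>D\<^sub>I D\<^sub>J \<rho>\<close> in the coordinates \<open>\<xi>\<^sup>I\<close> belonging to the affine coordinates \<open>c\<close>.\<close>

definition ambient_metric ::
    "('a, 'k::finite) chart set \<Rightarrow> ('a, 'k) chart \<Rightarrow> ('a \<Rightarrow> ('a, 'k) chart \<Rightarrow> real) \<Rightarrow>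
     real ^ ('k option) \<Rightarrow> real ^ ('k option) ^ ('k option)" where
  "ambient_metric A c \<rho> = hessian (ambient_expr A c (density_fun A 2 \<rho>))"

definition J_op ::
    "('a, 'k::finite) chart set \<Rightarrow> ('a, 'k) chart \<Rightarrow> ('a \<Rightarrow> ('a, 'k) chart \<Rightarrow> real) \<Rightarrow>
     'a \<times> (('a, 'k) chart \<Rightarrow> real) \<Rightarrow> real" where
  "J_op A c \<rho> z = det (ambient_metric A c \<rho> (ambient_coords c z))"

text \<open>The \<open>m\<close>-th power of the Laplacian of the ambient metric of \<open>\<rho>\<close> on functions on the ambient
  space over the domain of the affine coordinates \<open>c\<close>.\<close>

definition ambient_laplacian_pow ::
    "('a, 'k::finite) chart set \<Rightarrow> ('a, 'k) chart \<Rightarrow> ('a \<Rightarrow> ('a, 'k) chart \<Rightarrow> real) \<Rightarrow> nat \<Rightarrow>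
     ('a \<times> (('a, 'k) chart \<Rightarrow> real) \<Rightarrow> real) \<Rightarrow> 'a \<times> (('a, 'k) chart \<Rightarrow> real) \<Rightarrow> real" where
  "ambient_laplacian_pow A c \<rho> m F z =
     (laplacian (ambient_metric A c \<rho>) ^^ m) (ambient_expr A c F) (ambient_coords c z)"


section \<open>Strictly convex domains and Fefferman defining densities\<close>

text \<open>From here on manifolds have dimension \<open>n + 1\<close> with \<open>n = CARD('n)\<close>, modelled on
  \<open>real ^ ('n option)\<close>.\<close>

definition smooth_domain :: "('a::topological_space, 'n::finite option) chart set \<Rightarrow> 'a set \<Rightarrow> bool" where
  "smooth_domain A \<Omega> \<longleftrightarrow> open \<Omega> \<and> connected \<Omega> \<and> \<Omega> \<noteq> {} \<and> compact (closure \<Omega>) \<and>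
     (\<forall>p\<in>frontier \<Omega>. \<exists>c\<in>A. p \<in> fst c \<and> fst c \<inter> \<Omega> = {q \<in> fst c. snd c q $ None < 0})"

definition defining_function :: "('a::topological_space, 'k::finite) chart set \<Rightarrow> 'a set \<Rightarrow> ('a \<Rightarrow> real) \<Rightarrow> bool" where
  "defining_function A \<Omega> r \<longleftrightarrow> smooth_fun A r \<and> \<Omega> = {p. r p < 0} \<and> frontier \<Omega> = {p. r p = 0} \<and>
     (\<forall>c\<in>A. \<forall>p \<in> fst c \<inter> frontier \<Omega>. \<exists>v. frechet_derivative (r \<circ> coord_inv c) (at (snd c p)) v \<noteq> 0)"

definition strictly_convex ::
    "('a::topological_space, 'k::finite) chart set \<Rightarrow> ('a, 'k) conn set \<Rightarrow> 'a set \<Rightarrow> bool" where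
  "strictly_convex A S \<Omega> \<longleftrightarrow> (\<exists>r. \<exists>\<Gamma>\<in>S. defining_function A \<Omega> r \<and>
     (\<forall>c\<in>A. \<forall>p \<in> fst c \<inter> frontier \<Omega>. \<forall>v. v \<noteq> 0 \<longrightarrow>
        frechet_derivative (r \<circ> coord_inv c) (at (snd c p)) v = 0 \<longrightarrow>
        deriv2 (r \<circ> coord_inv c) (snd c p) v v
          - frechet_derivative (r \<circ> coord_inv c) (at (snd c p)) (\<Gamma> c p v v) > 0))"

definition defining_density ::
    "('a::topological_space, 'k::finite) chart set \<Rightarrow> 'a set \<Rightarrow> ('a \<Rightarrow> ('a, 'k) chart \<Rightarrow> real) \<Rightarrow> bool" where
  "defining_density A \<Omega> \<rho> \<longleftrightarrow> \<rho> \<in> proj_densities A 2 \<and>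
     (\<exists>\<tau>\<in>scales A. defining_function A \<Omega> (\<lambda>p. density_fun A 2 \<rho> (scale_point \<tau> p)))"

text \<open>\<open>\<rho>\<close> is a Fefferman defining density with \<open>\<J>[\<rho>] = -1 + \<theta> \<rho>\<^bsup>n/2+1\<^esup>\<close>. The equation of functions
  is stated on the ambient space.\<close>

definition fefferman_with ::
    "('a::topological_space, 'n::finite option) chart set \<Rightarrow> ('a, 'n option) conn set \<Rightarrow> 'a set \<Rightarrow>
     ('a \<Rightarrow> ('a, 'n option) chart \<Rightarrow> real) \<Rightarrow> ('a \<Rightarrow> ('a, 'n option) chart \<Rightarrow> real) \<Rightarrow> bool" where
  "fefferman_with A S \<Omega> \<rho> \<theta> \<longleftrightarrow> defining_density A \<Omega> \<rho> \<and>
     \<theta> \<in> proj_densities A (- real CARD('n) - 2) \<and>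
     (\<forall>c. affine_coords A S c \<longrightarrow> (\<forall>z \<in> ambient_space A (fst c).
        J_op A c \<rho> z = - 1 + density_fun A (- real CARD('n) - 2) \<theta> z
                            * density_fun A 2 \<rho> z ^ (CARD('n) div 2 + 1)))"

text \<open>The second condition is \<open>\<Delta>\<theta> = O(\<rho>)\<close>.\<close>

definition strict_fefferman ::
    "('a::topological_space, 'n::finite option) chart set \<Rightarrow> ('a, 'n option) conn set \<Rightarrow> 'a set \<Rightarrow>
     ('a \<Rightarrow> ('a, 'n option) chart \<Rightarrow> real) \<Rightarrow> bool" where
  "strict_fefferman A S \<Omega> \<rho> \<longleftrightarrow> (\<exists>\<theta>. fefferman_with A S \<Omega> \<rho> \<theta> \<and>
     (\<exists>\<tau>\<in>scales A. \<exists>C U. open U \<and> frontier \<Omega> \<subseteq> U \<and>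
        (\<forall>c. affine_coords A S c \<longrightarrow> (\<forall>p \<in> fst c \<inter> U.
           \<bar>ambient_laplacian_pow A c \<rho> 1 (density_fun A (- real CARD('n) - 2) \<theta>) (scale_point \<tau> p)\<bar>
             \<le> C * \<bar>density_fun A 2 \<rho> (scale_point \<tau> p)\<bar>))))"


section \<open>The boundary and its conformal densities\<close>

definition frame_matrix :: "real ^ ('n option) \<Rightarrow> ('n \<Rightarrow> real ^ ('n option)) \<Rightarrow> real ^ ('n::finite option) ^ ('n option)" where
  "frame_matrix \<nu> e = (\<chi> i j. case j of None \<Rightarrow> \<nu> $ i | Some a \<Rightarrow> e a $ i)"

text \<open>The coordinate vector fields of a chart \<open>y\<close> of the boundary, in the coordinates \<open>c\<close>.\<close>

definition coord_frame ::
    "('a, 'n::finite) chart \<Rightarrow> ('a, 'n option) chart \<Rightarrow> 'a \<Rightarrow> 'n \<Rightarrow> real ^ ('n option)" where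
  "coord_frame y c p a = dtrans y c p (axis a 1)"

text \<open>The maximal oriented atlas of \<open>M = frontier \<Omega>\<close>. The orientation is that of
  \<open>(\<nu> \<lrcorner> vol)|\<^sub>M\<close> for outward pointing \<open>\<nu>\<close>; positivity of the determinant contains the
  injectivity of the differential of the parametrisation.\<close>

definition boundary_atlas ::
    "('a::topological_space, 'n::finite option) chart set \<Rightarrow> 'a set \<Rightarrow> ('a, 'n) chart set" where
  "boundary_atlas A \<Omega> = {y. chart_on (frontier \<Omega>) y \<and>
     (\<forall>c\<in>A. smooth_on (overlap y c) (transition y c)) \<and>
     (\<exists>r. defining_function A \<Omega> r \<and> (\<forall>c\<in>A. \<forall>p \<in> fst y \<inter> fst c. \<forall>\<nu>.
        frechet_derivative (r \<circ> coord_inv c) (at (snd c p)) \<nu> > 0 \<longrightarrow>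
        det (frame_matrix \<nu> (coord_frame y c p)) > 0))}"

text \<open>\<open>\<E>[w]\<close>, the power \<open>-w/n\<close> of the top degree forms of the boundary.\<close>

definition conf_densities ::
    "('a::topological_space, 'n::finite option) chart set \<Rightarrow> 'a set \<Rightarrow> real \<Rightarrow> ('a \<Rightarrow> ('a, 'n) chart \<Rightarrow> real) set" where
  "conf_densities A \<Omega> w = density_sections (boundary_atlas A \<Omega>) (- w / real CARD('n))"

text \<open>\<open>\<xi>\<close> is the affine normal field of the scale \<open>\<tau>\<close> and \<open>h\<close> is its affine metric, with components
  \<open>h y p\<close> in the charts \<open>y\<close> of the boundary. The conditions at \<open>p\<close> are \<open>dr(\<xi>) > 0\<close>, the
  decomposition \<open>\<nabla>\<^sub>X Y + h(X, Y) \<xi> \<in> TM\<close> and the tangency of \<open>\<nabla>\<^sub>X \<xi>\<close>, both for coordinate vector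
  fields, the positivity of \<open>h\<close>, and the volume condition \<open>(\<xi> \<lrcorner> \<tau>\<^bsup>-(n+2)\<^esup>)|\<^bsub>TM\<^esub> = vol\<^sub>h\<close>.\<close>

definition affine_normal ::
    "('a::topological_space, 'n::finite option) chart set \<Rightarrow> ('a, 'n option) conn set \<Rightarrow> 'a set \<Rightarrow>
     ('a \<Rightarrow> ('a, 'n option) chart \<Rightarrow> real) \<Rightarrow>
     (('a, 'n option) chart \<Rightarrow> 'a \<Rightarrow> real ^ ('n option)) \<Rightarrow>
     (('a, 'n) chart \<Rightarrow> 'a \<Rightarrow> real ^ 'n ^ 'n) \<Rightarrow> bool" where
  "affine_normal A S \<Omega> \<tau> \<xi> h \<longleftrightarrow> (\<exists>r. \<exists>\<Gamma>\<in>S. defining_function A \<Omega> r \<and> parallel_scale A \<Gamma> \<tau> \<and>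
     (\<forall>c\<in>A. \<forall>c'\<in>A. \<forall>p \<in> fst c \<inter> fst c' \<inter> frontier \<Omega>. \<xi> c' p = dtrans c c' p (\<xi> c p)) \<and>
     (\<forall>c\<in>A. \<forall>y \<in> boundary_atlas A \<Omega>.
        smooth_on (overlap y c) (\<lambda>u. \<xi> c (coord_inv y u)) \<and>
        (\<forall>p \<in> fst y \<inter> fst c.
           let e = coord_frame y c p; TM = range (dtrans y c p) in
             frechet_derivative (r \<circ> coord_inv c) (at (snd c p)) (\<xi> c p) > 0 \<and>
             (\<forall>a b. deriv2 (transition y c) (snd y p) (axis a 1) (axis b 1)
                      + \<Gamma> c p (e a) (e b) + h y p $ a $ b *\<^sub>R \<xi> c p \<in> TM) \<and>
             (\<forall>a. frechet_derivative (\<lambda>u. \<xi> c (coord_inv y u)) (at (snd y p)) (axis a 1)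
                      + \<Gamma> c p (e a) (\<xi> c p) \<in> TM) \<and>
             (\<forall>u. u \<noteq> 0 \<longrightarrow> u \<bullet> (h y p *v u) > 0) \<and>
             \<tau> p c powr (- real CARD('n) - 2) * det (frame_matrix (\<xi> c p) e) = sqrt (det (h y p)))))"

text \<open>The identification of \<open>\<E>(w)|\<^sub>M\<close> with \<open>\<E>[w]\<close> given by \<open>\<tau>|\<^sub>M \<mapsto> (vol\<^sub>h)\<^bsup>-1/n\<^esup>\<close>. The section of
  \<open>\<E>(w)|\<^sub>M\<close> is the function \<open>G\<close>, homogeneous of degree \<open>w\<close> on the ambient space, of which only the
  values over \<open>M \<inter> U\<close> are used: it is \<open>G(\<tau>\<^bsup>-1\<^esup>) \<tau>\<^sup>w\<close>.\<close>

definition corresponds_on ::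
    "('a::topological_space, 'n::finite option) chart set \<Rightarrow> ('a, 'n option) conn set \<Rightarrow> 'a set \<Rightarrow> 'a set \<Rightarrow> real \<Rightarrow>
     ('a \<times> (('a, 'n option) chart \<Rightarrow> real) \<Rightarrow> real) \<Rightarrow> ('a \<Rightarrow> ('a, 'n) chart \<Rightarrow> real) \<Rightarrow> bool" where
  "corresponds_on A S \<Omega> U w G f \<longleftrightarrow> (\<exists>\<tau>\<in>scales A. \<exists>\<xi> h. affine_normal A S \<Omega> \<tau> \<xi> h \<and>
     (\<forall>y \<in> boundary_atlas A \<Omega>. \<forall>p \<in> fst y \<inter> U.
        f p y = G (scale_point \<tau> p) * sqrt (det (h y p)) powr (- w / real CARD('n))))"

definition extends ::
    "('a::topological_space, 'n::finite option) chart set \<Rightarrow> ('a, 'n option) conn set \<Rightarrow> 'a set \<Rightarrow> real \<Rightarrow>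
     ('a \<Rightarrow> ('a, 'n option) chart \<Rightarrow> real) \<Rightarrow> ('a \<Rightarrow> ('a, 'n) chart \<Rightarrow> real) \<Rightarrow> bool" where
  "extends A S \<Omega> w F f \<longleftrightarrow> F \<in> proj_densities A w \<and> corresponds_on A S \<Omega> UNIV w (density_fun A w F) f"


section \<open>The GJMS operator\<close>

text \<open>\<open>P f\<close> is the section of \<open>\<E>[-n-2]\<close> that is identified with \<open>\<Delta>\<^bsup>n/2+2\<^esup> F |\<^sub>M\<close> for every smooth
  extension \<open>F \<in> \<E>(2)\<close> of \<open>f\<close>.\<close>

definition gjms ::
    "('a::topological_space, 'n::finite option) chart set \<Rightarrow> ('a, 'n option) conn set \<Rightarrow> 'a set \<Rightarrow>
     ('a \<Rightarrow> ('a, 'n option) chart \<Rightarrow> real) \<Rightarrow> ('a \<Rightarrow> ('a, 'n) chart \<Rightarrow> real) \<Rightarrow> ('a \<Rightarrow> ('a, 'n) chart \<Rightarrow> real)" where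
  "gjms A S \<Omega> \<rho> f = (THE g. g \<in> conf_densities A \<Omega> (- real CARD('n) - 2) \<and>
     (\<forall>F. extends A S \<Omega> 2 F f \<longrightarrow> (\<forall>c. affine_coords A S c \<longrightarrow>
        corresponds_on A S \<Omega> (fst c) (- real CARD('n) - 2)
          (ambient_laplacian_pow A c \<rho> (CARD('n) div 2 + 2) (density_fun A 2 F)) g)))"

end

theory Submission
  imports Defs
begin

text \<open>In affine coordinates the ambient metric is the Hessian of a function \<open>\<rho>\<close> of degree 2, so its inverse
  maps \<open>d\<rho>\<close> to the Euler field, \<open>\<bar>d\<rho>\<bar>\<^sup>2 = 2\<rho>\<close>, and \<open>\<Delta>\<close>, \<open>\<rho>\<close> satisfy the commutation rule
  \<open>\<Delta>(\<rho>u) = \<rho>\<Delta>u - (n + 2 + 2s)u\<close> on functions \<open>u\<close> of degree \<open>s\<close>. Write \<open>k = n/2 + 2\<close>. Comparing the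
  determinants order by order shows that two Fefferman defining densities satisfy
  \<open>\<rho>\<^sub>2 = \<rho>\<^sub>1 + \<phi>\<rho>\<^sub>1\<^sup>k\<close>: the coefficient of \<open>\<phi>\<rho>\<^sub>1\<^bsup>j-1\<^esup>\<close> in the linearisation of \<open>ln \<bar>det g\<bar>\<close> is
  \<open>j(n + 4 - 2j)\<close>, which vanishes first for \<open>j = k\<close>. At that order the obstructions differ by \<open>\<rho>\<^sub>1\<Delta>\<phi>\<close> up
  to sign, and strictness forces \<open>\<Delta>\<phi> = 0\<close> on \<open>M\<close>. In the telescoping sum for
  \<open>\<Delta>\<^sub>2\<^sup>k - \<Delta>\<^sub>1\<^sup>k\<close> on functions \<open>f\<close> of degree 2 only \<open>\<Delta>\<^sub>1\<^bsup>k-1\<^esup>(\<Delta>\<^sub>2 - \<Delta>\<^sub>1)f\<close> survives on \<open>M\<close>, and the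
  commutation rule turns it into a multiple of \<open>f\<Delta>\<phi>\<close>.\<close>

section \<open>Calculus of smooth maps\<close>

lemma frechet_derivativeI: "(f has_derivative f') (at x) \<Longrightarrow> frechet_derivative f (at x) = f'"
  by (metis frechet_derivative_at)

lemma differentiable_has_derivative:
  "f differentiable at x \<Longrightarrow> (f has_derivative frechet_derivative f (at x)) (at x)"
  by (simp add: frechet_derivative_works)

lemma Ck_on_SucD:
  assumes "open S" "Ck_on (Suc k) S f" "x \<in> S"
  shows "f differentiable at x" "Ck_on k S (\<lambda>x. frechet_derivative f (at x) v)"
proof -
  show "f differentiable at x"
    using assms at_within_open[of x S] unfolding Ck_on.simps differentiable_on_def by metis
  show "Ck_on k S (\<lambda>x. frechet_derivative f (at x) v)"
    using assms(2) by simp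
qed

lemma Ck_on_Suc_has_derivative:
  "open S \<Longrightarrow> Ck_on (Suc k) S f \<Longrightarrow> x \<in> S \<Longrightarrow>
    (f has_derivative frechet_derivative f (at x)) (at x)"
  using Ck_on_SucD(1) differentiable_has_derivative by blast

lemma has_derivative_imp_differentiable_on:
  assumes "\<And>x. x \<in> S \<Longrightarrow> (f has_derivative f' x) (at x)"
  shows "f differentiable_on S"
  unfolding differentiable_on_def
  using assms differentiableI differentiable_at_withinI by blast

lemma Ck_on_Suc_lower:
  assumes "open S"
  shows "Ck_on (Suc k) S f \<Longrightarrow> Ck_on k S f"
proof (induction k arbitrary: f)
  case 0
  then show ?case by (simp add: differentiable_imp_continuous_on)
next
  case (Suc k)
  then show ?case by (metis Ck_on.simps(2))
qed

lemma Ck_on_cong: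
  assumes "open S"
  shows "(\<And>x. x \<in> S \<Longrightarrow> f x = g x) \<Longrightarrow> Ck_on k S f \<Longrightarrow> Ck_on k S g"
proof (induction k arbitrary: f g)
  case 0
  then show ?case by (simp cong: continuous_on_cong)
next
  case (Suc k)
  have d: "f differentiable at x" if "x \<in> S" for x
    using Ck_on_SucD(1)[OF assms Suc.prems(2) that] .
  have d': "(g has_derivative frechet_derivative f (at x)) (at x)" if "x \<in> S" for x
    by (rule has_derivative_transform_within_open[OF differentiable_has_derivative[OF d[OF that]] assms that])
      (simp add: Suc.prems(1))
  have "g differentiable_on S"
    using d' by (rule has_derivative_imp_differentiable_on)
  moreover have "Ck_on k S (\<lambda>x. frechet_derivative g (at x) v)" for v
    by (rule Suc.IH[of "\<lambda>x. frechet_derivative f (at x) v"])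
      (use Suc.prems in \<open>auto simp: frechet_derivativeI[OF d']\<close>)
  ultimately show ?case by simp
qed

lemma Ck_on_subset:
  assumes "open S" "T \<subseteq> S"
  shows "Ck_on k S f \<Longrightarrow> Ck_on k T f"
proof (induction k arbitrary: f)
  case 0
  then show ?case using assms continuous_on_subset by auto
next
  case (Suc k)
  then show ?case using assms differentiable_on_subset by auto
qed

lemma Ck_on_SucI:
  assumes "open S" "\<And>x. x \<in> S \<Longrightarrow> (f has_derivative f' x) (at x)"
    and "\<And>v. Ck_on k S (\<lambda>x. f' x v)"
  shows "Ck_on (Suc k) S f"
proof -
  have "f differentiable_on S"
    using assms(2) by (rule has_derivative_imp_differentiable_on)
  moreover have "Ck_on k S (\<lambda>x. frechet_derivative f (at x) v)" for v
    by (rule Ck_on_cong[OF assms(1) _ assms(3)[of v]]) (simp add: frechet_derivativeI[OF assms(2)])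
  ultimately show ?thesis by simp
qed

lemma Ck_on_const: "Ck_on k S (\<lambda>x. c)"
  by (induction k arbitrary: c) auto

lemma Ck_on_bounded_linear:
  assumes "open S" "bounded_linear f"
  shows "Ck_on k S f"
proof (cases k)
  case 0
  then show ?thesis using assms linear_continuous_on by auto
next
  case (Suc j)
  show ?thesis unfolding Suc
    by (rule Ck_on_SucI[where f' = "\<lambda>x. f"])
      (auto simp: assms bounded_linear_imp_has_derivative Ck_on_const)
qed

lemma Ck_on_add:
  assumes "open S"
  shows "Ck_on k S f \<Longrightarrow> Ck_on k S g \<Longrightarrow> Ck_on k S (\<lambda>x. f x + g x)"
proof (induction k arbitrary: f g)
  case 0
  then show ?case by (auto intro: continuous_intros)
next
  case (Suc k)
  show ?case
    by (rule Ck_on_SucI[where f' = "\<lambda>x v. frechet_derivative f (at x) v + frechet_derivative g (at x) v"])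
      (use Suc.prems in \<open>auto intro!: assms has_derivative_add Ck_on_Suc_has_derivative[OF assms] Suc.IH\<close>)
qed

lemma Ck_on_sum:
  assumes "open S" "\<And>i. i \<in> I \<Longrightarrow> Ck_on k S (f i)"
  shows "Ck_on k S (\<lambda>x. \<Sum>i\<in>I. f i x)"
  using assms(2) by (induction I rule: infinite_finite_induct) (auto intro: Ck_on_const Ck_on_add assms)

lemma (in bounded_bilinear) Ck_on_bilinear:
  assumes "open S"
  shows "Ck_on k S f \<Longrightarrow> Ck_on k S g \<Longrightarrow> Ck_on k S (\<lambda>x. prod (f x) (g x))"
proof (induction k arbitrary: f g)
  case 0
  then show ?case by (auto intro: continuous_on)
next
  case (Suc k)
  have "Ck_on k S f" "Ck_on k S g"
    using Suc.prems assms Ck_on_Suc_lower by blast+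
  moreover have "Ck_on k S (\<lambda>x. frechet_derivative f (at x) v)"
    "Ck_on k S (\<lambda>x. frechet_derivative g (at x) v)" for v
    using Suc.prems by auto
  ultimately show ?case
    by (intro Ck_on_SucI[where f' = "\<lambda>x v. prod (f x) (frechet_derivative g (at x) v)
         + prod (frechet_derivative f (at x) v) (g x)"])
      (use Suc.prems in \<open>auto intro!: assms FDERIV Ck_on_Suc_has_derivative[OF assms] Ck_on_add Suc.IH\<close>)
qed

lemma Ck_on_compose:
  fixes g :: "'a::real_normed_vector \<Rightarrow> 'b::euclidean_space" and f :: "'b \<Rightarrow> 'c::real_normed_vector"
  assumes "open S" "open T" "\<And>x. x \<in> S \<Longrightarrow> g x \<in> T"
  shows "Ck_on k T f \<Longrightarrow> Ck_on k S g \<Longrightarrow> Ck_on k S (\<lambda>x. f (g x))"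
proof (induction k arbitrary: f)
  case 0
  then show ?case using assms by (auto intro: continuous_on_compose2[of T f])
next
  case (Suc k)
  have df: "(f has_derivative frechet_derivative f (at (g x))) (at (g x))"
    and dg: "(g has_derivative frechet_derivative g (at x)) (at x)" if "x \<in> S" for x
    using that Suc.prems assms Ck_on_SucD differentiable_has_derivative by metis+
  define D where "D = (\<lambda>x v. \<Sum>b\<in>Basis. (frechet_derivative g (at x) v \<bullet> b) *\<^sub>R frechet_derivative f (at (g x)) b)"
  have "((\<lambda>x. f (g x)) has_derivative D x) (at x)" if "x \<in> S" for x
  proof (rule has_derivative_eq_rhs[OF diff_chain_at[OF dg df, unfolded o_def]])
    interpret f: linear "frechet_derivative f (at (g x))"
      using df[OF that] has_derivative_linear by blast
    show "(\<lambda>v. frechet_derivative f (at (g x)) (frechet_derivative g (at x) v)) = D x"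
      unfolding D_def
      by (rule ext, subst euclidean_representation[symmetric, of "frechet_derivative g _ _"])
        (simp only: f.sum f.scaleR)
  qed (use that in auto)
  moreover have "Ck_on k S (\<lambda>x. D x v)" for v
    unfolding D_def
  proof (intro Ck_on_sum bounded_bilinear.Ck_on_bilinear[OF bounded_bilinear_scaleR] assms(1) Suc.IH)
    fix b :: 'b
    show "Ck_on k S (\<lambda>x. frechet_derivative g (at x) v \<bullet> b)"
      using Suc.prems by (intro bounded_bilinear.Ck_on_bilinear[OF bounded_bilinear_inner] Ck_on_const assms) auto
  qed (use Suc.prems assms Ck_on_Suc_lower in auto)
  ultimately show ?case
    by (intro Ck_on_SucI[OF assms(1)])
qed

lemma Ck_on_powr: "Ck_on k {0<..} (\<lambda>x::real. x powr a)"
proof (induction k arbitrary: a)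
  case 0
  then show ?case by (auto intro!: continuous_intros)
next
  case (Suc k)
  show ?case
  proof (rule Ck_on_SucI[where f' = "\<lambda>x v. (a * x powr (a - 1)) * v"])
    show "((\<lambda>x. x powr a) has_derivative (*) (a * x powr (a - 1))) (at x)" if "x \<in> {0<..}" for x :: real
      using that has_real_derivative_powr[of x a] by (simp add: has_field_derivative_def)
    show "Ck_on k {0<..} (\<lambda>x. a * x powr (a - 1) * v)" for v
      by (intro bounded_bilinear.Ck_on_bilinear[OF bounded_bilinear_mult] Suc Ck_on_const) auto
  qed auto
qed

lemma Ck_on_inverse: "Ck_on k (- {0}) (inverse :: real \<Rightarrow> real)"
proof (induction k)
  case 0
  then show ?case by (auto intro!: continuous_intros)
next
  case (Suc k)
  have o: "open (- {0::real})" by auto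
  show ?case
  proof (rule Ck_on_SucI[where f' = "\<lambda>x v. - v * (inverse x * inverse x)", OF o])
    show "Ck_on k (- {0}) (\<lambda>x. - v * (inverse x * inverse x))" for v :: real
      by (intro bounded_bilinear.Ck_on_bilinear[OF bounded_bilinear_mult] Suc Ck_on_const o)
  qed (auto intro!: derivative_eq_intros)
qed

lemma smooth_on_Ck: "smooth_on S f \<Longrightarrow> Ck_on k S f"
  by (simp add: smooth_on_def)

lemma smooth_on_cong:
  "open S \<Longrightarrow> smooth_on S f \<Longrightarrow> (\<And>x. x \<in> S \<Longrightarrow> f x = g x) \<Longrightarrow> smooth_on S g"
  unfolding smooth_on_def using Ck_on_cong by blast

lemma smooth_on_subset: "open S \<Longrightarrow> T \<subseteq> S \<Longrightarrow> smooth_on S f \<Longrightarrow> smooth_on T f"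
  unfolding smooth_on_def using Ck_on_subset by blast

lemma smooth_on_imp_continuous_on: "smooth_on S f \<Longrightarrow> continuous_on S f"
  using smooth_on_Ck[of S f 0] by simp

lemma smooth_on_imp_differentiable:
  "open S \<Longrightarrow> smooth_on S f \<Longrightarrow> x \<in> S \<Longrightarrow> f differentiable at x"
  using smooth_on_Ck Ck_on_SucD(1) by blast

lemma smooth_on_has_derivative:
  "open S \<Longrightarrow> smooth_on S f \<Longrightarrow> x \<in> S \<Longrightarrow> (f has_derivative frechet_derivative f (at x)) (at x)"
  using smooth_on_imp_differentiable differentiable_has_derivative by blast

lemma smooth_on_frechet_derivative:
  "smooth_on S f \<Longrightarrow> smooth_on S (\<lambda>x. frechet_derivative f (at x) v)"
  unfolding smooth_on_def by (metis Ck_on.simps(2))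

lemma smooth_on_const: "smooth_on S (\<lambda>x. c)"
  by (simp add: smooth_on_def Ck_on_const)

lemma smooth_on_bounded_linear: "open S \<Longrightarrow> bounded_linear f \<Longrightarrow> smooth_on S f"
  by (simp add: smooth_on_def Ck_on_bounded_linear)

lemma smooth_on_add: "open S \<Longrightarrow> smooth_on S f \<Longrightarrow> smooth_on S g \<Longrightarrow> smooth_on S (\<lambda>x. f x + g x)"
  by (simp add: smooth_on_def Ck_on_add)

lemma smooth_on_sum: "open S \<Longrightarrow> (\<And>i. i \<in> I \<Longrightarrow> smooth_on S (f i)) \<Longrightarrow> smooth_on S (\<lambda>x. \<Sum>i\<in>I. f i x)"
  by (simp add: smooth_on_def Ck_on_sum)

lemma smooth_on_scaleR:
  "open S \<Longrightarrow> smooth_on S f \<Longrightarrow> smooth_on S g \<Longrightarrow> smooth_on S (\<lambda>x. f x *\<^sub>R g x)"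
  by (simp add: smooth_on_def bounded_bilinear.Ck_on_bilinear[OF bounded_bilinear_scaleR])

lemma smooth_on_mult:
  fixes f g :: "'a::real_normed_vector \<Rightarrow> real"
  shows "open S \<Longrightarrow> smooth_on S f \<Longrightarrow> smooth_on S g \<Longrightarrow> smooth_on S (\<lambda>x. f x * g x)"
  by (simp add: smooth_on_def bounded_bilinear.Ck_on_bilinear[OF bounded_bilinear_mult])

lemma smooth_on_prod:
  fixes f :: "'i \<Rightarrow> 'a::real_normed_vector \<Rightarrow> real"
  shows "open S \<Longrightarrow> (\<And>i. i \<in> I \<Longrightarrow> smooth_on S (f i)) \<Longrightarrow> smooth_on S (\<lambda>x. \<Prod>i\<in>I. f i x)"
  by (induction I rule: infinite_finite_induct) (auto intro: smooth_on_const smooth_on_mult)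

lemma smooth_on_power:
  fixes f :: "'a::real_normed_vector \<Rightarrow> real"
  shows "open S \<Longrightarrow> smooth_on S f \<Longrightarrow> smooth_on S (\<lambda>x. f x ^ n)"
  by (induction n) (auto intro: smooth_on_const smooth_on_mult)

lemma smooth_on_minus:
  fixes f :: "'a::real_normed_vector \<Rightarrow> real"
  shows "open S \<Longrightarrow> smooth_on S f \<Longrightarrow> smooth_on S (\<lambda>x. - f x)"
  using smooth_on_mult[OF _ smooth_on_const[of S "-1"], of f] by simp

lemma smooth_on_diff:
  fixes f g :: "'a::real_normed_vector \<Rightarrow> real"
  shows "open S \<Longrightarrow> smooth_on S f \<Longrightarrow> smooth_on S g \<Longrightarrow> smooth_on S (\<lambda>x. f x - g x)"
  using smooth_on_add[OF _ _ smooth_on_minus[of S g], of f] by simp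

lemma smooth_on_compose:
  fixes g :: "'a::real_normed_vector \<Rightarrow> 'b::euclidean_space" and f :: "'b \<Rightarrow> 'c::real_normed_vector"
  assumes "open S" "open T" "smooth_on T f" "smooth_on S g" "\<And>x. x \<in> S \<Longrightarrow> g x \<in> T"
  shows "smooth_on S (\<lambda>x. f (g x))"
  using assms Ck_on_compose unfolding smooth_on_def by metis

lemma smooth_on_powr:
  fixes f :: "'a::real_normed_vector \<Rightarrow> real"
  assumes "open S" "smooth_on S f" "\<And>x. x \<in> S \<Longrightarrow> f x > 0"
  shows "smooth_on S (\<lambda>x. f x powr a)"
  by (rule smooth_on_compose[of S "{0<..}" "\<lambda>x. x powr a"])
    (use assms in \<open>auto simp: Ck_on_powr smooth_on_def\<close>)

lemma smooth_on_inverse: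
  fixes f :: "'a::real_normed_vector \<Rightarrow> real"
  assumes "open S" "smooth_on S f" "\<And>x. x \<in> S \<Longrightarrow> f x \<noteq> 0"
  shows "smooth_on S (\<lambda>x. inverse (f x))"
  by (rule smooth_on_compose[of S "- {0}" inverse])
    (use assms in \<open>auto simp: Ck_on_inverse smooth_on_def\<close>)

lemma smooth_on_divide:
  fixes f g :: "'a::real_normed_vector \<Rightarrow> real"
  assumes "open S" "smooth_on S f" "smooth_on S g" "\<And>x. x \<in> S \<Longrightarrow> g x \<noteq> 0"
  shows "smooth_on S (\<lambda>x. f x / g x)"
  using smooth_on_mult[OF assms(1,2) smooth_on_inverse[OF assms(1,3,4)]] by (simp add: divide_inverse)

lemma smooth_on_vec_lambda:
  fixes f :: "'m::finite \<Rightarrow> 'a::real_normed_vector \<Rightarrow> real"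
  assumes "open S" "\<And>i. smooth_on S (f i)"
  shows "smooth_on S (\<lambda>x. \<chi> i. f i x)"
proof -
  have "smooth_on S (\<lambda>x. \<Sum>i\<in>UNIV. f i x *\<^sub>R (axis i 1 :: real ^ 'm))"
    by (intro smooth_on_sum smooth_on_scaleR smooth_on_const assms)
  then show ?thesis
    by (rule smooth_on_cong[OF assms(1)])
      (simp add: vec_eq_iff axis_def if_distrib[of "\<lambda>z. _ * z"] cong: if_cong)
qed

lemmas smooth_intros = smooth_on_const smooth_on_add smooth_on_sum smooth_on_scaleR smooth_on_mult
  smooth_on_prod smooth_on_power smooth_on_minus smooth_on_diff

lemma has_real_derivative_along_line:
  fixes f :: "'a::real_normed_vector \<Rightarrow> real"
  assumes "(f has_derivative f') (at (p + t *\<^sub>R u))"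
  shows "((\<lambda>a. f (p + a *\<^sub>R u)) has_real_derivative f' u) (at t)"
proof -
  interpret linear f' using assms has_derivative_linear by blast
  have "((\<lambda>a. p + a *\<^sub>R u) has_derivative (\<lambda>a. a *\<^sub>R u)) (at t)"
    by (auto intro!: derivative_eq_intros)
  from has_derivative_compose[OF this assms] show ?thesis
    by (simp add: has_field_derivative_def scaleR mult.commute[of _ "f' u"])
qed

lemma second_difference_mvt:
  fixes f :: "'a::real_normed_vector \<Rightarrow> real"
  assumes S: "open S" "Ck_on 2 S f" and h: "h > 0"
    and sub: "\<And>a b. a \<in> {0..h} \<Longrightarrow> b \<in> {0..h} \<Longrightarrow> x + a *\<^sub>R u + b *\<^sub>R v \<in> S"
  shows "\<exists>a\<in>{0..h}. \<exists>b\<in>{0..h}. f (x + h *\<^sub>R u + h *\<^sub>R v) - f (x + h *\<^sub>R u) - f (x + h *\<^sub>R v) + f x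
           = h * h * deriv2 f (x + a *\<^sub>R u + b *\<^sub>R v) v u"
proof -
  have C: "Ck_on (Suc (Suc 0)) S f" using S by (simp add: numeral_2_eq_2)
  have df: "(f has_derivative frechet_derivative f (at z)) (at z)" if "z \<in> S" for z
    by (rule Ck_on_Suc_has_derivative[OF S(1) C that])
  define F where "F = (\<lambda>z. frechet_derivative f (at z) u)"
  have "Ck_on (Suc 0) S F" using C by (simp add: F_def)
  then have dF: "(F has_derivative frechet_derivative F (at z)) (at z)" if "z \<in> S" for z
    by (rule Ck_on_Suc_has_derivative[OF S(1) _ that])
  define g where "g = (\<lambda>a. f (x + a *\<^sub>R u + h *\<^sub>R v) - f (x + a *\<^sub>R u))"
  have g: "(g has_real_derivative F (x + a *\<^sub>R u + h *\<^sub>R v) - F (x + a *\<^sub>R u)) (at a)"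
    if "a \<in> {0..h}" for a
  proof -
    have s: "(x + h *\<^sub>R v) + a *\<^sub>R u \<in> S" "x + a *\<^sub>R u \<in> S"
      using sub[OF that, of h] sub[OF that, of 0] h by (auto simp: algebra_simps)
    show ?thesis
      using DERIV_diff[OF has_real_derivative_along_line[OF df[OF s(1)]]
          has_real_derivative_along_line[OF df[OF s(2)]]]
      by (simp add: g_def F_def add.assoc add.commute[of "_ *\<^sub>R v"])
  qed
  obtain a where a: "0 < a" "a < h" and 1: "g h - g 0 = (h - 0) * (F (x + a *\<^sub>R u + h *\<^sub>R v) - F (x + a *\<^sub>R u))"
    using MVT2[of 0 h g "\<lambda>a. F (x + a *\<^sub>R u + h *\<^sub>R v) - F (x + a *\<^sub>R u)"] g h by auto
  define k where "k = (\<lambda>b. F (x + a *\<^sub>R u + b *\<^sub>R v))"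
  have k: "(k has_real_derivative frechet_derivative F (at (x + a *\<^sub>R u + b *\<^sub>R v)) v) (at b)"
    if "b \<in> {0..h}" for b
    unfolding k_def
    using has_real_derivative_along_line[OF dF[of "x + a *\<^sub>R u + b *\<^sub>R v"]] sub[of a b] a that by auto
  obtain b where b: "0 < b" "b < h"
    and 2: "k h - k 0 = (h - 0) * frechet_derivative F (at (x + a *\<^sub>R u + b *\<^sub>R v)) v"
    using MVT2[of 0 h k "\<lambda>b. frechet_derivative F (at (x + a *\<^sub>R u + b *\<^sub>R v)) v"] k h by auto
  have "f (x + h *\<^sub>R u + h *\<^sub>R v) - f (x + h *\<^sub>R u) - f (x + h *\<^sub>R v) + f x = g h - g 0"
    by (simp add: g_def)
  also have "\<dots> = h * (h * deriv2 f (x + a *\<^sub>R u + b *\<^sub>R v) v u)"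
    using 1 2 by (simp add: k_def deriv2_def F_def)
  finally show ?thesis using a b by (intro bexI[of _ a] bexI[of _ b]) auto
qed

lemma deriv2_commute:
  fixes f :: "'a::real_normed_vector \<Rightarrow> real"
  assumes S: "open S" "Ck_on 2 S f" "x \<in> S"
  shows "deriv2 f x u v = deriv2 f x v u"
proof (rule ccontr)
  assume ne: "deriv2 f x u v \<noteq> deriv2 f x v u"
  define e where "e = \<bar>deriv2 f x u v - deriv2 f x v u\<bar> / 2"
  have e: "e > 0" using ne by (simp add: e_def)
  have C: "Ck_on (Suc (Suc 0)) S f" using S by (simp add: numeral_2_eq_2)
  have cont: "continuous_on S (\<lambda>x. deriv2 f x u v)" for u v
    using C by (simp add: deriv2_def)
  have ev: "eventually (\<lambda>y. y \<in> S \<and> \<bar>deriv2 f y u v - deriv2 f x u v\<bar> < e \<and> \<bar>deriv2 f y v u - deriv2 f x v u\<bar> < e) (nhds x)"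
  proof -
    have "((\<lambda>y. deriv2 f y u v) \<longlongrightarrow> deriv2 f x u v) (nhds x)" for u v
      using cont[of u v] S(1,3) continuous_on_eq_continuous_at isCont_def tendsto_nhds_iff by blast
    from tendstoD[OF this e] show ?thesis
      using eventually_nhds_in_open[OF S(1,3)]
      by (simp add: dist_real_def eventually_conj_iff)
  qed
  then obtain d where d: "d > 0" and D: "\<And>y. dist y x < d \<Longrightarrow> y \<in> S \<and>
      \<bar>deriv2 f y u v - deriv2 f x u v\<bar> < e \<and> \<bar>deriv2 f y v u - deriv2 f x v u\<bar> < e"
    by (auto simp: eventually_nhds_metric)
  define h where "h = d / (2 * (norm u + norm v + 1))"
  have h: "h > 0" using d by (simp add: h_def add_nonneg_pos)
  have hs: "h * (norm u + norm v) < d"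
  proof -
    have "h * (norm u + norm v) \<le> h * (norm u + norm v + 1)" using h by (intro mult_left_mono) auto
    also have "\<dots> = d / 2"
      using add_nonneg_pos[of "norm u + norm v" 1] by (simp add: h_def field_simps)
    finally show ?thesis using d by linarith
  qed
  have near: "dist (x + a *\<^sub>R u + b *\<^sub>R v) x < d" "dist (x + a *\<^sub>R v + b *\<^sub>R u) x < d"
    if "a \<in> {0..h}" "b \<in> {0..h}" for a b
  proof -
    have "norm (a *\<^sub>R u + b *\<^sub>R v) \<le> h * norm u + h * norm v"
      using that by (intro norm_triangle_le) (auto intro!: add_mono mult_right_mono)
    then show "dist (x + a *\<^sub>R u + b *\<^sub>R v) x < d"
      using hs by (simp add: dist_norm algebra_simps)
    have "norm (a *\<^sub>R v + b *\<^sub>R u) \<le> h * norm v + h * norm u"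
      using that by (intro norm_triangle_le) (auto intro!: add_mono mult_right_mono)
    then show "dist (x + a *\<^sub>R v + b *\<^sub>R u) x < d"
      using hs by (simp add: dist_norm algebra_simps)
  qed
  obtain a b where 1: "a \<in> {0..h}" "b \<in> {0..h}"
    "f (x + h *\<^sub>R u + h *\<^sub>R v) - f (x + h *\<^sub>R u) - f (x + h *\<^sub>R v) + f x = h * h * deriv2 f (x + a *\<^sub>R u + b *\<^sub>R v) v u"
    using second_difference_mvt[OF S(1,2) h, of x u v] near D by blast
  obtain a' b' where 2: "a' \<in> {0..h}" "b' \<in> {0..h}"
    "f (x + h *\<^sub>R v + h *\<^sub>R u) - f (x + h *\<^sub>R v) - f (x + h *\<^sub>R u) + f x = h * h * deriv2 f (x + a' *\<^sub>R v + b' *\<^sub>R u) u v"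
    using second_difference_mvt[OF S(1,2) h, of x v u] near D by blast
  have "h * h * deriv2 f (x + a *\<^sub>R u + b *\<^sub>R v) v u = h * h * deriv2 f (x + a' *\<^sub>R v + b' *\<^sub>R u) u v"
    unfolding 1(3)[symmetric] 2(3)[symmetric] by (simp add: algebra_simps)
  then have "deriv2 f (x + a *\<^sub>R u + b *\<^sub>R v) v u = deriv2 f (x + a' *\<^sub>R v + b' *\<^sub>R u) u v"
    using h by simp
  then show False
    using D[OF near(1)[OF 1(1,2)]] D[OF near(2)[OF 2(1,2)]] by (simp add: e_def abs_if split: if_splits)
qed

subsection \<open>Division by a coordinate function\<close>

definition squeeze :: "'k::finite \<Rightarrow> real \<Rightarrow> real ^ 'k \<Rightarrow> real ^ 'k" where
  "squeeze i s x = x + ((s - 1) * x $ i) *\<^sub>R axis i 1"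

lemma squeeze_nth: "squeeze i s x $ j = (if j = i then s * x $ i else x $ j)"
  by (simp add: squeeze_def axis_def algebra_simps)

lemma bounded_linear_squeeze: "bounded_linear (squeeze i s)"
  by (rule linear_conv_bounded_linear[THEN iffD1], rule linearI)
    (auto simp: vec_eq_iff squeeze_nth algebra_simps)

lemma squeeze_in_ball:
  assumes "xb $ i = 0" "x \<in> ball xb d" "s \<in> {0..1}"
  shows "squeeze i s x \<in> ball xb d"
proof -
  have "norm (squeeze i s x - xb) \<le> norm (x - xb)"
    using assms by (intro norm_le_componentwise_cart)
      (auto simp: squeeze_nth abs_mult mult_left_le_one_le)
  then show ?thesis using assms(2) by (auto simp: dist_norm norm_minus_commute)
qed

lemma continuous_on_squeeze:
  assumes "xb $ i = 0" "continuous_on (ball xb d) g"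
  shows "continuous_on (ball xb d \<times> {0..1}) (\<lambda>z. g (squeeze i (snd z) (fst z)))"
proof (rule continuous_on_compose2[OF assms(2)])
  show "continuous_on (ball xb d \<times> {0..1}) (\<lambda>z. squeeze i (snd z) (fst z))"
    unfolding squeeze_def by (intro continuous_intros)
  show "(\<lambda>z. squeeze i (snd z) (fst z)) ` (ball xb d \<times> {0..1}) \<subseteq> ball xb d"
    using squeeze_in_ball[OF assms(1)] by (metis (no_types, lifting) SigmaE fst_conv image_subsetI snd_conv)
qed

text \<open>The quotient \<open>f / x\<^sub>i\<close> is the integral of \<open>\<partial>\<^sub>if\<close> along the segment to the hyperplane. The weights
  \<open>s\<^sup>p\<close> make these integrals closed under differentiation.\<close>

definition weighted_integral :: "'k::finite \<Rightarrow> nat \<Rightarrow> (real ^ 'k \<Rightarrow> real) \<Rightarrow> real ^ 'k \<Rightarrow> real" where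
  "weighted_integral i p g x = integral {0..1} (\<lambda>s. s ^ p * g (squeeze i s x))"

lemma Ck_on_weighted_integral:
  assumes "xb $ i = 0"
  shows "Ck_on k (ball xb d) g \<Longrightarrow> Ck_on k (ball xb d) (weighted_integral i p g)"
proof (induction k arbitrary: g p)
  case 0
  then have "continuous_on (ball xb d) g" by simp
  then have "continuous_on (ball xb d \<times> cbox 0 1) (\<lambda>(x, s). s ^ p * g (squeeze i s x))"
    unfolding split_beta cbox_interval
    by (intro continuous_on_mult continuous_on_power continuous_on_snd continuous_on_id
        continuous_on_squeeze[OF assms])
  from integral_continuous_on_param[OF this] show ?case
    by (simp add: weighted_integral_def[abs_def])
next
  case (Suc k)
  let ?B = "ball xb d" and ?e = "axis i 1 :: real ^ 'a"
  have dg: "(g has_derivative frechet_derivative g (at z)) (at z)" if "z \<in> ?B" for z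
    by (rule Ck_on_Suc_has_derivative[OF open_ball Suc.prems that])
  define f where "f = (\<lambda>z v. frechet_derivative g (at z) v)"
  define D where "D = (\<lambda>x v. weighted_integral i p (\<lambda>y. f y (v - (v $ i) *\<^sub>R ?e)) x
      + (v $ i) * weighted_integral i (Suc p) (\<lambda>y. f y ?e) x)"
  have fC: "Ck_on k ?B (\<lambda>z. f z v)" for v
    using Suc.prems by (simp add: f_def)
  have fc: "continuous_on ?B (\<lambda>z. f z v)" for v
    using fC[of v] by (cases k) (simp_all add: differentiable_imp_continuous_on)
  define fx where "fx = (\<lambda>x s. Blinfun (\<lambda>v. s ^ p * f (squeeze i s x) (squeeze i s v)))"
  have lin: "linear (f z)" if "z \<in> ?B" for z
    using dg[OF that] has_derivative_linear unfolding f_def by blast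
  have fx: "blinfun_apply (fx x s) = (\<lambda>v. s ^ p * f (squeeze i s x) (squeeze i s v))"
    if "x \<in> ?B" "s \<in> {0..1}" for x s
  proof -
    have "bounded_linear (f (squeeze i s x))"
      using dg[OF squeeze_in_ball[OF assms that]] has_derivative_bounded_linear unfolding f_def by blast
    then have "bounded_linear (\<lambda>v. s ^ p * f (squeeze i s x) (squeeze i s v))"
      by (intro bounded_linear_const_mult bounded_linear_compose[OF _ bounded_linear_squeeze])
    then show ?thesis unfolding fx_def by (rule bounded_linear_Blinfun_apply)
  qed
  have cont: "continuous_on (?B \<times> {0..1}) (\<lambda>(x, s). s ^ q * f (squeeze i s x) v)" for v q
    unfolding split_beta
    by (intro continuous_on_mult continuous_on_power continuous_on_snd continuous_on_id
        continuous_on_squeeze[OF assms fc])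
  have split: "f z (squeeze i s v) = f z (v - (v $ i) *\<^sub>R ?e) + s * (v $ i) * f z ?e"
    if "z \<in> ?B" for z s v
  proof -
    interpret linear "f z" using lin[OF that] .
    have "squeeze i s v = (v - (v $ i) *\<^sub>R ?e) + (s * (v $ i)) *\<^sub>R ?e"
      by (simp add: squeeze_def algebra_simps)
    then show ?thesis by (simp only: add scaleR real_scaleR_def)
  qed
  have cont_fx: "continuous_on (?B \<times> {0..1}) (\<lambda>z. blinfun_apply (fx (fst z) (snd z)) v)" for v
  proof -
    have "continuous_on (?B \<times> {0..1}) (\<lambda>z. (snd z ^ p * f (squeeze i (snd z) (fst z)) (v - (v $ i) *\<^sub>R ?e))
        + (v $ i) * (snd z ^ Suc p * f (squeeze i (snd z) (fst z)) ?e))"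
      by (intro continuous_on_add continuous_on_mult[OF continuous_on_const] cont[unfolded split_beta])
    then show ?thesis
      by (rule continuous_on_eq)
        (auto simp del: mem_ball simp: fx split[OF squeeze_in_ball[OF assms]] algebra_simps)
  qed
  have "(weighted_integral i p g has_derivative D x) (at x)" if x: "x \<in> ?B" for x
  proof -
    have int: "(\<lambda>s. s ^ q * f (squeeze i s x) v) integrable_on {0..1}" for v q
      by (rule integrable_continuous_real)
        (rule continuous_on_compose2[OF cont[unfolded split_beta, of q v], of _ "\<lambda>s. (x, s)", simplified],
          use x in \<open>auto intro!: continuous_intros\<close>)
    have "((\<lambda>x. integral (cbox 0 1) (\<lambda>s. s ^ p * g (squeeze i s x))) has_derivative
        blinfun_apply (integral (cbox 0 1) (fx x))) (at x within ?B)"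
    proof (rule leibniz_rule[OF _ _ _ x convex_ball])
      fix y s assume y: "y \<in> ?B" "s \<in> cbox 0 (1::real)"
      then have s: "s \<in> {0..1}" by simp
      have "((\<lambda>x. g (squeeze i s x)) has_derivative
          (\<lambda>v. frechet_derivative g (at (squeeze i s y)) (squeeze i s v))) (at y)"
        by (rule has_derivative_compose[OF bounded_linear_imp_has_derivative[OF bounded_linear_squeeze]
            dg[OF squeeze_in_ball[OF assms y(1) s]]])
      then have "((\<lambda>x. s ^ p * g (squeeze i s x)) has_derivative
          (\<lambda>v. s ^ p * frechet_derivative g (at (squeeze i s y)) (squeeze i s v))) (at y)"
        by (rule has_derivative_mult_right)
      then show "((\<lambda>x. s ^ p * g (squeeze i s x)) has_derivative blinfun_apply (fx y s)) (at y within ?B)"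
        by (simp add: fx[OF y(1) s] f_def has_derivative_at_withinI)
    next
      fix y assume y: "y \<in> ?B"
      have "continuous_on ?B g"
        using Suc.prems by (simp add: differentiable_imp_continuous_on)
      moreover have "continuous_on {0..1} (\<lambda>s. squeeze i s y)"
        unfolding squeeze_def by (intro continuous_intros)
      moreover have "(\<lambda>s. squeeze i s y) ` {0..1} \<subseteq> ?B"
        by (rule image_subsetI) (rule squeeze_in_ball[OF assms y])
      ultimately have "continuous_on {0..1} (\<lambda>s. g (squeeze i s y))"
        by (rule continuous_on_compose2)
      then have "continuous_on {0..1} (\<lambda>s. s ^ p * g (squeeze i s y))"
        by (intro continuous_on_mult continuous_on_power continuous_on_id)
      then show "(\<lambda>s. s ^ p * g (squeeze i s y)) integrable_on cbox 0 1"
        by (simp add: integrable_continuous_real)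
    next
      show "continuous_on (?B \<times> cbox 0 1) (\<lambda>(x, s). fx x s)"
        unfolding split_beta
        by (rule continuous_on_blinfun_componentwise) (use cont_fx in simp)
    qed
    moreover have "blinfun_apply (integral (cbox 0 1) (fx x)) = D x"
    proof
      fix v
      have "continuous_on {0..1} (\<lambda>s. fx x s)"
      proof (rule continuous_on_blinfun_componentwise)
        show "continuous_on {0..1} (\<lambda>s. blinfun_apply (fx x s) v)" for v
          by (rule continuous_on_compose2[OF cont_fx[of v], of _ "\<lambda>s. (x, s)", simplified])
            (use x in \<open>auto intro!: continuous_intros\<close>)
      qed
      then have "blinfun_apply (integral (cbox 0 1) (fx x)) v = integral {0..1} (\<lambda>s. blinfun_apply (fx x s) v)"
        by (simp add: blinfun_apply_integral integrable_continuous_real)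
      also have "\<dots> = integral {0..1} (\<lambda>s. s ^ p * f (squeeze i s x) (v - (v $ i) *\<^sub>R ?e)
          + (v $ i) * (s ^ Suc p * f (squeeze i s x) ?e))"
        by (rule integral_cong)
          (use x in \<open>simp del: mem_ball add: fx split[OF squeeze_in_ball[OF assms]] algebra_simps\<close>)
      also have "\<dots> = D x v"
        using int[of "Suc p" ?e] int[of p]
        by (subst integral_add) (auto simp: D_def weighted_integral_def intro: integrable_on_mult_right)
      finally show "blinfun_apply (integral (cbox 0 1) (fx x)) v = D x v" .
    qed
    ultimately show ?thesis
      using x by (simp add: weighted_integral_def[abs_def] at_within_open[OF _ open_ball])
  qed
  moreover have "Ck_on k ?B (\<lambda>x. D x v)" for v
    unfolding D_def
    by (intro Ck_on_add bounded_bilinear.Ck_on_bilinear[OF bounded_bilinear_mult] Ck_on_const Suc.IH fC open_ball)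
  ultimately show ?case by (intro Ck_on_SucI[OF open_ball])
qed

lemma smooth_division:
  fixes f :: "real ^ 'k::finite \<Rightarrow> real"
  assumes xb: "xb $ i = 0" and f: "smooth_on (ball xb d) f"
    and 0: "\<And>x. x \<in> ball xb d \<Longrightarrow> x $ i = 0 \<Longrightarrow> f x = 0"
  shows "\<exists>h. smooth_on (ball xb d) h \<and> (\<forall>x\<in>ball xb d. f x = x $ i * h x)"
proof (intro exI conjI ballI)
  let ?e = "axis i 1 :: real ^ 'k"
  let ?h = "weighted_integral i 0 (\<lambda>y. frechet_derivative f (at y) ?e)"
  show "smooth_on (ball xb d) ?h"
    using Ck_on_weighted_integral[OF xb] smooth_on_frechet_derivative[OF f] unfolding smooth_on_def by blast
  fix x assume x: "x \<in> ball xb d"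
  have "((\<lambda>s. f (squeeze i s x)) has_real_derivative
      x $ i * frechet_derivative f (at (squeeze i s x)) ?e) (at s)" if s: "s \<in> {0..1}" for s
  proof -
    have d: "(f has_derivative frechet_derivative f (at (squeeze i s x))) (at (squeeze i s x))"
      by (rule smooth_on_has_derivative[OF open_ball f squeeze_in_ball[OF xb x s]])
    interpret linear "frechet_derivative f (at (squeeze i s x))"
      using d has_derivative_linear by blast
    have eq: "squeeze i s x = (x - (x $ i) *\<^sub>R ?e) + s *\<^sub>R (x $ i) *\<^sub>R ?e" for s
      by (simp add: squeeze_def algebra_simps)
    have "((\<lambda>s. f (squeeze i s x)) has_real_derivative
        frechet_derivative f (at (squeeze i s x)) ((x $ i) *\<^sub>R ?e)) (at s)"
      using has_real_derivative_along_line[OF d[unfolded eq[of s]]] by (simp only: eq)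
    then show ?thesis by (simp only: scaleR real_scaleR_def)
  qed
  then have "((\<lambda>s. x $ i * frechet_derivative f (at (squeeze i s x)) ?e) has_integral
      f (squeeze i 1 x) - f (squeeze i 0 x)) {0..1}"
    by (intro fundamental_theorem_of_calculus)
      (auto simp: has_real_derivative_iff_has_vector_derivative[symmetric] intro: has_field_derivative_at_within)
  moreover have "f (squeeze i 0 x) = 0" "squeeze i 1 x = x"
    using squeeze_in_ball[OF xb x, of 0] by (auto simp: squeeze_nth squeeze_def intro: 0)
  ultimately have "((\<lambda>s. x $ i * frechet_derivative f (at (squeeze i s x)) ?e) has_integral f x) {0..1}"
    by simp
  from integral_unique[OF this] show "f x = x $ i * ?h x"
    by (simp add: weighted_integral_def)
qed


subsection \<open>Partial derivatives and homogeneous functions\<close>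

lemma pderiv_atI: "(f has_derivative f') (at x) \<Longrightarrow> pderiv_at I f x = f' (axis I 1)"
  by (simp add: pderiv_at_def frechet_derivativeI)

lemma has_derivative_pderiv:
  fixes f :: "real ^ 'm::finite \<Rightarrow> real"
  assumes "f differentiable at x"
  shows "(f has_derivative (\<lambda>v. \<Sum>I\<in>UNIV. v $ I * pderiv_at I f x)) (at x)"
proof -
  have d: "(f has_derivative frechet_derivative f (at x)) (at x)"
    using assms by (rule differentiable_has_derivative)
  interpret linear "frechet_derivative f (at x)"
    using d has_derivative_linear by blast
  have "frechet_derivative f (at x) v = (\<Sum>I\<in>UNIV. v $ I * pderiv_at I f x)" for v
  proof -
    have "frechet_derivative f (at x) v = frechet_derivative f (at x) (\<Sum>I\<in>UNIV. v $ I *\<^sub>R axis I 1)"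
      by (subst basis_expansion[of v, unfolded scalar_mult_eq_scaleR, symmetric]) (rule refl)
    then show ?thesis by (simp add: sum scaleR pderiv_at_def)
  qed
  then show ?thesis using d by (metis (no_types, lifting) ext)
qed

lemma pderiv_cong:
  assumes "open W" "x \<in> W" "\<And>y. y \<in> W \<Longrightarrow> f y = g y"
  shows "pderiv_at I f x = pderiv_at I g x"
proof -
  have "(f has_derivative d) (at x) \<longleftrightarrow> (g has_derivative d) (at x)" for d
    using has_derivative_transform_within_open[OF _ assms(1,2)] assms(3) by metis
  then show ?thesis by (simp add: pderiv_at_def frechet_derivative_def)
qed

lemma pderiv_const: "pderiv_at I (\<lambda>x. c) x = 0"
  by (simp add: pderiv_at_def)

locale open_set =
  fixes W :: "(real ^ 'm::finite) set"
  assumes W: "open W"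
begin

lemma smooth_differentiable: "smooth_on W f \<Longrightarrow> x \<in> W \<Longrightarrow> f differentiable at x"
  by (rule smooth_on_imp_differentiable[OF W])

lemmas smooth_has_derivative = has_derivative_pderiv[OF smooth_differentiable]

lemma pderiv_add:
  "smooth_on W f \<Longrightarrow> smooth_on W g \<Longrightarrow> x \<in> W \<Longrightarrow>
    pderiv_at I (\<lambda>x. f x + g x) x = pderiv_at I f x + pderiv_at I g x"
  by (subst pderiv_atI[OF has_derivative_add[OF smooth_has_derivative smooth_has_derivative]])
    (auto simp: axis_def if_distrib[of "\<lambda>z. z * _"] cong: if_cong)

lemma pderiv_mult:
  "smooth_on W f \<Longrightarrow> smooth_on W g \<Longrightarrow> x \<in> W \<Longrightarrow>
    pderiv_at I (\<lambda>x. f x * g x) x = f x * pderiv_at I g x + pderiv_at I f x * g x"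
  by (subst pderiv_atI[OF has_derivative_mult[OF smooth_has_derivative smooth_has_derivative]])
    (auto simp: axis_def if_distrib[of "\<lambda>z. z * _"] cong: if_cong)

lemma pderiv_cmult: "smooth_on W g \<Longrightarrow> x \<in> W \<Longrightarrow> pderiv_at I (\<lambda>x. c * g x) x = c * pderiv_at I g x"
  by (simp add: pderiv_mult[OF smooth_on_const] pderiv_const)

lemma pderiv_minus: "smooth_on W g \<Longrightarrow> x \<in> W \<Longrightarrow> pderiv_at I (\<lambda>x. - g x) x = - pderiv_at I g x"
  using pderiv_cmult[of g x I "-1"] by simp

lemma pderiv_diff:
  "smooth_on W f \<Longrightarrow> smooth_on W g \<Longrightarrow> x \<in> W \<Longrightarrow>
    pderiv_at I (\<lambda>x. f x - g x) x = pderiv_at I f x - pderiv_at I g x"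
  using pderiv_add[OF _ smooth_on_minus[OF W], of f g x I] by (simp add: pderiv_minus)

lemma pderiv_power:
  "smooth_on W f \<Longrightarrow> x \<in> W \<Longrightarrow>
    pderiv_at I (\<lambda>x. f x ^ Suc n) x = real (Suc n) * f x ^ n * pderiv_at I f x"
proof (induction n)
  case (Suc n)
  have "pderiv_at I (\<lambda>x. f x ^ Suc (Suc n)) x = pderiv_at I (\<lambda>x. f x * f x ^ Suc n) x"
    by simp
  also have "\<dots> = f x * pderiv_at I (\<lambda>x. f x ^ Suc n) x + pderiv_at I f x * f x ^ Suc n"
    by (rule pderiv_mult) (use Suc in \<open>auto intro: smooth_on_power[OF W] simp del: power_Suc\<close>)
  finally show ?case using Suc by (simp add: algebra_simps)
qed simp

lemma smooth_pderiv: "smooth_on W f \<Longrightarrow> smooth_on W (pderiv_at I f)"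
  unfolding pderiv_at_def[abs_def] by (rule smooth_on_frechet_derivative)

lemma smooth_nth: "smooth_on W (\<lambda>x. x $ I)"
  by (rule smooth_on_bounded_linear[OF W bounded_linear_vec_nth])

lemma pderiv_commute:
  "smooth_on W f \<Longrightarrow> x \<in> W \<Longrightarrow> pderiv_at I (pderiv_at J f) x = pderiv_at J (pderiv_at I f) x"
  using deriv2_commute[OF W, of f x "axis I 1" "axis J 1"]
  by (simp add: smooth_on_Ck pderiv_at_def[abs_def] deriv2_def)

lemma smooth_cong: "smooth_on W f \<Longrightarrow> (\<And>x. x \<in> W \<Longrightarrow> f x = g x) \<Longrightarrow> smooth_on W g"
  using smooth_on_cong[OF W] by blast

lemmas smooth = smooth_intros(1) smooth_intros(2-)[OF W] smooth_pderiv smooth_nth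

end

definition homog_on :: "(real ^ 'm) set \<Rightarrow> real \<Rightarrow> (real ^ 'm \<Rightarrow> real) \<Rightarrow> bool" where
  "homog_on W s f \<longleftrightarrow> (\<forall>x\<in>W. \<forall>t>0. f (t *\<^sub>R x) = t powr s * f x)"

locale open_cone = open_set W for W :: "(real ^ 'm::finite) set" +
  assumes cone: "x \<in> W \<Longrightarrow> t > 0 \<Longrightarrow> t *\<^sub>R x \<in> W"
begin

lemma homogD: "homog_on W s f \<Longrightarrow> x \<in> W \<Longrightarrow> t > 0 \<Longrightarrow> f (t *\<^sub>R x) = t powr s * f x"
  by (simp add: homog_on_def)

lemma homog_mult: "homog_on W s f \<Longrightarrow> homog_on W s' g \<Longrightarrow> homog_on W (s + s') (\<lambda>x. f x * g x)"
  by (simp add: homog_on_def powr_add)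

lemma homog_cmult: "homog_on W s f \<Longrightarrow> homog_on W s (\<lambda>x. c * f x)"
  by (simp add: homog_on_def)

lemma homog_add: "homog_on W s f \<Longrightarrow> homog_on W s g \<Longrightarrow> homog_on W s (\<lambda>x. f x + g x)"
  by (simp add: homog_on_def algebra_simps)

lemma homog_minus: "homog_on W s f \<Longrightarrow> homog_on W s (\<lambda>x. - f x)"
  by (simp add: homog_on_def)

lemma homog_diff: "homog_on W s f \<Longrightarrow> homog_on W s g \<Longrightarrow> homog_on W s (\<lambda>x. f x - g x)"
  by (simp add: homog_on_def algebra_simps)

lemma homog_sum: "(\<And>i. i \<in> A \<Longrightarrow> homog_on W s (f i)) \<Longrightarrow> homog_on W s (\<lambda>x. \<Sum>i\<in>A. f i x)"
  by (simp add: homog_on_def sum_distrib_left)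

lemma homog_const: "homog_on W 0 (\<lambda>x. c)"
  by (simp add: homog_on_def)

lemma homog_power: "homog_on W s f \<Longrightarrow> homog_on W (real n * s) (\<lambda>x. f x ^ n)"
  by (simp add: homog_on_def power_mult_distrib powr_powr[symmetric] powr_realpow mult.commute[of _ s])

lemma homog_cong: "homog_on W s f \<Longrightarrow> (\<And>x. x \<in> W \<Longrightarrow> f x = g x) \<Longrightarrow> homog_on W s g"
  using cone by (simp add: homog_on_def)

lemma homog_pderiv:
  assumes f: "smooth_on W f" "homog_on W s f"
  shows "homog_on W (s - 1) (pderiv_at I f)"
  unfolding homog_on_def
proof (intro ballI allI impI)
  fix x and t :: real assume x: "x \<in> W" and t: "t > 0"
  have tx: "t *\<^sub>R x \<in> W" using cone x t .
  have "((\<lambda>y. f (t *\<^sub>R y)) has_derivative (\<lambda>v. \<Sum>I\<in>UNIV. (t *\<^sub>R v) $ I * pderiv_at I f (t *\<^sub>R x))) (at x)"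
    by (rule has_derivative_compose[of "\<lambda>y. t *\<^sub>R y" "\<lambda>v. t *\<^sub>R v", OF _ smooth_has_derivative[OF f(1) tx]])
      (auto intro!: derivative_eq_intros)
  note der = this
  have "pderiv_at I (\<lambda>y. f (t *\<^sub>R y)) x = t * pderiv_at I f (t *\<^sub>R x)"
    unfolding pderiv_atI[OF der]
    by (simp add: axis_def if_distrib[of "\<lambda>z. z * _"] if_distrib[of "\<lambda>z. _ * z"] cong: if_cong)
  moreover have "pderiv_at I (\<lambda>y. f (t *\<^sub>R y)) x = t powr s * pderiv_at I f x"
    unfolding pderiv_cmult[OF f(1) x, symmetric]
    by (rule pderiv_cong[OF W x]) (simp add: homogD[OF f(2)] t)
  ultimately show "pderiv_at I f (t *\<^sub>R x) = t powr (s - 1) * pderiv_at I f x"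
    using t by (simp add: powr_diff field_simps)
qed

lemma euler:
  assumes f: "smooth_on W f" "homog_on W s f" and x: "x \<in> W"
  shows "(\<Sum>I\<in>UNIV. x $ I * pderiv_at I f x) = s * f x"
proof -
  have "((\<lambda>t. f (0 + t *\<^sub>R x)) has_real_derivative (\<Sum>I\<in>UNIV. x $ I * pderiv_at I f x)) (at 1)"
    by (rule has_real_derivative_along_line) (simp add: smooth_has_derivative f x)
  then have "((\<lambda>t. t powr s * f x) has_real_derivative (\<Sum>I\<in>UNIV. x $ I * pderiv_at I f x)) (at 1)"
    by (rule has_field_derivative_transform_within_open[of _ _ _ "{0<..}"]) (auto simp: homogD f x)
  moreover have "((\<lambda>t. t powr s * f x) has_real_derivative s * f x) (at 1)"
    by (auto intro!: derivative_eq_intros)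
  ultimately show ?thesis by (rule DERIV_unique)
qed

end


subsection \<open>Determinants and inverse matrices\<close>

lemma has_derivative_det:
  fixes A :: "'a::real_normed_vector \<Rightarrow> real ^ 'm ^ 'm::finite"
  assumes A: "\<And>i j. ((\<lambda>x. A x $ i $ j) has_derivative A' i j) (at x)"
  shows "((\<lambda>x. det (A x)) has_derivative
    (\<lambda>v. \<Sum>k\<in>UNIV. det (\<chi> i j. if i = k then A' k j v else A x $ i $ j))) (at x)"
proof -
  have e: "(\<Prod>i\<in>UNIV. if i = k then F i else G i) = F k * (\<Prod>i\<in>UNIV - {k}. G i)"
    for k :: 'm and F G :: "'m \<Rightarrow> real"
    by (subst prod.remove[of UNIV k]) (auto intro!: prod.cong)
  have "((\<lambda>x. \<Sum>p | p permutes UNIV. of_int (sign p) * (\<Prod>i\<in>UNIV. A x $ i $ p i)) has_derivative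
      (\<lambda>v. \<Sum>p | p permutes UNIV. of_int (sign p) * (\<Sum>k\<in>UNIV. A' k (p k) v * (\<Prod>j\<in>UNIV - {k}. A x $ j $ p j)))) (at x)"
    by (intro has_derivative_sum has_derivative_mult_right has_derivative_prod A)
  then show ?thesis
    unfolding det_def
    by (rule has_derivative_eq_rhs)
      (auto simp: fun_eq_iff sum_distrib_left e sum.swap[of _ "{p. p permutes UNIV}"] if_distrib[of "\<lambda>f. f _"]
        intro!: sum.cong cong: if_cong)
qed

lemma matrix_inv_cancel:
  fixes A :: "real ^ 'm ^ 'm::finite"
  assumes "det A \<noteq> 0"
  shows "A ** matrix_inv A = mat 1" "matrix_inv A ** A = mat 1"
proof -
  have "\<exists>B. A ** B = mat 1 \<and> B ** A = mat 1"
    using assms invertible_det_nz unfolding invertible_def by blast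
  from someI_ex[OF this] show "A ** matrix_inv A = mat 1" "matrix_inv A ** A = mat 1"
    by (auto simp: matrix_inv_def)
qed

lemma matrix_inv_sum:
  fixes A :: "real ^ 'm ^ 'm::finite"
  assumes "det A \<noteq> 0"
  shows "(\<Sum>K\<in>UNIV. A $ I $ K * matrix_inv A $ K $ J) = (if I = J then 1 else 0)"
    and "(\<Sum>K\<in>UNIV. matrix_inv A $ I $ K * A $ K $ J) = (if I = J then 1 else 0)"
  using matrix_inv_cancel[OF assms] by (simp_all add: vec_eq_iff matrix_matrix_mult_def mat_def)

lemma det_replace_row:
  fixes A :: "real ^ 'm ^ 'm::finite"
  assumes "det A \<noteq> 0"
  shows "det (\<chi> i j. if i = k then b j else A $ i $ j) =
    (\<Sum>j\<in>UNIV. b j * matrix_inv A $ j $ k) * det A"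
proof -
  define x where "x = (\<chi> i. \<Sum>j\<in>UNIV. b j * matrix_inv A $ j $ i)"
  have "(\<Sum>i\<in>UNIV. x $ i * A $ i $ j) = b j" for j
  proof -
    have "(\<Sum>i\<in>UNIV. x $ i * A $ i $ j) = (\<Sum>l\<in>UNIV. b l * (\<Sum>i\<in>UNIV. matrix_inv A $ l $ i * A $ i $ j))"
      unfolding x_def by (simp add: sum_distrib_left sum_distrib_right mult.assoc) (rule sum.swap)
    also have "\<dots> = b j" by (simp add: matrix_inv_sum[OF assms] if_distrib cong: if_cong)
    finally show ?thesis .
  qed
  then have "(\<chi> i j. if i = k then b j else A $ i $ j) =
      (\<chi> i. if i = k then sum (\<lambda>i. x $ i *s row i A) UNIV else row i A)"
    by (auto simp: vec_eq_iff row_def)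
  then show ?thesis by (simp only: cramer_lemma_transpose) (simp add: x_def)
qed

lemma jacobi_formula:
  fixes A :: "'a::real_normed_vector \<Rightarrow> real ^ 'm ^ 'm::finite"
  assumes A: "\<And>i j. ((\<lambda>x. A x $ i $ j) has_derivative A' i j) (at x)" and nz: "det (A x) \<noteq> 0"
  shows "((\<lambda>x. det (A x)) has_derivative
    (\<lambda>v. det (A x) * (\<Sum>k\<in>UNIV. \<Sum>j\<in>UNIV. A' k j v * matrix_inv (A x) $ j $ k))) (at x)"
  by (rule has_derivative_eq_rhs[OF has_derivative_det[OF A]])
    (simp add: fun_eq_iff det_replace_row[OF nz] sum_distrib_left sum_distrib_right mult.commute)

lemma matrix_inv_entry:
  fixes A :: "real ^ 'm ^ 'm::finite"
  assumes "det A \<noteq> 0"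
  shows "matrix_inv A $ k $ l = det (\<chi> i j. if j = k then (if i = l then 1 else 0) else A $ i $ j) / det A"
proof -
  have "A *v (\<chi> i. matrix_inv A $ i $ l) = (\<chi> i. if i = l then 1 else 0)"
    using matrix_inv_sum(1)[OF assms] by (simp add: vec_eq_iff matrix_vector_mult_def)
  then have "(\<chi> i. matrix_inv A $ i $ l) =
      (\<chi> k. det (\<chi> i j. if j = k then (\<chi> i. if i = l then 1 else 0) $ i else A $ i $ j) / det A)"
    using cramer[OF assms] by blast
  then have "(\<chi> i. matrix_inv A $ i $ l) $ k = 
      (\<chi> k. det (\<chi> i j. if j = k then (\<chi> i. if i = l then 1 else 0) $ i else A $ i $ j) / det A) $ k"
    by simp
  then show ?thesis by (simp cong: if_cong)
qed

lemma smooth_on_det: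
  fixes A :: "'a::real_normed_vector \<Rightarrow> real ^ 'm ^ 'm::finite"
  assumes "open W" "\<And>i j. smooth_on W (\<lambda>x. A x $ i $ j)"
  shows "smooth_on W (\<lambda>x. det (A x))"
  unfolding det_def by (intro smooth_intros assms)

lemma smooth_on_matrix_inv:
  fixes A :: "'a::real_normed_vector \<Rightarrow> real ^ 'm ^ 'm::finite"
  assumes "open W" "\<And>i j. smooth_on W (\<lambda>x. A x $ i $ j)" "\<And>x. x \<in> W \<Longrightarrow> det (A x) \<noteq> 0"
  shows "smooth_on W (\<lambda>x. matrix_inv (A x) $ k $ l)"
proof -
  have "smooth_on W (\<lambda>x. (\<chi> i j. if j = k then (if i = l then 1 else 0) else A x $ i $ j) $ i $ j)" for i j :: 'm
    by (cases "j = k") (simp_all add: assms smooth_on_const)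
  then have "smooth_on W (\<lambda>x. det (\<chi> i j. if j = k then (if i = l then 1 else 0) else A x $ i $ j) / det (A x))"
    by (intro smooth_on_divide smooth_on_det assms) auto
  then show ?thesis
    by (rule smooth_on_cong[OF assms(1)]) (simp add: matrix_inv_entry assms(3))
qed

section \<open>The ambient metric of a homogeneous function\<close>

definition tr2 :: "real ^ 'm ^ 'm \<Rightarrow> ('m::finite \<Rightarrow> 'm \<Rightarrow> real) \<Rightarrow> real" where
  "tr2 G A = (\<Sum>I\<in>UNIV. \<Sum>J\<in>UNIV. G $ I $ J * A I J)"

lemma tr2_add: "tr2 G (\<lambda>I J. A I J + B I J) = tr2 G A + tr2 G B"
  by (simp add: tr2_def sum.distrib algebra_simps)

lemma tr2_cmult: "tr2 G (\<lambda>I J. c * A I J) = c * tr2 G A"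
  by (simp add: tr2_def sum_distrib_left algebra_simps)

lemma tr2_swap:
  assumes "\<And>I J. G $ I $ J = G $ J $ I"
  shows "tr2 G (\<lambda>I J. A J I) = tr2 G A"
  unfolding tr2_def by (subst sum.swap) (simp add: assms)

lemma tr2_outer: "tr2 G (\<lambda>I J. u I * v J) = (\<Sum>I\<in>UNIV. u I * (\<Sum>J\<in>UNIV. G $ I $ J * v J))"
  by (simp add: tr2_def sum_distrib_left algebra_simps)

lemma tr2_matrix_inv:
  fixes M :: "real ^ 'm ^ 'm::finite"
  assumes "det M \<noteq> 0" "\<And>I J. M $ I $ J = M $ J $ I"
  shows "tr2 (matrix_inv M) (\<lambda>I J. M $ I $ J) = real CARD('m)"
proof -
  have "tr2 (matrix_inv M) (\<lambda>I J. M $ I $ J) = (\<Sum>I\<in>UNIV. \<Sum>J\<in>UNIV. matrix_inv M $ I $ J * M $ J $ I)"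
    unfolding tr2_def by (intro sum.cong refl) (metis assms(2))
  then show ?thesis by (simp add: matrix_inv_sum(2)[OF assms(1)])
qed

lemma matrix_inv_symmetric:
  fixes M :: "real ^ 'm ^ 'm::finite"
  assumes "det M \<noteq> 0" "\<And>I J. M $ I $ J = M $ J $ I"
  shows "matrix_inv M $ I $ J = matrix_inv M $ J $ I"
proof -
  have T: "transpose M = M" using assms(2) by (simp add: vec_eq_iff transpose_def)
  have "matrix_inv M = matrix_inv M ** (M ** transpose (matrix_inv M))"
    using matrix_inv_cancel(2)[OF assms(1), THEN arg_cong[of _ _ transpose], unfolded matrix_transpose_mul T transpose_mat]
    by (simp only: matrix_mul_rid)
  also have "\<dots> = transpose (matrix_inv M)"
    by (simp add: matrix_mul_assoc matrix_inv_cancel[OF assms(1)])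
  finally have "matrix_inv M $ I $ J = transpose (matrix_inv M) $ I $ J" by (rule arg_cong)
  then show ?thesis by (simp add: transpose_def)
qed

lemma matrix_inv_solve:
  fixes M :: "real ^ 'm ^ 'm::finite"
  assumes "det M \<noteq> 0" "\<And>I. (\<Sum>J\<in>UNIV. M $ I $ J * x J) = b I"
  shows "(\<Sum>J\<in>UNIV. matrix_inv M $ I $ J * b J) = x I"
proof -
  have "(\<Sum>J\<in>UNIV. matrix_inv M $ I $ J * b J) = (\<Sum>K\<in>UNIV. (\<Sum>J\<in>UNIV. matrix_inv M $ I $ J * M $ J $ K) * x K)"
    unfolding assms(2)[symmetric] sum_distrib_left sum_distrib_right
    by (subst sum.swap) (simp add: algebra_simps)
  also have "\<dots> = x I"
    by (simp add: matrix_inv_sum(2)[OF assms(1)] if_distrib[of "\<lambda>z. z * _"] cong: if_cong)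
  finally show ?thesis .
qed

locale nondegenerate = open_cone W for W :: "(real ^ 'm::finite) set" +
  fixes r :: "real ^ 'm \<Rightarrow> real"
  assumes r_smooth: "smooth_on W r" and r_homog: "homog_on W 2 r"
    and det_nz: "x \<in> W \<Longrightarrow> det (hessian r x) \<noteq> 0"
    and zero_notin: "0 \<notin> W"
begin

definition G :: "real ^ 'm \<Rightarrow> real ^ 'm ^ 'm" where "G x = matrix_inv (hessian r x)"

definition flat_lap :: "(real ^ 'm \<Rightarrow> real) \<Rightarrow> real ^ 'm \<Rightarrow> real" where
  "flat_lap f x = tr2 (G x) (\<lambda>I J. pderiv_at I (pderiv_at J f) x)"

definition ip :: "(real ^ 'm \<Rightarrow> real) \<Rightarrow> (real ^ 'm \<Rightarrow> real) \<Rightarrow> real ^ 'm \<Rightarrow> real" where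
  "ip f h x = tr2 (G x) (\<lambda>I J. pderiv_at I f x * pderiv_at J h x)"

lemma hessian_nth: "hessian f x $ I $ J = pderiv_at I (pderiv_at J f) x"
  by (simp add: hessian_def)

lemma hessian_sym: "smooth_on W f \<Longrightarrow> x \<in> W \<Longrightarrow> hessian f x $ I $ J = hessian f x $ J $ I"
  by (simp add: hessian_nth pderiv_commute)

lemma hessian_smooth: "smooth_on W f \<Longrightarrow> smooth_on W (\<lambda>x. hessian f x $ I $ J)"
  unfolding hessian_nth by (intro smooth)

lemma G_smooth: "smooth_on W (\<lambda>x. G x $ I $ J)"
  unfolding G_def by (intro smooth_on_matrix_inv W hessian_smooth r_smooth det_nz)

lemma G_sym: "x \<in> W \<Longrightarrow> G x $ I $ J = G x $ J $ I"
  unfolding G_def by (rule matrix_inv_symmetric) (simp_all add: det_nz hessian_sym r_smooth)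

lemma ip_sym: "x \<in> W \<Longrightarrow> ip f h x = ip h f x"
  unfolding ip_def by (subst tr2_swap[OF G_sym, symmetric]) (simp_all add: mult.commute)

lemma G_homog: "homog_on W 0 (\<lambda>x. G x $ I $ J)"
proof -
  have "homog_on W (2 - 1 - 1) (\<lambda>x. hessian r x $ I $ J)" for I J
    unfolding hessian_nth by (intro homog_pderiv smooth_pderiv r_smooth r_homog)
  then have "hessian r (t *\<^sub>R x) = hessian r x" if "x \<in> W" "t > 0" for x t
    using that by (simp add: homog_on_def vec_eq_iff)
  then show ?thesis by (simp add: homog_on_def G_def)
qed

lemma hessian_euler:
  assumes "smooth_on W f" "homog_on W s f" "x \<in> W"
  shows "(\<Sum>J\<in>UNIV. pderiv_at I (pderiv_at J f) x * x $ J) = (s - 1) * pderiv_at I f x"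
  using euler[OF smooth_pderiv[OF assms(1)] homog_pderiv[OF assms(1,2)] assms(3), of I]
  by (simp add: pderiv_commute[OF assms(1,3), of I] mult.commute)

lemma G_dr: "x \<in> W \<Longrightarrow> (\<Sum>J\<in>UNIV. G x $ I $ J * pderiv_at J r x) = x $ I"
  unfolding G_def
  by (rule matrix_inv_solve[OF det_nz])
    (use hessian_euler[OF r_smooth r_homog] in \<open>simp_all add: hessian_nth\<close>)

lemma ip_r: "smooth_on W f \<Longrightarrow> homog_on W s f \<Longrightarrow> x \<in> W \<Longrightarrow> ip f r x = s * f x"
  unfolding ip_def tr2_outer using G_dr euler[of f s x] by (simp add: mult.commute)

lemma ip_rr: "x \<in> W \<Longrightarrow> ip r r x = 2 * r x"
  by (rule ip_r[OF r_smooth r_homog])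

lemma flat_lap_r: "x \<in> W \<Longrightarrow> flat_lap r x = real CARD('m)"
  unfolding flat_lap_def G_def hessian_nth[symmetric]
  by (rule tr2_matrix_inv) (simp_all add: det_nz hessian_sym r_smooth)

lemma flat_lap_smooth: "smooth_on W f \<Longrightarrow> smooth_on W (flat_lap f)"
  unfolding flat_lap_def[abs_def] tr2_def by (intro smooth G_smooth)

lemma ip_smooth: "smooth_on W f \<Longrightarrow> smooth_on W h \<Longrightarrow> smooth_on W (ip f h)"
  unfolding ip_def[abs_def] tr2_def by (intro smooth G_smooth)

lemma flat_lap_homog: "smooth_on W f \<Longrightarrow> homog_on W s f \<Longrightarrow> homog_on W (s - 2) (flat_lap f)"
proof -
  assume f: "smooth_on W f" "homog_on W s f"
  have "homog_on W (0 + (s - 1 - 1)) (\<lambda>x. G x $ I $ J * pderiv_at I (pderiv_at J f) x)" for I J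
    by (intro homog_mult G_homog homog_pderiv smooth_pderiv f)
  then show ?thesis
    unfolding flat_lap_def[abs_def] tr2_def by (intro homog_sum) simp
qed

lemma hessian_mult:
  assumes "smooth_on W f" "smooth_on W h" "x \<in> W"
  shows "pderiv_at I (pderiv_at J (\<lambda>y. f y * h y)) x =
    f x * pderiv_at I (pderiv_at J h) x + pderiv_at I f x * pderiv_at J h x
    + (pderiv_at J f x * pderiv_at I h x + pderiv_at I (pderiv_at J f) x * h x)"
proof -
  have "pderiv_at I (pderiv_at J (\<lambda>y. f y * h y)) x =
      pderiv_at I (\<lambda>y. f y * pderiv_at J h y + pderiv_at J f y * h y) x"
    by (rule pderiv_cong[OF W assms(3)]) (simp add: pderiv_mult assms)
  also have "\<dots> = pderiv_at I (\<lambda>y. f y * pderiv_at J h y) x + pderiv_at I (\<lambda>y. pderiv_at J f y * h y) x"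
    by (intro pderiv_add smooth assms)
  also have "\<dots> = (f x * pderiv_at I (pderiv_at J h) x + pderiv_at I f x * pderiv_at J h x)
      + (pderiv_at J f x * pderiv_at I h x + pderiv_at I (pderiv_at J f) x * h x)"
    by (intro arg_cong2[of _ _ _ _ "(+)"] pderiv_mult smooth assms)
  finally show ?thesis .
qed

lemma flat_lap_mult:
  assumes "smooth_on W f" "smooth_on W h" "x \<in> W"
  shows "flat_lap (\<lambda>y. f y * h y) x = f x * flat_lap h x + 2 * ip f h x + h x * flat_lap f x"
proof -
  have "flat_lap (\<lambda>y. f y * h y) x = f x * flat_lap h x + ip f h x
      + (tr2 (G x) (\<lambda>I J. pderiv_at J f x * pderiv_at I h x) + h x * flat_lap f x)"
    unfolding flat_lap_def hessian_mult[OF assms] ip_def mult.commute[of _ "h x"] by (simp only: tr2_add tr2_cmult)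
  also have "tr2 (G x) (\<lambda>I J. pderiv_at J f x * pderiv_at I h x) = ip f h x"
    unfolding ip_def using tr2_swap[OF G_sym[OF assms(3)], of "\<lambda>I J. pderiv_at I f x * pderiv_at J h x"] by simp
  finally show ?thesis by simp
qed

lemma dr_nonzero: "x \<in> W \<Longrightarrow> \<exists>I. pderiv_at I r x \<noteq> 0"
proof (rule ccontr)
  assume x: "x \<in> W" and "\<nexists>I. pderiv_at I r x \<noteq> 0"
  then have "x $ I = 0" for I using G_dr[OF x, of I] by simp
  then have "x = 0" by (simp add: vec_eq_iff)
  then show False using x zero_notin by simp
qed

lemma zero_set_nowhere_dense:
  assumes "x \<in> W" "open U" "x \<in> U"
  shows "\<exists>y\<in>U \<inter> W. r y \<noteq> 0"
proof (rule ccontr)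
  assume "\<not> (\<exists>y\<in>U \<inter> W. r y \<noteq> 0)"
  then have "pderiv_at I r x = pderiv_at I (\<lambda>x. 0) x" for I
    using assms W by (intro pderiv_cong[of "U \<inter> W"]) auto
  then show False using dr_nonzero[OF assms(1)] by (simp add: pderiv_const)
qed

definition vanish :: "nat \<Rightarrow> (real ^ 'm \<Rightarrow> real) \<Rightarrow> bool" where
  "vanish p f \<longleftrightarrow> (\<exists>h. smooth_on W h \<and> (\<forall>x\<in>W. f x = r x ^ p * h x))"

lemma vanishI: "smooth_on W h \<Longrightarrow> (\<And>x. x \<in> W \<Longrightarrow> f x = r x ^ p * h x) \<Longrightarrow> vanish p f"
  by (auto simp: vanish_def)

lemma vanishE:
  assumes "vanish p f"
  obtains h where "smooth_on W h" "\<And>x. x \<in> W \<Longrightarrow> f x = r x ^ p * h x"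
  using assms by (auto simp: vanish_def)

lemma vanish_cong: "vanish p f \<Longrightarrow> (\<And>x. x \<in> W \<Longrightarrow> f x = h x) \<Longrightarrow> vanish p h"
  by (auto simp: vanish_def)

lemma vanish_0: "smooth_on W f \<Longrightarrow> vanish 0 f"
  by (rule vanishI) auto

lemma vanish_smooth: "vanish p f \<Longrightarrow> smooth_on W f"
proof (erule vanishE)
  fix h assume h: "smooth_on W h" "\<And>x. x \<in> W \<Longrightarrow> f x = r x ^ p * h x"
  have "smooth_on W (\<lambda>x. r x ^ p * h x)" by (intro smooth r_smooth h)
  then show "smooth_on W f" by (rule smooth_cong) (simp add: h)
qed

lemma vanish_mult:
  assumes "vanish p f" "vanish q h"
  shows "vanish (p + q) (\<lambda>x. f x * h x)"
proof -
  obtain f' h' where "smooth_on W f'" "smooth_on W h'"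
    "\<And>x. x \<in> W \<Longrightarrow> f x = r x ^ p * f' x" "\<And>x. x \<in> W \<Longrightarrow> h x = r x ^ q * h' x"
    using assms by (meson vanishE)
  then show ?thesis
    by (intro vanishI[of "\<lambda>x. f' x * h' x"]) (auto simp: power_add intro!: smooth)
qed

lemma vanish_r: "vanish p (\<lambda>x. r x ^ p)"
  by (rule vanishI[of "\<lambda>x. 1"]) (auto intro: smooth)

lemma vanish_mono: "vanish q f \<Longrightarrow> p \<le> q \<Longrightarrow> vanish p f"
proof -
  assume "vanish q f" "p \<le> q"
  then obtain h where "smooth_on W h" "\<And>x. x \<in> W \<Longrightarrow> f x = r x ^ q * h x" by (auto simp: vanish_def)
  then show ?thesis
    using \<open>p \<le> q\<close> by (intro vanishI[of "\<lambda>x. r x ^ (q - p) * h x"])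
      (auto simp flip: power_add simp: mult.assoc[symmetric] intro!: smooth r_smooth)
qed

lemma vanish_smult: "smooth_on W f \<Longrightarrow> vanish p h \<Longrightarrow> vanish p (\<lambda>x. f x * h x)"
  using vanish_mult[of 0 f p h] vanish_0 by simp

lemma vanish_add: "vanish p f \<Longrightarrow> vanish p h \<Longrightarrow> vanish p (\<lambda>x. f x + h x)"
proof -
  assume "vanish p f" "vanish p h"
  then obtain f' h' where "smooth_on W f'" "smooth_on W h'"
    "\<And>x. x \<in> W \<Longrightarrow> f x = r x ^ p * f' x" "\<And>x. x \<in> W \<Longrightarrow> h x = r x ^ p * h' x"
    by (auto simp: vanish_def)
  then show ?thesis by (intro vanishI[of "\<lambda>x. f' x + h' x"]) (auto simp: algebra_simps intro!: smooth)
qed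

lemma vanish_cmult: "vanish p f \<Longrightarrow> vanish p (\<lambda>x. c * f x)"
  by (rule vanish_smult) (rule smooth)

lemma vanish_minus: "vanish p f \<Longrightarrow> vanish p (\<lambda>x. - f x)"
  using vanish_cmult[of p f "-1"] by simp

lemma vanish_diff: "vanish p f \<Longrightarrow> vanish p h \<Longrightarrow> vanish p (\<lambda>x. f x - h x)"
  using vanish_add[of p f "\<lambda>x. - h x"] vanish_minus by simp

lemma vanish_zero: "vanish p (\<lambda>x. 0)"
  by (rule vanishI[of "\<lambda>x. 0"]) (auto intro: smooth)

lemma vanish_sum: "(\<And>i. i \<in> A \<Longrightarrow> vanish p (f i)) \<Longrightarrow> vanish p (\<lambda>x. \<Sum>i\<in>A. f i x)"
  by (induction A rule: infinite_finite_induct) (auto simp: vanish_zero vanish_add)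

lemma vanish_eq_0: "vanish p f \<Longrightarrow> p > 0 \<Longrightarrow> x \<in> W \<Longrightarrow> r x = 0 \<Longrightarrow> f x = 0"
  by (auto simp: vanish_def)

lemma vanish_pderiv:
  assumes "vanish (Suc p) f"
  shows "vanish p (pderiv_at I f)"
proof -
  obtain h where h: "smooth_on W h" "\<And>x. x \<in> W \<Longrightarrow> f x = r x ^ Suc p * h x"
    using assms by (auto simp: vanish_def)
  have "pderiv_at I f x = r x ^ p * (r x * pderiv_at I h x + real (Suc p) * pderiv_at I r x * h x)" if x: "x \<in> W" for x
  proof -
    have "pderiv_at I f x = pderiv_at I (\<lambda>x. r x ^ Suc p * h x) x"
      by (rule pderiv_cong[OF W x h(2)])
    also have "\<dots> = r x ^ Suc p * pderiv_at I h x + pderiv_at I (\<lambda>x. r x ^ Suc p) x * h x"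
      by (rule pderiv_mult) (auto intro!: smooth h r_smooth x simp del: power_Suc)
    also have "pderiv_at I (\<lambda>x. r x ^ Suc p) x = real (Suc p) * r x ^ p * pderiv_at I r x"
      by (rule pderiv_power[OF r_smooth x])
    finally show ?thesis by (simp add: algebra_simps)
  qed
  then show ?thesis by (rule vanishI[rotated]) (auto intro!: smooth h r_smooth)
qed

end

text \<open>Here \<open>a = n/2\<close>, the dimension of the ambient space is \<open>n + 2 = 2a + 2\<close>.\<close>

locale fefferman = nondegenerate W r for W :: "(real ^ 'm::finite) set" and r +
  fixes \<theta> :: "real ^ 'm \<Rightarrow> real" and a :: nat
  assumes a_pos: "a \<ge> 1" and card_eq: "CARD('m) = 2 * a + 2"
    and \<theta>_smooth: "smooth_on W \<theta>" and \<theta>_homog: "homog_on W (- real (2 * a + 2)) \<theta>"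
    and J_eq: "x \<in> W \<Longrightarrow> det (hessian r x) = - 1 + \<theta> x * r x ^ (a + 1)"
begin

abbreviation lap :: "(real ^ 'm \<Rightarrow> real) \<Rightarrow> real ^ 'm \<Rightarrow> real" where
  "lap \<equiv> laplacian (hessian r)"

text \<open>The first order part of the Laplacian is half the gradient of \<open>ln \<bar>det g\<bar>\<close>, computed here from
  \<open>det g = - 1 + \<theta> r\<^bsup>a+1\<^esup>\<close>.\<close>

definition drift :: "'m \<Rightarrow> real ^ 'm \<Rightarrow> real" where
  "drift K x = r x ^ a * ((real (a + 1) * (\<theta> x * x $ K)
     + r x * (\<Sum>L\<in>UNIV. G x $ K $ L * pderiv_at L \<theta> x)) / (2 * det (hessian r x)))"

lemma pderiv_det:
  assumes "x \<in> W"
  shows "pderiv_at L (\<lambda>x. det (hessian r x)) x = det (hessian r x) * tr2 (G x) (\<lambda>I J. pderiv_at L (\<lambda>y. hessian r y $ I $ J) x)"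
proof -
  have d: "((\<lambda>x. det (hessian r x)) has_derivative (\<lambda>v. det (hessian r x) * (\<Sum>k\<in>UNIV. \<Sum>j\<in>UNIV.
      (\<Sum>I\<in>UNIV. v $ I * pderiv_at I (\<lambda>y. hessian r y $ k $ j) x) * matrix_inv (hessian r x) $ j $ k))) (at x)"
    by (intro jacobi_formula smooth_has_derivative hessian_smooth r_smooth assms det_nz)
  show ?thesis
    unfolding pderiv_atI[OF d]
    by (simp add: tr2_def G_sym[OF assms, of _ "_ :: 'm"] axis_def if_distrib[of "\<lambda>z. z * _"] mult.commute G_def[symmetric] cong: if_cong)
qed

lemma pderiv_J:
  assumes "x \<in> W"
  shows "pderiv_at L (\<lambda>x. det (hessian r x)) x
    = r x ^ a * (real (a + 1) * (\<theta> x * pderiv_at L r x) + r x * pderiv_at L \<theta> x)"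
proof -
  have s: "smooth_on W (\<lambda>x. \<theta> x * r x ^ Suc a)" by (intro smooth \<theta>_smooth r_smooth)
  have "pderiv_at L (\<lambda>x. det (hessian r x)) x = pderiv_at L (\<lambda>x. - 1 + \<theta> x * r x ^ Suc a) x"
    by (rule pderiv_cong[OF W assms]) (simp add: J_eq)
  also have "\<dots> = pderiv_at L (\<lambda>x. \<theta> x * r x ^ Suc a) x"
    by (simp only: pderiv_add[OF smooth(1) s assms] pderiv_const add_0)
  also have "\<dots> = \<theta> x * pderiv_at L (\<lambda>x. r x ^ Suc a) x + pderiv_at L \<theta> x * r x ^ Suc a"
    by (intro pderiv_mult smooth \<theta>_smooth r_smooth assms)
  also have "pderiv_at L (\<lambda>x. r x ^ Suc a) x = real (Suc a) * r x ^ a * pderiv_at L r x"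
    by (rule pderiv_power[OF r_smooth assms])
  finally show ?thesis by (simp add: algebra_simps)
qed

lemma third_derivative_sym:
  assumes "x \<in> W"
  shows "pderiv_at I (\<lambda>y. hessian r y $ J $ L) x = pderiv_at L (\<lambda>y. hessian r y $ I $ J) x"
proof -
  have "pderiv_at I (\<lambda>y. hessian r y $ J $ L) x = pderiv_at I (\<lambda>y. hessian r y $ L $ J) x"
    by (rule pderiv_cong[OF W assms]) (simp add: hessian_sym r_smooth)
  also have "\<dots> = pderiv_at I (pderiv_at L (pderiv_at J r)) x"
    by (simp add: hessian_nth[abs_def])
  also have "\<dots> = pderiv_at L (pderiv_at I (pderiv_at J r)) x"
    by (intro pderiv_commute smooth r_smooth assms)
  finally show ?thesis by (simp add: hessian_nth[abs_def])
qed

lemma christoffel_hessian: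
  assumes "x \<in> W"
  shows "christoffel (hessian r) x K I J = (\<Sum>L\<in>UNIV. G x $ K $ L / 2 * pderiv_at L (\<lambda>y. hessian r y $ I $ J) x)"
proof -
  have "pderiv_at J (\<lambda>y. hessian r y $ I $ L) x = pderiv_at L (\<lambda>y. hessian r y $ I $ J) x" for L
  proof -
    have "pderiv_at J (\<lambda>y. hessian r y $ I $ L) x = pderiv_at L (\<lambda>y. hessian r y $ J $ I) x"
      by (rule third_derivative_sym[OF assms])
    also have "\<dots> = pderiv_at L (\<lambda>y. hessian r y $ I $ J) x"
      by (rule pderiv_cong[OF W assms]) (simp add: hessian_sym r_smooth)
    finally show ?thesis .
  qed
  then show ?thesis
    unfolding christoffel_def G_def[symmetric] by (simp add: third_derivative_sym[OF assms, of I J])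
qed

lemma lap_eq:
  assumes "x \<in> W"
  shows "lap f x = - flat_lap f x + (\<Sum>K\<in>UNIV. drift K x * pderiv_at K f x)"
proof -
  let ?D = "det (hessian r x)" and ?t = "\<lambda>L I J. pderiv_at L (\<lambda>y. hessian r y $ I $ J) x"
  have nz: "?D \<noteq> 0" by (rule det_nz[OF assms])
  have t: "tr2 (G x) (?t L) = pderiv_at L (\<lambda>x. det (hessian r x)) x / ?D" for L
    using pderiv_det[OF assms, of L] nz by simp
  have "(\<Sum>I\<in>UNIV. \<Sum>J\<in>UNIV. G x $ I $ J * christoffel (hessian r) x K I J) = drift K x" for K
  proof -
    have "(\<Sum>I\<in>UNIV. \<Sum>J\<in>UNIV. G x $ I $ J * christoffel (hessian r) x K I J)
        = (\<Sum>I\<in>UNIV. \<Sum>J\<in>UNIV. \<Sum>L\<in>UNIV. G x $ K $ L / 2 * (G x $ I $ J * ?t L I J))"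
      by (simp add: christoffel_hessian[OF assms] sum_distrib_left algebra_simps)
    also have "\<dots> = (\<Sum>I\<in>UNIV. \<Sum>L\<in>UNIV. \<Sum>J\<in>UNIV. G x $ K $ L / 2 * (G x $ I $ J * ?t L I J))"
      by (intro sum.cong refl sum.swap)
    also have "\<dots> = (\<Sum>L\<in>UNIV. \<Sum>I\<in>UNIV. \<Sum>J\<in>UNIV. G x $ K $ L / 2 * (G x $ I $ J * ?t L I J))"
      by (rule sum.swap)
    also have "\<dots> = (\<Sum>L\<in>UNIV. G x $ K $ L / 2 * tr2 (G x) (?t L))"
      by (simp add: tr2_def sum_distrib_left)
    also have "\<dots> = (\<Sum>L\<in>UNIV. r x ^ a / (2 * ?D) * (real (a + 1) * (\<theta> x * (G x $ K $ L * pderiv_at L r x)) + r x * (G x $ K $ L * pderiv_at L \<theta> x)))"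
      unfolding t pderiv_J[OF assms] using nz by (intro sum.cong refl) (simp add: field_simps)
    also have "\<dots> = r x ^ a / (2 * ?D) * (real (a + 1) * (\<theta> x * x $ K) + r x * (\<Sum>L\<in>UNIV. G x $ K $ L * pderiv_at L \<theta> x))"
      by (simp only: sum_distrib_left[symmetric] sum.distrib G_dr[OF assms])
    also have "\<dots> = drift K x"
      unfolding drift_def by (simp only: times_divide_eq_left times_divide_eq_right)
    finally show ?thesis .
  qed
  note drift = this
  have "(\<Sum>I\<in>UNIV. \<Sum>J\<in>UNIV. G x $ I $ J * (\<Sum>K\<in>UNIV. christoffel (hessian r) x K I J * pderiv_at K f x))
      = (\<Sum>I\<in>UNIV. \<Sum>J\<in>UNIV. \<Sum>K\<in>UNIV. G x $ I $ J * christoffel (hessian r) x K I J * pderiv_at K f x)"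
    by (simp add: sum_distrib_left mult.assoc)
  also have "\<dots> = (\<Sum>I\<in>UNIV. \<Sum>K\<in>UNIV. \<Sum>J\<in>UNIV. G x $ I $ J * christoffel (hessian r) x K I J * pderiv_at K f x)"
    by (intro sum.cong refl sum.swap)
  also have "\<dots> = (\<Sum>K\<in>UNIV. \<Sum>I\<in>UNIV. \<Sum>J\<in>UNIV. G x $ I $ J * christoffel (hessian r) x K I J * pderiv_at K f x)"
    by (rule sum.swap)
  also have "\<dots> = (\<Sum>K\<in>UNIV. drift K x * pderiv_at K f x)"
    by (simp add: drift[symmetric] sum_distrib_right)
  finally show ?thesis
    unfolding laplacian_def flat_lap_def tr2_def G_def[symmetric]
    by (simp add: right_diff_distrib sum_subtractf)
qed

lemma drift_vanish: "vanish a (drift K)"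
  unfolding drift_def[abs_def]
  by (rule vanishI[OF _ refl], intro smooth_on_divide W smooth \<theta>_smooth r_smooth G_smooth smooth_on_det hessian_smooth)
    (simp add: det_nz)

lemma drift_smooth: "smooth_on W (drift K)"
  using drift_vanish by (rule vanish_smooth)

lemma drift_r:
  assumes "x \<in> W"
  shows "(\<Sum>K\<in>UNIV. drift K x * pderiv_at K r x) = 0"
proof -
  let ?D = "det (hessian r x)"
  have e: "(\<Sum>K\<in>UNIV. x $ K * pderiv_at K r x) = 2 * r x"
    using euler[OF r_smooth r_homog assms] .
  have "(\<Sum>K\<in>UNIV. (\<Sum>L\<in>UNIV. G x $ K $ L * pderiv_at L \<theta> x) * pderiv_at K r x) = ip r \<theta> x"
    by (simp add: ip_def tr2_outer mult.commute)
  also have "\<dots> = - real (2 * a + 2) * \<theta> x"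
    unfolding ip_sym[OF assms, of r] by (rule ip_r[OF \<theta>_smooth \<theta>_homog assms])
  finally have i: "(\<Sum>K\<in>UNIV. (\<Sum>L\<in>UNIV. G x $ K $ L * pderiv_at L \<theta> x) * pderiv_at K r x) = - real (2 * a + 2) * \<theta> x" .
  have d: "drift K x * pderiv_at K r x = r x ^ a / (2 * ?D) *
      (real (a + 1) * \<theta> x * (x $ K * pderiv_at K r x) + r x * ((\<Sum>L\<in>UNIV. G x $ K $ L * pderiv_at L \<theta> x) * pderiv_at K r x))" for K
  proof -
    define S where "S = (\<Sum>L\<in>UNIV. G x $ K $ L * pderiv_at L \<theta> x)"
    show ?thesis unfolding drift_def S_def[symmetric] by (simp add: algebra_simps add_divide_distrib)
  qed
  have "(\<Sum>K\<in>UNIV. drift K x * pderiv_at K r x) = (\<Sum>K\<in>UNIV. r x ^ a / (2 * ?D) *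
      (real (a + 1) * \<theta> x * (x $ K * pderiv_at K r x) + r x * ((\<Sum>L\<in>UNIV. G x $ K $ L * pderiv_at L \<theta> x) * pderiv_at K r x)))"
    by (simp only: d)
  also have "\<dots> = r x ^ a / (2 * ?D) * (real (a + 1) * \<theta> x * (2 * r x) + r x * (- real (2 * a + 2) * \<theta> x))"
    by (simp only: sum_distrib_left[symmetric] sum.distrib e i)
  also have "\<dots> = 0" by (simp add: algebra_simps)
  finally show ?thesis .
qed

lemma lap_cong: "(\<And>x. x \<in> W \<Longrightarrow> f x = h x) \<Longrightarrow> x \<in> W \<Longrightarrow> lap f x = lap h x"
proof -
  assume fh: "\<And>x. x \<in> W \<Longrightarrow> f x = h x" and x: "x \<in> W"
  have 1: "pderiv_at I f y = pderiv_at I h y" if "y \<in> W" for I y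
    by (rule pderiv_cong[OF W that fh])
  have "pderiv_at I (pderiv_at J f) x = pderiv_at I (pderiv_at J h) x" for I J
    by (rule pderiv_cong[OF W x 1])
  then show ?thesis by (simp add: laplacian_def 1[OF x])
qed

lemma lap_smooth: "smooth_on W f \<Longrightarrow> smooth_on W (lap f)"
  by (rule smooth_cong[of "\<lambda>x. - flat_lap f x + (\<Sum>K\<in>UNIV. drift K x * pderiv_at K f x)"])
    (auto simp: lap_eq intro!: smooth flat_lap_smooth drift_smooth)

lemma drift_homog: "homog_on W (- 1) (drift K)"
proof -
  have D: "hessian r (t *\<^sub>R x) = hessian r x" if "x \<in> W" "t > 0" for x t
  proof -
    have "homog_on W (2 - 1 - 1) (\<lambda>x. hessian r x $ I $ J)" for I J
      unfolding hessian_nth by (intro homog_pderiv smooth_pderiv r_smooth r_homog)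
    then show ?thesis using that by (simp add: homog_on_def vec_eq_iff)
  qed
  have X: "homog_on W 1 (\<lambda>x. x $ K)" by (simp add: homog_on_def)
  have 1: "homog_on W (- real (2 * a + 2) + 1) (\<lambda>x. \<theta> x * x $ K)"
    by (intro homog_mult \<theta>_homog X)
  have "homog_on W (2 + (0 + (- real (2 * a + 2) - 1)))
      (\<lambda>x. r x * (\<Sum>L\<in>UNIV. G x $ K $ L * pderiv_at L \<theta> x))"
    by (intro homog_mult homog_sum homog_pderiv G_homog r_homog \<theta>_homog \<theta>_smooth)
  then have 2: "homog_on W (- real (2 * a + 2) + 1) (\<lambda>x. r x * (\<Sum>L\<in>UNIV. G x $ K $ L * pderiv_at L \<theta> x))"
    by (simp add: algebra_simps)
  have 3: "homog_on W 0 (\<lambda>x. inverse (2 * det (hessian r x)))"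
    by (simp add: homog_on_def D)
  have "homog_on W (real a * 2 + (- real (2 * a + 2) + 1 + 0)) (drift K)"
    unfolding drift_def[abs_def] divide_inverse
    by (intro homog_mult[of _ "\<lambda>x. r x ^ a"] homog_power r_homog homog_mult[OF _ 3] homog_add homog_cmult 1 2)
  then show ?thesis by simp
qed

lemma lap_homog: "smooth_on W f \<Longrightarrow> homog_on W s f \<Longrightarrow> homog_on W (s - 2) (lap f)"
proof -
  assume f: "smooth_on W f" "homog_on W s f"
  have "homog_on W (- 1 + (s - 1)) (\<lambda>x. \<Sum>K\<in>UNIV. drift K x * pderiv_at K f x)"
    by (intro homog_sum homog_mult drift_homog homog_pderiv f)
  then have "homog_on W (s - 2) (\<lambda>x. - flat_lap f x + (\<Sum>K\<in>UNIV. drift K x * pderiv_at K f x))"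
    by (intro homog_add homog_minus flat_lap_homog f) simp
  then show ?thesis by (rule homog_cong) (simp add: lap_eq)
qed

lemma lap_add: "smooth_on W f \<Longrightarrow> smooth_on W h \<Longrightarrow> x \<in> W \<Longrightarrow> lap (\<lambda>y. f y + h y) x = lap f x + lap h x"
proof -
  assume f: "smooth_on W f" "smooth_on W h" and x: "x \<in> W"
  have "pderiv_at I (pderiv_at J (\<lambda>y. f y + h y)) x = pderiv_at I (pderiv_at J f) x + pderiv_at I (pderiv_at J h) x" for I J
  proof -
    have "pderiv_at I (pderiv_at J (\<lambda>y. f y + h y)) x = pderiv_at I (\<lambda>y. pderiv_at J f y + pderiv_at J h y) x"
      by (rule pderiv_cong[OF W x]) (simp add: pderiv_add f)
    then show ?thesis by (simp add: pderiv_add smooth_pderiv f x)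
  qed
  then show ?thesis
    by (simp add: lap_eq[OF x] flat_lap_def tr2_add pderiv_add f x algebra_simps sum.distrib)
qed

lemma lap_mult:
  assumes "smooth_on W f" "smooth_on W h" "x \<in> W"
  shows "lap (\<lambda>y. f y * h y) x = f x * lap h x - 2 * ip f h x + h x * lap f x"
  by (simp add: lap_eq[OF assms(3)] flat_lap_mult assms pderiv_mult algebra_simps sum.distrib sum_distrib_left)

lemma lap_cmult: "smooth_on W f \<Longrightarrow> x \<in> W \<Longrightarrow> lap (\<lambda>y. c * f y) x = c * lap f x"
proof -
  assume f: "smooth_on W f" and x: "x \<in> W"
  have z: "pderiv_at I (\<lambda>y. c) = (\<lambda>y. 0)" for I by (simp add: fun_eq_iff pderiv_const)
  show ?thesis
    unfolding lap_mult[OF smooth(1) f x] by (simp add: ip_def z laplacian_def tr2_def pderiv_const)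
qed

lemma lap_r: "x \<in> W \<Longrightarrow> lap r x = - real (2 * a + 2)"
  by (simp add: lap_eq drift_r flat_lap_r card_eq)

lemma lap_r_mult:
  assumes "smooth_on W f" "homog_on W s f" "x \<in> W"
  shows "lap (\<lambda>y. r y * f y) x = r x * lap f x - (real (2 * a + 2) + 2 * s) * f x"
  using lap_mult[OF r_smooth assms(1,3)] lap_r[OF assms(3)] ip_sym[OF assms(3), of r f] ip_r[OF assms]
  by (simp add: algebra_simps)

lemma vanish_ip_r:
  assumes "smooth_on W h"
  shows "vanish p (ip r (\<lambda>y. r y ^ p * h y))"
proof (induction p)
  case 0
  then show ?case using assms by (intro vanish_0 ip_smooth) (simp_all add: r_smooth)
next
  case (Suc p)
  define f where "f = (\<lambda>y. r y ^ p * h y)"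
  have f: "smooth_on W f" unfolding f_def by (intro smooth r_smooth assms)
  have f': "vanish p f" by (rule vanishI[OF assms]) (simp add: f_def)
  have eq: "ip r (\<lambda>y. r y * f y) x = r x ^ 1 * ip r f x + 2 * (r x ^ 1 * f x)" if x: "x \<in> W" for x
  proof -
    have "ip r (\<lambda>y. r y * f y) x = tr2 (G x) (\<lambda>I J. r x * (pderiv_at I r x * pderiv_at J f x)
        + f x * (pderiv_at I r x * pderiv_at J r x))"
      unfolding ip_def pderiv_mult[OF r_smooth f x] by (simp add: algebra_simps)
    also have "\<dots> = r x * ip r f x + f x * ip r r x"
      by (simp only: tr2_add tr2_cmult ip_def)
    finally show ?thesis by (simp add: ip_rr x)
  qed
  have "vanish (1 + p) (\<lambda>x. r x ^ 1 * ip r f x + 2 * (r x ^ 1 * f x))"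
    by (intro vanish_add vanish_cmult vanish_mult[OF vanish_r] Suc[folded f_def] f')
  then have "vanish (1 + p) (ip r (\<lambda>y. r y * f y))"
    by (rule vanish_cong) (simp only: eq)
  then show ?case by (simp add: mult.assoc f_def)
qed

lemma vanish_lap_power:
  assumes "smooth_on W h"
  shows "vanish p (lap (\<lambda>y. r y ^ Suc p * h y))"
proof (induction p)
  case 0
  show ?case by (intro vanish_0 lap_smooth smooth r_smooth assms)
next
  case (Suc p)
  let ?f = "\<lambda>y. r y ^ Suc p * h y"
  have f: "smooth_on W ?f" by (intro smooth r_smooth assms)
  have "vanish (Suc p) ?f" by (rule vanishI[OF assms]) simp
  moreover have "vanish (1 + p) (\<lambda>x. r x ^ 1 * lap ?f x)"
    by (intro vanish_mult vanish_r Suc)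
  moreover have "vanish (Suc p) (ip r ?f)" by (rule vanish_ip_r[OF assms])
  ultimately have "vanish (Suc p) (\<lambda>x. r x ^ 1 * lap ?f x - 2 * ip r ?f x + lap r x * ?f x)"
    by (intro vanish_add vanish_diff vanish_cmult vanish_smult[OF lap_smooth[OF r_smooth]]) simp_all
  then have "vanish (Suc p) (lap (\<lambda>y. r y * ?f y))"
    by (rule vanish_cong) (simp only: lap_mult[OF r_smooth f] power_one_right mult.commute[of "lap r _"])
  then show ?case by (simp add: mult.assoc)
qed

lemma vanish_lap:
  assumes "vanish (Suc p) f"
  shows "vanish p (lap f)"
proof -
  obtain h where h: "smooth_on W h" "\<And>x. x \<in> W \<Longrightarrow> f x = r x ^ Suc p * h x"
    using assms by (auto simp: vanish_def)
  from vanish_lap_power[OF h(1)] show ?thesis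
    by (rule vanish_cong) (rule lap_cong, simp_all add: h)
qed

lemma lap_pow_smooth: "smooth_on W f \<Longrightarrow> smooth_on W ((lap ^^ m) f)"
  by (induction m) (auto intro: lap_smooth)

lemma lap_pow_homog: "smooth_on W f \<Longrightarrow> homog_on W s f \<Longrightarrow> homog_on W (s - 2 * real m) ((lap ^^ m) f)"
proof (induction m)
  case (Suc m)
  then have "homog_on W (s - 2 * real m - 2) (lap ((lap ^^ m) f))"
    by (intro lap_homog lap_pow_smooth)
  then show ?case by (simp add: algebra_simps)
qed simp

lemma lap_pow_cong: "(\<And>x. x \<in> W \<Longrightarrow> f x = h x) \<Longrightarrow> x \<in> W \<Longrightarrow> (lap ^^ m) f x = (lap ^^ m) h x"
  by (induction m arbitrary: x) (auto intro: lap_cong)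

lemma lap_pow_add:
  assumes "smooth_on W f" "smooth_on W h"
  shows "x \<in> W \<Longrightarrow> (lap ^^ m) (\<lambda>y. f y + h y) x = (lap ^^ m) f x + (lap ^^ m) h x"
proof (induction m arbitrary: x)
  case (Suc m)
  have "lap ((lap ^^ m) (\<lambda>y. f y + h y)) x = lap (\<lambda>x. (lap ^^ m) f x + (lap ^^ m) h x) x"
    by (rule lap_cong[OF Suc.IH Suc.prems])
  then show ?case by (simp add: lap_add lap_pow_smooth assms Suc.prems)
qed simp

lemma lap_pow_cmult:
  assumes "smooth_on W f"
  shows "x \<in> W \<Longrightarrow> (lap ^^ m) (\<lambda>y. c * f y) x = c * (lap ^^ m) f x"
proof (induction m arbitrary: x)
  case (Suc m)
  have "lap ((lap ^^ m) (\<lambda>y. c * f y)) x = lap (\<lambda>x. c * (lap ^^ m) f x) x"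
    by (rule lap_cong[OF Suc.IH Suc.prems])
  then show ?case by (simp add: lap_cmult lap_pow_smooth assms Suc.prems)
qed simp

lemma vanish_lap_pow: "vanish (m + p) f \<Longrightarrow> vanish p ((lap ^^ m) f)"
proof (induction m arbitrary: p)
  case (Suc m)
  then have "vanish (Suc p) ((lap ^^ m) f)" by simp
  then show ?case by (simp add: vanish_lap)
qed simp

definition ladder_coeff :: "nat \<Rightarrow> real \<Rightarrow> real" where
  "ladder_coeff p s = - real p * (2 * real p + 2 * real a + 2 * s)"

lemma lap_power_mult:
  assumes "smooth_on W u" "homog_on W s u"
  shows "x \<in> W \<Longrightarrow> lap (\<lambda>y. r y ^ Suc p * u y) x
    = r x ^ Suc p * lap u x + ladder_coeff (Suc p) s * (r x ^ p * u x)"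
proof (induction p)
  case 0
  then show ?case
    using lap_r_mult[OF assms 0] by (simp add: ladder_coeff_def algebra_simps)
next
  case (Suc p)
  have "homog_on W (real (Suc p) * 2 + s) (\<lambda>y. r y ^ Suc p * u y)"
    by (intro homog_mult homog_power r_homog assms)
  moreover have "smooth_on W (\<lambda>y. r y ^ Suc p * u y)" by (intro smooth r_smooth assms)
  ultimately have "lap (\<lambda>y. r y * (r y ^ Suc p * u y)) x = r x * lap (\<lambda>y. r y ^ Suc p * u y) x
      - (real (2 * a + 2) + 2 * (real (Suc p) * 2 + s)) * (r x ^ Suc p * u x)"
    using lap_r_mult[of "\<lambda>y. r y ^ Suc p * u y"] Suc.prems by blast
  then show ?case
    unfolding Suc.IH[OF Suc.prems] by (simp add: ladder_coeff_def algebra_simps)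
qed

lemma lap_pow_ladder:
  assumes u: "smooth_on W u" "homog_on W s u" and x: "x \<in> W" "r x = 0"
  shows "(lap ^^ p) (\<lambda>y. r y ^ p * u y) x = (\<Prod>i=1..p. ladder_coeff i s) * u x"
proof (induction p)
  case (Suc p)
  have "(lap ^^ Suc p) (\<lambda>y. r y ^ Suc p * u y) x = (lap ^^ p) (lap (\<lambda>y. r y ^ Suc p * u y)) x"
    by (simp only: funpow_Suc_right o_apply)
  also have "\<dots> = (lap ^^ p) (\<lambda>x. r x ^ Suc p * lap u x + ladder_coeff (Suc p) s * (r x ^ p * u x)) x"
    by (rule lap_pow_cong[OF lap_power_mult[OF u] x(1)])
  also have "\<dots> = (lap ^^ p) (\<lambda>x. r x ^ Suc p * lap u x) x + (lap ^^ p) (\<lambda>x. ladder_coeff (Suc p) s * (r x ^ p * u x)) x"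
    by (intro lap_pow_add x smooth r_smooth lap_smooth u)
  also have "(lap ^^ p) (\<lambda>x. r x ^ Suc p * lap u x) x = 0"
  proof (rule vanish_eq_0[of 1])
    show "vanish 1 ((lap ^^ p) (\<lambda>x. r x ^ Suc p * lap u x))"
      by (rule vanish_lap_pow, rule vanishI[OF lap_smooth[OF u(1)]]) simp
  qed (use x in auto)
  also have "(lap ^^ p) (\<lambda>x. ladder_coeff (Suc p) s * (r x ^ p * u x)) x = ladder_coeff (Suc p) s * (lap ^^ p) (\<lambda>x. r x ^ p * u x) x"
    by (intro lap_pow_cmult x smooth r_smooth u)
  finally show ?case using Suc.IH by (simp add: mult.commute)
qed simp

end

section \<open>Contact of two solutions\<close>

lemma det_rank_one:
  fixes X \<alpha> :: "'m::finite \<Rightarrow> real"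
  assumes 0: "(\<Sum>k\<in>UNIV. \<alpha> k * X k) = 0"
  shows "det (\<chi> i j. (if i = j then 1 else 0) + X i * \<alpha> j) = 1"
proof -
  define P :: "real \<Rightarrow> real ^ 'm ^ 'm" where "P = (\<lambda>s. \<chi> i j. (if i = j then 1 else 0) + s * X i * \<alpha> j)"
  have inv: "P s ** P (- s) = mat 1" for s
  proof -
    have "(\<Sum>k\<in>UNIV. ((if i = k then 1 else 0) + s * X i * \<alpha> k) * ((if k = j then 1 else 0) - s * X k * \<alpha> j))
        = (if i = j then 1 else 0)" for i j
    proof -
      have "((if i = k then 1 else 0) + s * X i * \<alpha> k) * ((if k = j then 1 else 0) - s * X k * \<alpha> j)
         = (if i = k then (if k = j then 1 else 0) - s * X k * \<alpha> j else 0) + (if k = j then s * X i * \<alpha> k else 0)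
           - s * s * X i * \<alpha> j * (\<alpha> k * X k)" for k
        by (simp add: algebra_simps)
      then show ?thesis
        by (simp add: sum.distrib sum_subtractf sum_distrib_left[symmetric] 0)
    qed
    then show ?thesis by (simp add: P_def matrix_matrix_mult_def mat_def vec_eq_iff)
  qed
  have nz: "det (P s) \<noteq> 0" for s
    using arg_cong[OF inv[of s], of det] by (auto simp: det_mul)
  have minv: "matrix_inv (P s) = P (- s)" for s
  proof -
    have "matrix_inv (P s) = matrix_inv (P s) ** (P s ** P (- s))" by (simp add: inv)
    then show ?thesis by (simp add: matrix_mul_assoc matrix_inv_cancel[OF nz])
  qed
  have "((\<lambda>s. det (P s)) has_real_derivative 0) (at s)" for s
  proof -
    have d: "((\<lambda>s. det (P s)) has_derivative (\<lambda>v. det (P s) *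
        (\<Sum>k\<in>UNIV. \<Sum>j\<in>UNIV. (v * (X k * \<alpha> j)) * matrix_inv (P s) $ j $ k))) (at s)"
      by (rule jacobi_formula[where A = P]) (auto simp: nz, auto simp: P_def intro!: derivative_eq_intros)
    have "(\<Sum>k\<in>UNIV. \<Sum>j\<in>UNIV. (X k * \<alpha> j) * matrix_inv (P s) $ j $ k)
        = (\<Sum>k\<in>UNIV. \<alpha> k * X k - s * (\<alpha> k * X k) * (\<Sum>j\<in>UNIV. \<alpha> j * X j))"
    proof (rule sum.cong[OF refl])
      fix k
      have "(X k * \<alpha> j) * matrix_inv (P s) $ j $ k = (if j = k then X k * \<alpha> j else 0) - s * (\<alpha> k * X k) * (\<alpha> j * X j)" for j
        unfolding minv by (simp add: P_def algebra_simps)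
      then show "(\<Sum>j\<in>UNIV. (X k * \<alpha> j) * matrix_inv (P s) $ j $ k) = \<alpha> k * X k - s * (\<alpha> k * X k) * (\<Sum>j\<in>UNIV. \<alpha> j * X j)"
        by (simp add: sum_subtractf sum_distrib_left mult.commute)
    qed
    then have "(\<Sum>k\<in>UNIV. \<Sum>j\<in>UNIV. (X k * \<alpha> j) * matrix_inv (P s) $ j $ k) = 0"
      by (simp add: 0)
    moreover have "(\<Sum>k\<in>UNIV. \<Sum>j\<in>UNIV. (v * (X k * \<alpha> j)) * matrix_inv (P s) $ j $ k)
        = v * (\<Sum>k\<in>UNIV. \<Sum>j\<in>UNIV. (X k * \<alpha> j) * matrix_inv (P s) $ j $ k)" for v
      by (simp add: sum_distrib_left mult.assoc)
    moreover have "((*) (0 :: real)) = (\<lambda>v. 0)" by (simp add: fun_eq_iff)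
    ultimately show ?thesis using d by (simp add: has_field_derivative_def)
  qed
  then have "det (P 1) = det (P 0)"
    by (intro DERIV_isconst_all) auto
  also have "P 0 = mat 1" by (simp add: P_def mat_def)
  finally show ?thesis by (simp add: P_def)
qed

text \<open>On the zero set of \<open>r\<close> the Hessian of \<open>r v\<close> is \<open>v P\<^sup>T g P\<close> with the unipotent matrix
  \<open>P = 1 + x (d ln v)\<^sup>T\<close>.\<close>

lemma (in nondegenerate) det_hessian_mult:
  assumes v: "smooth_on W v" "homog_on W 0 v" and x: "x \<in> W" "r x = 0" "v x \<noteq> 0"
  shows "det (hessian (\<lambda>y. r y * v y) x) = v x ^ CARD('m) * det (hessian r x)"
proof -
  define p where "p = (\<lambda>I. pderiv_at I r x)"
  define \<alpha> where "\<alpha> = (\<lambda>I. pderiv_at I v x / v x)"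
  define P :: "real ^ 'm ^ 'm" where "P = (\<chi> i j. (if i = j then 1 else 0) + x $ i * \<alpha> j)"
  have \<alpha>X: "(\<Sum>k\<in>UNIV. \<alpha> k * x $ k) = 0"
  proof -
    have "(\<Sum>k\<in>UNIV. \<alpha> k * x $ k) = (\<Sum>k\<in>UNIV. x $ k * pderiv_at k v x) / v x"
      by (simp add: \<alpha>_def sum_divide_distrib mult.commute)
    then show ?thesis using euler[OF v x(1)] by simp
  qed
  have gX: "(\<Sum>k\<in>UNIV. hessian r x $ i $ k * x $ k) = p i" for i
    using hessian_euler[OF r_smooth r_homog x(1)] by (simp add: hessian_nth p_def)
  have Xp: "(\<Sum>k\<in>UNIV. x $ k * p k) = 0"
    using euler[OF r_smooth r_homog x(1)] x by (simp add: p_def)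
  have gP: "(hessian r x ** P) $ i $ j = hessian r x $ i $ j + p i * \<alpha> j" for i j
  proof -
    have "(hessian r x ** P) $ i $ j = (\<Sum>k\<in>UNIV. (if k = j then hessian r x $ i $ k else 0) + hessian r x $ i $ k * x $ k * \<alpha> j)"
      unfolding matrix_matrix_mult_def P_def
      by (simp, intro sum.cong refl) (simp add: algebra_simps)
    then show ?thesis by (simp add: sum.distrib sum_distrib_right[symmetric] gX)
  qed
  have "(transpose P ** (hessian r x ** P)) $ i $ j = hessian r x $ i $ j + p i * \<alpha> j + \<alpha> i * p j" for i j
  proof -
    define Q where "Q = hessian r x ** P"
    have Q: "Q $ k $ j = hessian r x $ j $ k + p k * \<alpha> j" for k
      unfolding Q_def gP using hessian_sym[OF r_smooth x(1)] by simp
    have "(transpose P ** Q) $ i $ j = (\<Sum>k\<in>UNIV. (if k = i then Q $ k $ j else 0)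
       + \<alpha> i * (x $ k * Q $ k $ j))"
      unfolding matrix_matrix_mult_def P_def transpose_def
      by (simp, intro sum.cong refl) (simp add: algebra_simps)
    also have "\<dots> = Q $ i $ j + \<alpha> i * (\<Sum>k\<in>UNIV. x $ k * Q $ k $ j)"
      by (simp add: sum.distrib sum_distrib_left[symmetric])
    also have "(\<Sum>k\<in>UNIV. x $ k * Q $ k $ j) = (\<Sum>k\<in>UNIV. hessian r x $ j $ k * x $ k + x $ k * p k * \<alpha> j)"
      unfolding Q by (intro sum.cong refl) (simp add: algebra_simps)
    also have "\<dots> = p j"
      by (simp add: sum.distrib sum_distrib_right[symmetric] gX Xp)
    finally show ?thesis by (simp add: gP Q_def)
  qed
  then have "hessian (\<lambda>y. r y * v y) x = (\<chi> i. v x *s (transpose P ** (hessian r x ** P)) $ i)"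
    using x(3) by (simp add: vec_eq_iff hessian_nth hessian_mult[OF r_smooth v(1) x(1)] x(2) \<alpha>_def p_def field_simps)
  then have "det (hessian (\<lambda>y. r y * v y) x) = (\<Prod>i\<in>(UNIV :: 'm set). v x) * det (transpose P ** (hessian r x ** P))"
    by (simp only: det_rows_mul) simp
  moreover have "det P = 1" unfolding P_def by (rule det_rank_one[OF \<alpha>X])
  ultimately show ?thesis by (simp add: det_mul det_transpose)
qed

lemma tendsto_det:
  fixes A :: "'a \<Rightarrow> real ^ 'm ^ 'm::finite"
  assumes "\<And>i j. ((\<lambda>n. A n $ i $ j) \<longlongrightarrow> B $ i $ j) F"
  shows "((\<lambda>n. det (A n)) \<longlongrightarrow> det B) F"
  unfolding det_def by (intro tendsto_intros assms)

lemma tendsto_matrix_inv: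
  fixes A :: "'a \<Rightarrow> real ^ 'm ^ 'm::finite"
  assumes A: "\<And>i j. ((\<lambda>n. A n $ i $ j) \<longlongrightarrow> B $ i $ j) F" and nz: "det B \<noteq> 0"
  shows "((\<lambda>n. matrix_inv (A n) $ k $ l) \<longlongrightarrow> matrix_inv B $ k $ l) F"
proof -
  have D: "((\<lambda>n. det (A n)) \<longlongrightarrow> det B) F" by (rule tendsto_det[OF A])
  have "((\<lambda>n. det (\<chi> i j. if j = k then (if i = l then 1 else 0) else A n $ i $ j)) \<longlongrightarrow>
      det (\<chi> i j. if j = k then (if i = l then 1 else 0) else B $ i $ j)) F"
    by (rule tendsto_det) (simp add: A)
  then have "((\<lambda>n. det (\<chi> i j. if j = k then (if i = l then 1 else 0) else A n $ i $ j) / det (A n)) \<longlongrightarrow>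
      det (\<chi> i j. if j = k then (if i = l then 1 else 0) else B $ i $ j) / det B) F"
    by (intro tendsto_divide D nz)
  moreover have "eventually (\<lambda>n. det (A n) \<noteq> 0) F"
    using tendsto_imp_eventually_ne[OF D nz] .
  ultimately show ?thesis
    unfolding matrix_inv_entry[OF nz]
    by (elim Lim_transform_eventually) (auto elim!: eventually_mono simp: matrix_inv_entry)
qed

lemma tendsto_tr2:
  assumes "\<And>I J. ((\<lambda>n. A n $ I $ J) \<longlongrightarrow> B $ I $ J) F" "\<And>I J. ((\<lambda>n. f n I J) \<longlongrightarrow> h I J) F"
  shows "((\<lambda>n. tr2 (A n) (f n)) \<longlongrightarrow> tr2 B h) F"
  unfolding tr2_def by (intro tendsto_intros assms)

lemma det_mvt:
  fixes A B :: "real ^ 'm ^ 'm::finite"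
  assumes sym: "\<And>I J. A $ I $ J = A $ J $ I" "\<And>I J. B $ I $ J = B $ J $ I"
  shows "\<exists>t\<in>{0..1}. det (A + t *\<^sub>R B) \<noteq> 0 \<longrightarrow>
    det (A + B) - det A = det (A + t *\<^sub>R B) * tr2 (matrix_inv (A + t *\<^sub>R B)) (\<lambda>I J. B $ I $ J)"
proof -
  define M where "M = (\<lambda>t. A + t *\<^sub>R B)"
  define p' where "p' = (\<lambda>t. \<Sum>k\<in>UNIV. det (\<chi> i j. if i = k then B $ k $ j else M t $ i $ j))"
  have "((\<lambda>t. det (M t)) has_real_derivative p' t) (at t)" for t
  proof -
    have e: "((\<lambda>t. M t $ i $ j) has_derivative (\<lambda>v. v * B $ i $ j)) (at t)" for i j
      by (auto simp: M_def intro!: derivative_eq_intros)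
    note d = has_derivative_det[of M, OF e]
    have "det (\<chi> i j. if i = k then v * B $ k $ j else M t $ i $ j) = v * det (\<chi> i j. if i = k then B $ k $ j else M t $ i $ j)" for k v
    proof -
      have "(\<chi> i j. if i = k then v * B $ k $ j else M t $ i $ j) = (\<chi> i. if i = k then v *s B $ k else M t $ i)"
        "(\<chi> i j. if i = k then B $ k $ j else M t $ i $ j) = (\<chi> i. if i = k then B $ k else M t $ i)"
        by (auto simp: vec_eq_iff)
      then show ?thesis by (simp only: det_row_mul)
    qed
    then have "((\<lambda>t. det (M t)) has_derivative (\<lambda>v. v * p' t)) (at t)"
      using d by (simp add: p'_def sum_distrib_left)
    then show ?thesis by (simp add: has_field_derivative_def mult.commute[of _ "p' t"])
  qed
  then obtain t where t: "0 < t" "t < 1" "det (M 1) - det (M 0) = (1 - 0) * p' t"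
    using MVT2[of 0 1 "\<lambda>t. det (M t)" p'] by auto
  have "p' t = det (M t) * tr2 (matrix_inv (M t)) (\<lambda>I J. B $ I $ J)" if nz: "det (M t) \<noteq> 0"
  proof -
    have "M t $ I $ J = M t $ J $ I" for I J using sym by (simp add: M_def)
    from matrix_inv_symmetric[OF nz this] show ?thesis
      by (simp add: p'_def det_replace_row[OF nz] tr2_def sum_distrib_left sum_distrib_right mult.commute mult.left_commute)
  qed
  then show ?thesis using t by (intro bexI[of _ t]) (auto simp: M_def)
qed

text \<open>Differences of determinants are analysed at points off the zero set by the mean value theorem;
  the intermediate parameters are controlled by compactness of the unit interval.\<close>

lemma (in nondegenerate) approach_zero_set:
  assumes \<psi>: "smooth_on W \<psi>" and x: "x \<in> W"
    and nz: "\<And>t. t \<in> {0..1} \<Longrightarrow> det (hessian r x + t *\<^sub>R hessian \<psi> x) \<noteq> 0"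
  obtains y :: "nat \<Rightarrow> real ^ 'm" and t :: "nat \<Rightarrow> real" and t0
  where "\<And>n. y n \<in> W" "\<And>n. r (y n) \<noteq> 0" "y \<longlonglongrightarrow> x" "t \<longlonglongrightarrow> t0" "t0 \<in> {0..1}"
    "\<And>n. det (hessian r (y n) + t n *\<^sub>R hessian \<psi> (y n)) \<noteq> 0"
    "\<And>n. det (hessian r (y n) + hessian \<psi> (y n)) - det (hessian r (y n)) =
       det (hessian r (y n) + t n *\<^sub>R hessian \<psi> (y n))
       * tr2 (matrix_inv (hessian r (y n) + t n *\<^sub>R hessian \<psi> (y n))) (\<lambda>I J. hessian \<psi> (y n) $ I $ J)"
    "(\<lambda>n. det (hessian r (y n) + t n *\<^sub>R hessian \<psi> (y n))) \<longlonglongrightarrow> det (hessian r x + t0 *\<^sub>R hessian \<psi> x)"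
    "\<And>I J. (\<lambda>n. matrix_inv (hessian r (y n) + t n *\<^sub>R hessian \<psi> (y n)) $ I $ J) \<longlonglongrightarrow>
       matrix_inv (hessian r x + t0 *\<^sub>R hessian \<psi> x) $ I $ J"
proof -
  define M where "M = (\<lambda>t y. hessian r y + t *\<^sub>R hessian \<psi> y)"
  define E where "E = (\<lambda>t y. det (hessian r y + hessian \<psi> y) - det (hessian r y) = det (M t y) * tr2 (matrix_inv (M t y)) (\<lambda>I J. hessian \<psi> y $ I $ J))"
  have "\<exists>y t. y \<in> W \<and> r y \<noteq> 0 \<and> dist y x < inverse (real (Suc n)) \<and> t \<in> {0..1} \<and> (det (M t y) \<noteq> 0 \<longrightarrow> E t y)" for n
  proof -
    obtain y where y: "y \<in> ball x (inverse (real (Suc n))) \<inter> W" "r y \<noteq> 0"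
      using zero_set_nowhere_dense[OF x open_ball, of x "inverse (real (Suc n))"] by auto
    have "\<exists>t\<in>{0..1}. det (M t y) \<noteq> 0 \<longrightarrow> E t y"
      unfolding M_def E_def using y by (intro det_mvt hessian_sym r_smooth \<psi>) auto
    then obtain t where "t \<in> {0..1}" "det (M t y) \<noteq> 0 \<longrightarrow> E t y" by blast
    then show ?thesis using y by (intro exI[of _ y] exI[of _ t]) (auto simp: dist_commute)
  qed
  then obtain y t where yt: "\<And>n. y n \<in> W" "\<And>n. r (y n) \<noteq> 0" "\<And>n. dist (y n) x < inverse (real (Suc n))"
    "\<And>n. t n \<in> {0..1}" "\<And>n. det (M (t n) (y n)) \<noteq> 0 \<Longrightarrow> E (t n) (y n)" by metis
  obtain t0 \<sigma> where t0: "t0 \<in> {0..1}" "strict_mono (\<sigma> :: nat \<Rightarrow> nat)" "(t \<circ> \<sigma>) \<longlonglongrightarrow> t0"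
    using compact_Icc[of "0 :: real" 1] yt(4) unfolding compact_def by meson
  have "y \<longlonglongrightarrow> x"
    by (rule iffD2[OF tendsto_dist_iff], rule real_tendsto_sandwich[OF _ _ tendsto_const LIMSEQ_inverse_real_of_nat])
      (auto intro!: always_eventually less_imp_le yt(3) simp del: of_nat_Suc)
  then have y\<sigma>: "(y \<circ> \<sigma>) \<longlonglongrightarrow> x" using t0(2) by (rule LIMSEQ_subseq_LIMSEQ)
  have cont: "(\<lambda>n. hessian f ((y \<circ> \<sigma>) n) $ I $ J) \<longlonglongrightarrow> hessian f x $ I $ J" if "smooth_on W f" for f I J
  proof (rule isCont_tendsto_compose[OF _ y\<sigma>])
    show "isCont (\<lambda>y. hessian f y $ I $ J) x"
      using smooth_on_imp_continuous_on[OF hessian_smooth[OF that]] W x continuous_on_eq_continuous_at by blast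
  qed
  have M: "(\<lambda>n. M ((t \<circ> \<sigma>) n) ((y \<circ> \<sigma>) n) $ I $ J) \<longlonglongrightarrow> M t0 x $ I $ J" for I J
    using tendsto_add[OF cont[OF r_smooth, of I J] tendsto_mult[OF t0(3) cont[OF \<psi>, of I J]]]
    by (simp add: M_def)
  have D: "(\<lambda>n. det (M ((t \<circ> \<sigma>) n) ((y \<circ> \<sigma>) n))) \<longlonglongrightarrow> det (M t0 x)"
    by (rule tendsto_det[OF M])
  have nz0: "det (M t0 x) \<noteq> 0" using nz t0 by (simp add: M_def)
  have "eventually (\<lambda>n. det (M ((t \<circ> \<sigma>) n) ((y \<circ> \<sigma>) n)) \<noteq> 0) sequentially"
    using tendsto_imp_eventually_ne[OF D nz0] .
  then obtain n0 where n0: "\<And>n. det (M ((t \<circ> \<sigma>) (n + n0)) ((y \<circ> \<sigma>) (n + n0))) \<noteq> 0"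
    unfolding eventually_sequentially by (meson le_add2)
  show ?thesis
  proof (rule that[of "\<lambda>n. (y \<circ> \<sigma>) (n + n0)" "\<lambda>n. (t \<circ> \<sigma>) (n + n0)" t0])
    show "(\<lambda>n. (y \<circ> \<sigma>) (n + n0)) \<longlonglongrightarrow> x" "(\<lambda>n. (t \<circ> \<sigma>) (n + n0)) \<longlonglongrightarrow> t0"
      using LIMSEQ_ignore_initial_segment y\<sigma> t0(3) by blast+
    show "(\<lambda>n. det (hessian r ((y \<circ> \<sigma>) (n + n0)) + (t \<circ> \<sigma>) (n + n0) *\<^sub>R hessian \<psi> ((y \<circ> \<sigma>) (n + n0)))) \<longlonglongrightarrow> det (hessian r x + t0 *\<^sub>R hessian \<psi> x)"
      using LIMSEQ_ignore_initial_segment[OF D, of n0] by (simp add: M_def)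
    show "(\<lambda>n. matrix_inv (hessian r ((y \<circ> \<sigma>) (n + n0)) + (t \<circ> \<sigma>) (n + n0) *\<^sub>R hessian \<psi> ((y \<circ> \<sigma>) (n + n0))) $ I $ J) \<longlonglongrightarrow>
       matrix_inv (hessian r x + t0 *\<^sub>R hessian \<psi> x) $ I $ J" for I J
      using LIMSEQ_ignore_initial_segment[OF tendsto_matrix_inv[OF M nz0], of n0] by (simp add: M_def)
  qed (use yt t0 n0 in \<open>auto simp: M_def E_def\<close>)
qed

context nondegenerate
begin

lemma pderiv_mult_power:
  assumes "smooth_on W u" "x \<in> W"
  shows "pderiv_at I (\<lambda>y. u y * r y ^ Suc i) x =
    real (Suc i) * u x * r x ^ i * pderiv_at I r x + r x ^ Suc i * pderiv_at I u x"
proof -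
  have "pderiv_at I (\<lambda>y. u y * r y ^ Suc i) x = u x * pderiv_at I (\<lambda>y. r y ^ Suc i) x + pderiv_at I u x * r x ^ Suc i"
    by (intro pderiv_mult smooth r_smooth assms)
  then show ?thesis unfolding pderiv_power[OF r_smooth assms(2)] by (simp add: algebra_simps)
qed

lemma hessian_mult_power:
  assumes u: "smooth_on W u" and x: "x \<in> W"
  shows "pderiv_at I (pderiv_at J (\<lambda>y. u y * r y ^ (i + 2))) x =
    real (i + 2) * real (i + 1) * u x * r x ^ i * (pderiv_at I r x * pderiv_at J r x)
    + real (i + 2) * r x ^ (i + 1) * (u x * hessian r x $ I $ J
        + (pderiv_at I u x * pderiv_at J r x + pderiv_at I r x * pderiv_at J u x))
    + r x ^ (i + 2) * hessian u x $ I $ J"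
proof -
  have "pderiv_at I (pderiv_at J (\<lambda>y. r y ^ Suc (Suc i))) x
      = pderiv_at I (\<lambda>y. real (i + 2) * (pderiv_at J r y * r y ^ Suc i)) x"
    by (rule pderiv_cong[OF W x]) (simp only: pderiv_power[OF r_smooth], simp)
  also have "\<dots> = real (i + 2) * pderiv_at I (\<lambda>y. pderiv_at J r y * r y ^ Suc i) x"
    by (intro pderiv_cmult smooth r_smooth x)
  also have "\<dots> = real (i + 2) * (real (Suc i) * pderiv_at J r x * r x ^ i * pderiv_at I r x
      + r x ^ Suc i * pderiv_at I (pderiv_at J r) x)"
    by (simp only: pderiv_mult_power[OF smooth_pderiv[OF r_smooth] x])
  finally have h: "pderiv_at I (pderiv_at J (\<lambda>y. r y ^ Suc (Suc i))) x = real (i + 2) * (real (Suc i) * pderiv_at J r x * r x ^ i * pderiv_at I r x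
      + r x ^ Suc i * pderiv_at I (pderiv_at J r) x)" .
  have "pderiv_at I (pderiv_at J (\<lambda>y. u y * r y ^ Suc (Suc i))) x =
    u x * pderiv_at I (pderiv_at J (\<lambda>y. r y ^ Suc (Suc i))) x + pderiv_at I u x * pderiv_at J (\<lambda>y. r y ^ Suc (Suc i)) x
    + (pderiv_at J u x * pderiv_at I (\<lambda>y. r y ^ Suc (Suc i)) x + pderiv_at I (pderiv_at J u) x * r x ^ Suc (Suc i))"
    by (rule hessian_mult) (intro smooth r_smooth u x)+
  then show ?thesis
    unfolding h pderiv_power[OF r_smooth x] hessian_nth by (simp add: algebra_simps)
qed

text \<open>The first two identities express that the inverse of the Hessian of a function of degree two
  maps its differential to the Euler field.\<close>

lemma path_identities:
  fixes i :: nat and t :: real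
  defines "\<psi> \<equiv> \<lambda>\<phi> y. \<phi> y * r y ^ (i + 2)"
  assumes \<phi>: "smooth_on W \<phi>" "homog_on W (- 2 * real (i + 1)) \<phi>" and x: "x \<in> W"
    and nz: "det (hessian r x + t *\<^sub>R hessian (\<psi> \<phi>) x) \<noteq> 0"
  defines "H \<equiv> matrix_inv (hessian r x + t *\<^sub>R hessian (\<psi> \<phi>) x)"
  defines "p \<equiv> \<lambda>I. pderiv_at I r x" and "q \<equiv> \<lambda>I. pderiv_at I \<phi> x"
  defines "\<kappa> \<equiv> 1 + t * real (i + 2) * \<phi> x * r x ^ (i + 1)"
  shows "2 * r x = \<kappa> * tr2 H (\<lambda>I J. p I * p J) + t * r x ^ (i + 2) * tr2 H (\<lambda>I J. q I * p J)"
    and "- 2 * real (i + 1) * \<phi> x = \<kappa> * tr2 H (\<lambda>I J. q I * p J) + t * r x ^ (i + 2) * tr2 H (\<lambda>I J. q I * q J)"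
    and "\<kappa> * tr2 H (\<lambda>I J. hessian (\<psi> \<phi>) x $ I $ J) =
      real (i + 2) * real (i + 1) * \<phi> x * r x ^ i * tr2 H (\<lambda>I J. p I * p J)
      + real (i + 2) * r x ^ (i + 1) * (\<phi> x * real CARD('m) + 2 * tr2 H (\<lambda>I J. q I * p J))
      + r x ^ (i + 2) * tr2 H (\<lambda>I J. hessian \<phi> x $ I $ J)"
proof -
  define M where "M = hessian r x + t *\<^sub>R hessian (\<psi> \<phi>) x"
  have \<psi>s: "smooth_on W (\<psi> \<phi>)" unfolding \<psi>_def by (intro smooth r_smooth \<phi>)
  have "homog_on W (- 2 * real (i + 1) + real (i + 2) * 2) (\<psi> \<phi>)"
    unfolding \<psi>_def by (intro homog_mult homog_power r_homog \<phi>)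
  then have \<psi>h: "homog_on W 2 (\<psi> \<phi>)" by simp
  have nzM: "det M \<noteq> 0" using nz by (simp add: M_def)
  have sym: "M $ I $ J = M $ J $ I" for I J
    using hessian_sym[OF r_smooth x] hessian_sym[OF \<psi>s x] by (simp add: M_def)
  have H: "H = matrix_inv M" by (simp add: H_def M_def)
  have Hs: "H $ I $ J = H $ J $ I" for I J unfolding H by (rule matrix_inv_symmetric[OF nzM sym])
  have d\<psi>: "pderiv_at I (\<psi> \<phi>) x = real (i + 2) * \<phi> x * r x ^ (i + 1) * p I + r x ^ (i + 2) * q I" for I
    using pderiv_mult_power[OF \<phi>(1) x, of I "Suc i"] by (simp add: \<psi>_def p_def q_def)
  have MX: "(\<Sum>J\<in>UNIV. M $ I $ J * x $ J) = \<kappa> * p I + t * r x ^ (i + 2) * q I" for I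
  proof -
    have "(\<Sum>J\<in>UNIV. M $ I $ J * x $ J) = (\<Sum>J\<in>UNIV. hessian r x $ I $ J * x $ J)
        + t * (\<Sum>J\<in>UNIV. hessian (\<psi> \<phi>) x $ I $ J * x $ J)"
      by (simp add: M_def algebra_simps sum.distrib sum_distrib_left)
    also have "\<dots> = p I + t * pderiv_at I (\<psi> \<phi>) x"
      using hessian_euler[OF r_smooth r_homog x, of I] hessian_euler[OF \<psi>s \<psi>h x, of I]
      by (simp add: hessian_nth p_def)
    finally show ?thesis by (simp add: d\<psi> \<kappa>_def algebra_simps)
  qed
  have HX: "(\<Sum>J\<in>UNIV. H $ I $ J * (\<kappa> * p J + t * r x ^ (i + 2) * q J)) = x $ I" for I
    unfolding H by (rule matrix_inv_solve[OF nzM MX])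
  have split: "tr2 H (\<lambda>I J. u I * (\<kappa> * p J + t * r x ^ (i + 2) * q J)) =
      \<kappa> * tr2 H (\<lambda>I J. u I * p J) + t * r x ^ (i + 2) * tr2 H (\<lambda>I J. u I * q J)" for u
  proof -
    have "tr2 H (\<lambda>I J. u I * (\<kappa> * p J + t * r x ^ (i + 2) * q J)) =
      tr2 H (\<lambda>I J. \<kappa> * (u I * p J) + (t * r x ^ (i + 2)) * (u I * q J))"
      by (simp add: algebra_simps)
    then show ?thesis by (simp only: tr2_add tr2_cmult)
  qed
  have pq: "tr2 H (\<lambda>I J. p I * q J) = tr2 H (\<lambda>I J. q I * p J)"
    by (subst tr2_swap[OF Hs, symmetric]) (simp add: mult.commute)
  have "tr2 H (\<lambda>I J. p I * (\<kappa> * p J + t * r x ^ (i + 2) * q J)) = 2 * r x"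
    unfolding tr2_outer HX using euler[OF r_smooth r_homog x] by (simp add: p_def mult.commute)
  then show "2 * r x = \<kappa> * tr2 H (\<lambda>I J. p I * p J) + t * r x ^ (i + 2) * tr2 H (\<lambda>I J. q I * p J)"
    unfolding split pq by simp
  have "tr2 H (\<lambda>I J. q I * (\<kappa> * p J + t * r x ^ (i + 2) * q J)) = - 2 * real (i + 1) * \<phi> x"
    unfolding tr2_outer HX using euler[OF \<phi> x] by (simp add: q_def mult.commute)
  then show "- 2 * real (i + 1) * \<phi> x = \<kappa> * tr2 H (\<lambda>I J. q I * p J) + t * r x ^ (i + 2) * tr2 H (\<lambda>I J. q I * q J)"
    unfolding split by simp
  define T where "T = tr2 H (\<lambda>I J. hessian (\<psi> \<phi>) x $ I $ J)"
  define S where "S = tr2 H (\<lambda>I J. hessian r x $ I $ J)"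
  have "tr2 H (\<lambda>I J. M $ I $ J) = S + t * T"
    unfolding S_def T_def by (simp add: M_def tr2_add tr2_cmult)
  then have N: "S + t * T = real CARD('m)"
    unfolding H by (simp add: tr2_matrix_inv[OF nzM sym])
  have T: "T = real (i + 2) * real (i + 1) * \<phi> x * r x ^ i * tr2 H (\<lambda>I J. p I * p J)
      + real (i + 2) * r x ^ (i + 1) * (\<phi> x * S + (tr2 H (\<lambda>I J. q I * p J) + tr2 H (\<lambda>I J. p I * q J)))
      + r x ^ (i + 2) * tr2 H (\<lambda>I J. hessian \<phi> x $ I $ J)"
  proof -
    have e: "(\<lambda>I J. hessian (\<psi> \<phi>) x $ I $ J) = (\<lambda>I J. real (i + 2) * real (i + 1) * \<phi> x * r x ^ i * (p I * p J)
      + real (i + 2) * r x ^ (i + 1) * (\<phi> x * hessian r x $ I $ J + (q I * p J + p I * q J))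
      + r x ^ (i + 2) * hessian \<phi> x $ I $ J)"
      unfolding \<psi>_def p_def q_def hessian_nth[of "\<lambda>y. \<phi> y * r y ^ (i + 2)"]
      by (intro ext) (rule hessian_mult_power[OF \<phi>(1) x])
    show ?thesis
      unfolding T_def e S_def by (simp only: tr2_add tr2_cmult)
  qed
  show "\<kappa> * tr2 H (\<lambda>I J. hessian (\<psi> \<phi>) x $ I $ J) =
      real (i + 2) * real (i + 1) * \<phi> x * r x ^ i * tr2 H (\<lambda>I J. p I * p J)
      + real (i + 2) * r x ^ (i + 1) * (\<phi> x * real CARD('m) + 2 * tr2 H (\<lambda>I J. q I * p J))
      + r x ^ (i + 2) * tr2 H (\<lambda>I J. hessian \<phi> x $ I $ J)"
    unfolding T_def[symmetric] N[symmetric] \<kappa>_def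
    using T unfolding pq by (simp add: algebra_simps)
qed

end

locale fefferman_pair = m1: fefferman W r1 \<theta>1 a + m2: fefferman W r2 \<theta>2 a
  for W :: "(real ^ 'm::finite) set" and r1 r2 \<theta>1 \<theta>2 a +
  assumes zero_iff: "x \<in> W \<Longrightarrow> r1 x = 0 \<longleftrightarrow> r2 x = 0"
    and same_sign: "x \<in> W \<Longrightarrow> r1 x * r2 x \<ge> 0"
    and division: "\<And>f s. smooth_on W f \<Longrightarrow> homog_on W s f \<Longrightarrow> (\<And>x. x \<in> W \<Longrightarrow> r1 x = 0 \<Longrightarrow> f x = 0) \<Longrightarrow>
      \<exists>h. smooth_on W h \<and> homog_on W (s - 2) h \<and> (\<forall>x\<in>W. f x = r1 x * h x)"
begin

lemma contact_2: "\<exists>\<phi>. smooth_on W \<phi> \<and> homog_on W (- 2) \<phi> \<and> (\<forall>x\<in>W. r2 x = r1 x + \<phi> x * r1 x ^ 2)"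
proof -
  obtain u where u: "smooth_on W u" "homog_on W (2 - 2) u" "\<And>x. x \<in> W \<Longrightarrow> r2 x = r1 x * u x"
    using division[OF m2.r_smooth m2.r_homog] zero_iff by blast
  have u0: "homog_on W 0 u" using u(2) by simp
  have "u x = 1" if x: "x \<in> W" "r1 x = 0" for x
  proof -
    have d2: "pderiv_at I r2 x = u x * pderiv_at I r1 x" for I
    proof -
      have "pderiv_at I r2 x = pderiv_at I (\<lambda>x. r1 x * u x) x"
        by (rule pderiv_cong[OF m1.W x(1) u(3)])
      then show ?thesis by (simp add: m1.pderiv_mult m1.r_smooth u x)
    qed
    have nz: "u x \<noteq> 0" using m2.dr_nonzero[OF x(1)] d2 by auto
    have "\<not> u x < 0"
    proof
      assume "u x < 0"
      have "open (u -` {..<0} \<inter> W)"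
        using continuous_on_open_vimage[OF m1.W] smooth_on_imp_continuous_on[OF u(1)] open_lessThan by blast
      then obtain y where y: "y \<in> W" "u y < 0" "r1 y \<noteq> 0"
        using m1.zero_set_nowhere_dense[OF x(1)] \<open>u x < 0\<close> x(1) by blast
      then have "(r1 y)\<^sup>2 * u y < 0" by (intro mult_pos_neg) auto
      then have "r1 y * r2 y < 0"
        using u(3)[OF y(1)] by (simp add: power2_eq_square mult.assoc)
      then show False using same_sign[OF y(1)] by simp
    qed
    then have pos: "u x > 0" using nz by simp
    have "det (hessian r2 x) = det (hessian (\<lambda>y. r1 y * u y) x)"
    proof -
      have "pderiv_at I (pderiv_at J r2) x = pderiv_at I (pderiv_at J (\<lambda>y. r1 y * u y)) x" for I J
        by (rule pderiv_cong[OF m1.W x(1) pderiv_cong[OF m1.W _ u(3)]])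
      then show ?thesis by (simp add: hessian_def)
    qed
    also have "\<dots> = u x ^ CARD('m) * det (hessian r1 x)"
      by (rule m1.det_hessian_mult[OF u(1) u0 x nz])
    finally have "u x ^ CARD('m) = 1"
      using m1.J_eq[OF x(1)] m2.J_eq[OF x(1)] x(2) zero_iff[OF x(1)] by simp
    then show "u x = 1" using pos power_eq_iff_eq_base[of "CARD('m)" "u x" 1] zero_less_card_finite[where 'a = 'm] by simp
  qed
  then obtain \<phi> where "smooth_on W \<phi>" "homog_on W (0 - 2) \<phi>" "\<And>x. x \<in> W \<Longrightarrow> u x - 1 = r1 x * \<phi> x"
    using division[of "\<lambda>x. u x - 1" 0] u u0 by (fastforce intro!: m1.smooth m1.homog_diff m1.homog_const)
  moreover have "r2 x = r1 x + (u x - 1) * r1 x" if "x \<in> W" for x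
    using u(3)[OF that] by (simp add: algebra_simps)
  ultimately show ?thesis by (intro exI[of _ \<phi>]) (simp add: power2_eq_square)
qed

context
  fixes \<phi> :: "real ^ 'm \<Rightarrow> real" and i :: nat
  assumes \<phi>: "smooth_on W \<phi>" "homog_on W (- 2 * real (i + 1)) \<phi>"
    and r2_eq: "\<And>x. x \<in> W \<Longrightarrow> r2 x = r1 x + \<phi> x * r1 x ^ (i + 2)"
begin

definition \<Theta> :: "real ^ 'm \<Rightarrow> real" where
  "\<Theta> = (\<lambda>y. \<theta>2 y * (1 + \<phi> y * r1 y ^ (i + 1)) ^ (a + 1) - \<theta>1 y)"

lemma hessian_r2: "x \<in> W \<Longrightarrow> hessian r2 x = hessian r1 x + hessian (\<lambda>y. \<phi> y * r1 y ^ (i + 2)) x"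
proof -
  assume x: "x \<in> W"
  have s: "smooth_on W (\<lambda>y. \<phi> y * r1 y ^ (i + 2))" by (intro m1.smooth \<phi> m1.r_smooth)
  have 1: "pderiv_at J r2 y = pderiv_at J r1 y + pderiv_at J (\<lambda>y. \<phi> y * r1 y ^ (i + 2)) y" if "y \<in> W" for J y
    unfolding m1.pderiv_add[OF m1.r_smooth s that, symmetric] by (rule pderiv_cong[OF m1.W that r2_eq])
  have "pderiv_at I (pderiv_at J r2) x = pderiv_at I (pderiv_at J r1) x + pderiv_at I (pderiv_at J (\<lambda>y. \<phi> y * r1 y ^ (i + 2))) x" for I J
    unfolding m1.pderiv_add[OF m1.smooth_pderiv[OF m1.r_smooth] m1.smooth_pderiv[OF s] x, symmetric]
    by (rule pderiv_cong[OF m1.W x 1])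
  then show ?thesis by (simp add: hessian_def vec_eq_iff)
qed

lemma det_difference:
  assumes "x \<in> W"
  shows "det (hessian r2 x) - det (hessian r1 x) = r1 x ^ (a + 1) * \<Theta> x"
proof -
  have "r2 x = r1 x * (1 + \<phi> x * r1 x ^ (i + 1))"
    using r2_eq[OF assms] by (simp add: algebra_simps)
  then have "r2 x ^ (a + 1) = r1 x ^ (a + 1) * (1 + \<phi> x * r1 x ^ (i + 1)) ^ (a + 1)"
    by (simp only: power_mult_distrib)
  then show ?thesis
    unfolding m1.J_eq[OF assms] m2.J_eq[OF assms] \<Theta>_def by (simp add: algebra_simps)
qed

lemma det_path:
  assumes "x \<in> W" "r1 x = 0"
  shows "det (hessian r1 x + t *\<^sub>R hessian (\<lambda>y. \<phi> y * r1 y ^ (i + 2)) x) = - 1"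
proof -
  define v where "v = (\<lambda>y. 1 + t * (\<phi> y * r1 y ^ (i + 1)))"
  have s: "smooth_on W (\<lambda>y. \<phi> y * r1 y ^ (i + 2))" by (intro m1.smooth \<phi> m1.r_smooth)
  have vs: "smooth_on W v" unfolding v_def by (intro m1.smooth \<phi> m1.r_smooth)
  have "homog_on W (- 2 * real (i + 1) + real (i + 1) * 2) (\<lambda>y. \<phi> y * r1 y ^ (i + 1))"
    by (intro m1.homog_mult m1.homog_power m1.r_homog \<phi>)
  then have "homog_on W 0 (\<lambda>y. \<phi> y * r1 y ^ (i + 1))" by simp
  then have vh: "homog_on W 0 v" unfolding v_def by (intro m1.homog_add m1.homog_const m1.homog_cmult)
  have 1: "pderiv_at J (\<lambda>y. r1 y * v y) y = pderiv_at J r1 y + t * pderiv_at J (\<lambda>y. \<phi> y * r1 y ^ (i + 2)) y" if "y \<in> W" for J y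
  proof -
    have "pderiv_at J (\<lambda>y. r1 y * v y) y = pderiv_at J (\<lambda>y. r1 y + t * (\<phi> y * r1 y ^ (i + 2))) y"
      by (simp add: v_def algebra_simps)
    also have "\<dots> = pderiv_at J r1 y + pderiv_at J (\<lambda>y. t * (\<phi> y * r1 y ^ (i + 2))) y"
      by (intro m1.pderiv_add m1.smooth s m1.r_smooth that)
    also have "\<dots> = pderiv_at J r1 y + t * pderiv_at J (\<lambda>y. \<phi> y * r1 y ^ (i + 2)) y"
      by (simp only: m1.pderiv_cmult[OF s that])
    finally show ?thesis .
  qed
  have "pderiv_at I (pderiv_at J (\<lambda>y. r1 y * v y)) x = pderiv_at I (pderiv_at J r1) x
      + t * pderiv_at I (pderiv_at J (\<lambda>y. \<phi> y * r1 y ^ (i + 2))) x" for I J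
  proof -
    have "pderiv_at I (pderiv_at J (\<lambda>y. r1 y * v y)) x
        = pderiv_at I (\<lambda>y. pderiv_at J r1 y + t * pderiv_at J (\<lambda>y. \<phi> y * r1 y ^ (i + 2)) y) x"
      by (rule pderiv_cong[OF m1.W assms(1) 1])
    also have "\<dots> = pderiv_at I (pderiv_at J r1) x + pderiv_at I (\<lambda>y. t * pderiv_at J (\<lambda>y. \<phi> y * r1 y ^ (i + 2)) y) x"
      by (intro m1.pderiv_add m1.smooth m1.smooth_pderiv s m1.r_smooth assms)
    finally show ?thesis by (simp only: m1.pderiv_cmult[OF m1.smooth_pderiv[OF s] assms(1)])
  qed
  then have "hessian r1 x + t *\<^sub>R hessian (\<lambda>y. \<phi> y * r1 y ^ (i + 2)) x = hessian (\<lambda>y. r1 y * v y) x"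
    by (simp add: hessian_def vec_eq_iff)
  then show ?thesis
    using m1.det_hessian_mult[OF vs vh assms] m1.J_eq[OF assms(1)] assms(2) by (simp add: v_def)
qed

lemma \<Theta>_limits:
  assumes x: "x \<in> W" "r1 x = 0" and i: "i \<le> a"
  shows "r1 x ^ (a - i) * \<Theta> x = - real (i + 2) * (2 * real (a - i)) * \<phi> x"
    and "i = a \<Longrightarrow> smooth_on W \<eta> \<Longrightarrow> (\<And>y. y \<in> W \<Longrightarrow> \<Theta> y = r1 y * \<eta> y) \<Longrightarrow> \<eta> x = - m1.flat_lap \<phi> x"
proof -
  let ?\<psi> = "\<lambda>y. \<phi> y * r1 y ^ (i + 2)"
  have s: "smooth_on W ?\<psi>" by (intro m1.smooth \<phi> m1.r_smooth)
  have nz: "det (hessian r1 x + t *\<^sub>R hessian ?\<psi> x) \<noteq> 0" for t unfolding det_path[OF x] by simp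
  obtain y t t0 where
    yW: "\<And>n. y n \<in> W" and ry: "\<And>n. r1 (y n) \<noteq> 0" and yx: "y \<longlonglongrightarrow> x" and tt0: "t \<longlonglongrightarrow> t0" and "t0 \<in> {0..1}"
    and nzn: "\<And>n. det (hessian r1 (y n) + t n *\<^sub>R hessian ?\<psi> (y n)) \<noteq> 0"
    and mvt: "\<And>n. det (hessian r1 (y n) + hessian ?\<psi> (y n)) - det (hessian r1 (y n)) =
       det (hessian r1 (y n) + t n *\<^sub>R hessian ?\<psi> (y n))
       * tr2 (matrix_inv (hessian r1 (y n) + t n *\<^sub>R hessian ?\<psi> (y n))) (\<lambda>I J. hessian ?\<psi> (y n) $ I $ J)"
    and Dlim: "(\<lambda>n. det (hessian r1 (y n) + t n *\<^sub>R hessian ?\<psi> (y n))) \<longlonglongrightarrow> det (hessian r1 x + t0 *\<^sub>R hessian ?\<psi> x)"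
    and Hlim: "\<And>I J. (\<lambda>n. matrix_inv (hessian r1 (y n) + t n *\<^sub>R hessian ?\<psi> (y n)) $ I $ J) \<longlonglongrightarrow>
       matrix_inv (hessian r1 x + t0 *\<^sub>R hessian ?\<psi> x) $ I $ J"
    by (rule m1.approach_zero_set[OF s x(1) nz]) (rule that)
  define H where "H = (\<lambda>n. matrix_inv (hessian r1 (y n) + t n *\<^sub>R hessian ?\<psi> (y n)))"
  define H0 where "H0 = matrix_inv (hessian r1 x + t0 *\<^sub>R hessian ?\<psi> x)"
  define D where "D = (\<lambda>n. det (hessian r1 (y n) + t n *\<^sub>R hessian ?\<psi> (y n)))"
  define \<alpha> where "\<alpha> = (\<lambda>n. tr2 (H n) (\<lambda>I J. pderiv_at I r1 (y n) * pderiv_at J r1 (y n)))"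
  define \<beta> where "\<beta> = (\<lambda>n. tr2 (H n) (\<lambda>I J. pderiv_at I \<phi> (y n) * pderiv_at J r1 (y n)))"
  define \<gamma> where "\<gamma> = (\<lambda>n. tr2 (H n) (\<lambda>I J. pderiv_at I \<phi> (y n) * pderiv_at J \<phi> (y n)))"
  define h where "h = (\<lambda>n. tr2 (H n) (\<lambda>I J. hessian \<phi> (y n) $ I $ J))"
  define \<kappa> where "\<kappa> = (\<lambda>n. 1 + t n * real (i + 2) * \<phi> (y n) * r1 (y n) ^ (i + 1))"
  define T where "T = (\<lambda>n. tr2 (H n) (\<lambda>I J. hessian ?\<psi> (y n) $ I $ J))"
  define R where "R = (\<lambda>n. r1 (y n))"
  define P where "P = (\<lambda>n. \<phi> (y n))"
  define U where "U = (\<lambda>n. \<Theta> (y n))"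
  have lim: "(\<lambda>n. f (y n)) \<longlonglongrightarrow> f x" if "smooth_on W f" for f :: "real ^ 'm \<Rightarrow> real"
  proof (rule isCont_tendsto_compose[OF _ yx])
    show "isCont f x"
      using smooth_on_imp_continuous_on[OF that] m1.W x(1) continuous_on_eq_continuous_at by blast
  qed
  have "smooth_on W \<Theta>" unfolding \<Theta>_def by (intro m1.smooth m1.r_smooth m1.\<theta>_smooth m2.\<theta>_smooth \<phi>)
  then have Ulim: "U \<longlonglongrightarrow> \<Theta> x" unfolding U_def by (rule lim)
  have Rlim: "R \<longlonglongrightarrow> 0" using lim[OF m1.r_smooth] x(2) by (simp add: R_def)
  have Plim: "P \<longlonglongrightarrow> \<phi> x" using lim[OF \<phi>(1)] by (simp add: P_def)
  have Hl: "(\<lambda>n. H n $ I $ J) \<longlonglongrightarrow> H0 $ I $ J" for I J unfolding H_def H0_def by (rule Hlim)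
  have Dl: "D \<longlonglongrightarrow> - 1" using Dlim unfolding D_def det_path[OF x] .
  have dl: "(\<lambda>n. pderiv_at I f (y n)) \<longlonglongrightarrow> pderiv_at I f x" if "smooth_on W f" for I f
    by (intro lim m1.smooth_pderiv that)
  have hl: "(\<lambda>n. hessian \<phi> (y n) $ I $ J) \<longlonglongrightarrow> hessian \<phi> x $ I $ J" for I J
    by (intro lim m1.hessian_smooth \<phi>)
  define \<beta>0 where "\<beta>0 = tr2 H0 (\<lambda>I J. pderiv_at I \<phi> x * pderiv_at J r1 x)"
  define \<gamma>0 where "\<gamma>0 = tr2 H0 (\<lambda>I J. pderiv_at I \<phi> x * pderiv_at J \<phi> x)"
  have \<beta>l: "\<beta> \<longlonglongrightarrow> \<beta>0"
    unfolding \<beta>_def \<beta>0_def by (intro tendsto_tr2 Hl tendsto_mult dl \<phi> m1.r_smooth)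
  have \<gamma>l: "\<gamma> \<longlonglongrightarrow> \<gamma>0"
    unfolding \<gamma>_def \<gamma>0_def by (intro tendsto_tr2 Hl tendsto_mult dl \<phi>)
  have hlim: "h \<longlonglongrightarrow> tr2 H0 (\<lambda>I J. hessian \<phi> x $ I $ J)"
    unfolding h_def by (rule tendsto_tr2[OF Hl hl])
  have id1: "2 * R n = \<kappa> n * \<alpha> n + t n * R n ^ (i + 2) * \<beta> n" for n
    using m1.path_identities(1)[OF \<phi> yW nzn, of n] unfolding H_def \<alpha>_def \<beta>_def \<kappa>_def R_def .
  have id2: "\<kappa> n * \<beta> n + t n * R n ^ (i + 2) * \<gamma> n = - 2 * real (i + 1) * P n" for n
    using m1.path_identities(2)[OF \<phi> yW nzn, of n] unfolding H_def \<beta>_def \<gamma>_def \<kappa>_def R_def P_def by (rule sym)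
  have id3: "\<kappa> n * T n = real (i + 2) * real (i + 1) * P n * R n ^ i * \<alpha> n
      + real (i + 2) * R n ^ (i + 1) * (P n * real CARD('m) + 2 * \<beta> n) + R n ^ (i + 2) * h n" for n
    using m1.path_identities(3)[OF \<phi> yW nzn, of n]
    unfolding H_def \<alpha>_def \<beta>_def h_def \<kappa>_def T_def R_def P_def .
  have \<kappa>eq: "\<kappa> n = 1 + t n * real (i + 2) * P n * R n ^ (i + 1)" for n by (simp add: \<kappa>_def P_def R_def)
  have \<kappa>l: "\<kappa> \<longlonglongrightarrow> 1 + t0 * real (i + 2) * \<phi> x * 0 ^ (i + 1)"
    unfolding \<kappa>eq[abs_def] by (intro tendsto_intros tt0 Plim Rlim)
  have "(\<lambda>n. \<kappa> n * \<beta> n + t n * R n ^ (i + 2) * \<gamma> n) \<longlonglongrightarrow> (1 + t0 * real (i + 2) * \<phi> x * 0 ^ (i + 1)) * \<beta>0 + t0 * 0 ^ (i + 2) * \<gamma>0"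
    by (intro tendsto_intros \<kappa>l \<beta>l tt0 Rlim \<gamma>l)
  moreover have "(\<lambda>n. - 2 * real (i + 1) * P n) \<longlonglongrightarrow> - 2 * real (i + 1) * \<phi> x"
    by (intro tendsto_intros Plim)
  ultimately have "(1 + t0 * real (i + 2) * \<phi> x * 0 ^ (i + 1)) * \<beta>0 + t0 * 0 ^ (i + 2) * \<gamma>0 = - 2 * real (i + 1) * \<phi> x"
    unfolding id2 by (rule LIMSEQ_unique)
  then have \<beta>0: "\<beta>0 = - 2 * real (i + 1) * \<phi> x" by simp
  have DT: "R n ^ (a + 1) * U n = D n * T n" for n
    using mvt[of n] det_difference[OF yW[of n]] unfolding hessian_r2[OF yW]
    by (simp add: R_def U_def D_def T_def H_def)
  have main: "\<kappa> n ^ 2 * (R n ^ (a - i) * U n) = D n * (real (i + 2) * real (i + 1) * P n * (2 - t n * R n ^ (i + 1) * \<beta> n)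
      + \<kappa> n * (real (i + 2) * (P n * real (2 * a + 2) + 2 * \<beta> n) + R n * h n))" for n
  proof -
    have "R n ^ (i + 1) * (\<kappa> n ^ 2 * (R n ^ (a - i) * U n)) = \<kappa> n ^ 2 * (R n ^ (i + 1 + (a - i)) * U n)"
      by (simp only: power_add) (simp add: algebra_simps)
    also have "\<dots> = D n * (\<kappa> n * (\<kappa> n * T n))"
      using i DT[of n] by (simp add: power2_eq_square)
    also have "\<kappa> n * (\<kappa> n * T n) = real (i + 2) * real (i + 1) * P n * R n ^ i * (\<kappa> n * \<alpha> n) +
        \<kappa> n * (real (i + 2) * R n ^ (i + 1) * (P n * real CARD('m) + 2 * \<beta> n) + R n ^ (i + 2) * h n)"
      unfolding id3 by (simp add: algebra_simps)
    also have "\<kappa> n * \<alpha> n = 2 * R n - t n * R n ^ (i + 2) * \<beta> n"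
      using id1[of n] by simp
    also have "D n * (real (i + 2) * real (i + 1) * P n * R n ^ i * (2 * R n - t n * R n ^ (i + 2) * \<beta> n) +
        \<kappa> n * (real (i + 2) * R n ^ (i + 1) * (P n * real CARD('m) + 2 * \<beta> n) + R n ^ (i + 2) * h n)) =
      R n ^ (i + 1) * (D n * (real (i + 2) * real (i + 1) * P n * (2 - t n * R n ^ (i + 1) * \<beta> n)
      + \<kappa> n * (real (i + 2) * (P n * real (2 * a + 2) + 2 * \<beta> n) + R n * h n)))"
      unfolding m1.card_eq by (simp add: algebra_simps)
    finally show ?thesis using ry[of n] by (simp add: R_def)
  qed
  have 1: "(\<lambda>n. \<kappa> n ^ 2 * (R n ^ (a - i) * U n)) \<longlonglongrightarrow> (1 + t0 * real (i + 2) * \<phi> x * 0 ^ (i + 1)) ^ 2 * (0 ^ (a - i) * \<Theta> x)"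
    by (intro tendsto_intros \<kappa>l Rlim Ulim)
  have 2: "(\<lambda>n. \<kappa> n ^ 2 * (R n ^ (a - i) * U n)) \<longlonglongrightarrow> - 1 * (real (i + 2) * real (i + 1) * \<phi> x * (2 - t0 * 0 ^ (i + 1) * \<beta>0)
      + (1 + t0 * real (i + 2) * \<phi> x * 0 ^ (i + 1)) * (real (i + 2) * (\<phi> x * real (2 * a + 2) + 2 * \<beta>0) + 0 * tr2 H0 (\<lambda>I J. hessian \<phi> x $ I $ J)))"
    unfolding main by (intro tendsto_intros \<kappa>l Rlim Plim Dl tt0 \<beta>l hlim)
  show "r1 x ^ (a - i) * \<Theta> x = - real (i + 2) * (2 * real (a - i)) * \<phi> x"
    using LIMSEQ_unique[OF 1 2] i unfolding \<beta>0 x(2) by (simp add: of_nat_diff algebra_simps)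
  assume ia: "i = a" and \<eta>: "smooth_on W \<eta>" "\<And>y. y \<in> W \<Longrightarrow> \<Theta> y = r1 y * \<eta> y"
  define C where "C = (\<lambda>n. \<eta> (y n))"
  have Clim: "C \<longlonglongrightarrow> \<eta> x" unfolding C_def by (rule lim[OF \<eta>(1)])
  have main2: "\<kappa> n ^ 2 * C n = D n * (real (a + 2) * (2 * real (a + 1) * P n * (t n * real (a + 2) * P n * R n ^ a)
      - real (a + 1) * P n * t n * R n ^ a * \<beta> n - 2 * t n * R n ^ (a + 1) * \<gamma> n) + \<kappa> n * h n)" for n
  proof -
    have \<kappa>\<beta>: "\<kappa> n * \<beta> n = - 2 * real (a + 1) * P n - t n * R n ^ (a + 2) * \<gamma> n"
      using id2[of n] ia by simp
    have "R n * (\<kappa> n ^ 2 * C n) = \<kappa> n ^ 2 * (R n ^ (a - i) * U n)"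
      using ia \<eta>(2)[OF yW[of n]] by (simp add: U_def R_def C_def)
    also have "\<dots> = D n * (real (a + 2) * (real (a + 1) * P n * (2 - t n * R n ^ (a + 1) * \<beta> n)
        + \<kappa> n * (P n * real (2 * a + 2)) + 2 * (\<kappa> n * \<beta> n)) + \<kappa> n * (R n * h n))"
      unfolding main unfolding ia by (simp add: algebra_simps)
    also have "\<dots> = D n * (real (a + 2) * (2 * real (a + 1) * P n * (\<kappa> n - 1) - real (a + 1) * P n * t n * R n ^ (a + 1) * \<beta> n
        - 2 * t n * R n ^ (a + 2) * \<gamma> n) + \<kappa> n * (R n * h n))"
      unfolding \<kappa>\<beta> by (simp add: algebra_simps)
    also have "\<kappa> n - 1 = t n * real (a + 2) * P n * R n ^ (a + 1)"
      unfolding \<kappa>eq ia by simp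
    finally have "R n * (\<kappa> n ^ 2 * C n) = R n * (D n * (real (a + 2) * (2 * real (a + 1) * P n * (t n * real (a + 2) * P n * R n ^ a)
      - real (a + 1) * P n * t n * R n ^ a * \<beta> n - 2 * t n * R n ^ (a + 1) * \<gamma> n) + \<kappa> n * h n))"
      by (simp add: algebra_simps)
    then show ?thesis using ry[of n] by (simp add: R_def)
  qed
  have 3: "(\<lambda>n. \<kappa> n ^ 2 * C n) \<longlonglongrightarrow> (1 + t0 * real (i + 2) * \<phi> x * 0 ^ (i + 1)) ^ 2 * \<eta> x"
    by (intro tendsto_intros \<kappa>l Clim)
  have 4: "(\<lambda>n. \<kappa> n ^ 2 * C n) \<longlonglongrightarrow> - 1 * (real (a + 2) * (2 * real (a + 1) * \<phi> x * (t0 * real (a + 2) * \<phi> x * 0 ^ a)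
      - real (a + 1) * \<phi> x * t0 * 0 ^ a * \<beta>0 - 2 * t0 * 0 ^ (a + 1) * \<gamma>0)
      + (1 + t0 * real (i + 2) * \<phi> x * 0 ^ (i + 1)) * tr2 H0 (\<lambda>I J. hessian \<phi> x $ I $ J))"
    unfolding main2 by (intro tendsto_intros \<kappa>l Rlim Plim Dl tt0 \<beta>l \<gamma>l hlim)
  have "hessian ?\<psi> x $ I $ J = 0" for I J
    unfolding m1.hessian_nth m1.hessian_mult_power[OF \<phi>(1) x(1)] using x(2) ia m1.a_pos by simp
  then have "hessian ?\<psi> x = 0" by (simp add: vec_eq_iff)
  then have "H0 = m1.G x" by (simp add: H0_def m1.G_def)
  then show "\<eta> x = - m1.flat_lap \<phi> x"
    using LIMSEQ_unique[OF 3 4] m1.a_pos by (simp add: m1.flat_lap_def m1.hessian_nth)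
qed

end

end

lemma matrix_add_rdistrib: "(A + B) ** C = A ** C + B ** C"
  for A B :: "real ^ 'm ^ 'm::finite"
  by (simp add: vec_eq_iff matrix_matrix_mult_def sum.distrib distrib_right)

lemma (in fefferman_pair) contact_order:
  "\<exists>\<phi>. smooth_on W \<phi> \<and> homog_on W (- 2 * real (a + 1)) \<phi> \<and> (\<forall>x\<in>W. r2 x = r1 x + \<phi> x * r1 x ^ (a + 2))"
proof -
  have "i \<le> a \<Longrightarrow> \<exists>\<phi>. smooth_on W \<phi> \<and> homog_on W (- 2 * real (i + 1)) \<phi> \<and> (\<forall>x\<in>W. r2 x = r1 x + \<phi> x * r1 x ^ (i + 2))" for i
  proof (induction i)
    case 0
    then show ?case using contact_2 by (simp add: numeral_2_eq_2)
  next
    case (Suc i)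
    then obtain \<phi> where \<phi>: "smooth_on W \<phi>" "homog_on W (- 2 * real (i + 1)) \<phi>"
      and r2: "\<And>x. x \<in> W \<Longrightarrow> r2 x = r1 x + \<phi> x * r1 x ^ (i + 2)" by auto
    have "\<phi> x = 0" if "x \<in> W" "r1 x = 0" for x
    proof -
      define d where "d = real (a - i)"
      have d: "d > 0" and r0: "r1 x ^ (a - i) = 0" using Suc.prems that(2) by (auto simp: d_def)
      have "r1 x ^ (a - i) * \<Theta> \<phi> i x = - real (i + 2) * (2 * d) * \<phi> x"
        unfolding d_def by (rule \<Theta>_limits(1)[OF \<phi> r2 that]) (use Suc.prems in auto)
      then have "real (i + 2) * d * \<phi> x = 0" unfolding r0 by simp
      moreover have "real (i + 2) \<noteq> 0" by simp
      ultimately show ?thesis using d by (simp del: of_nat_add)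
    qed
    then obtain \<phi>' where \<phi>': "smooth_on W \<phi>'" "homog_on W (- 2 * real (i + 1) - 2) \<phi>'"
      and eq: "\<And>x. x \<in> W \<Longrightarrow> \<phi> x = r1 x * \<phi>' x" using division[OF \<phi>] by blast
    have "- 2 * real (i + 1) - 2 = - 2 * real (Suc i + 1)" by simp
    then have "homog_on W (- 2 * real (Suc i + 1)) \<phi>'" using \<phi>'(2) by metis
    moreover have "r2 x = r1 x + \<phi>' x * r1 x ^ (Suc i + 2)" if "x \<in> W" for x
      unfolding r2[OF that] eq[OF that] by simp
    ultimately show ?case using \<phi>'(1) by blast
  qed
  from this[of a] show ?thesis by simp
qed

locale contact_pair = fefferman_pair W r1 r2 \<theta>1 \<theta>2 a
  for W :: "(real ^ 'm::finite) set" and r1 r2 \<theta>1 \<theta>2 a +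
  fixes \<phi> :: "real ^ 'm \<Rightarrow> real"
  assumes \<phi>_smooth: "smooth_on W \<phi>" and \<phi>_homog: "homog_on W (- 2 * real (a + 1)) \<phi>"
    and r2_eq: "\<And>x. x \<in> W \<Longrightarrow> r2 x = r1 x + \<phi> x * r1 x ^ (a + 2)"
begin

abbreviation "V \<equiv> m1.vanish"

definition Y where "Y I x = (\<Sum>K\<in>UNIV. m1.G x $ I $ K * pderiv_at K \<phi> x)"
definition Y2 where "Y2 I x = (\<Sum>K\<in>UNIV. m2.G x $ I $ K * pderiv_at K \<phi> x)"
definition P2 where "P2 I x = (\<Sum>K\<in>UNIV. m2.G x $ I $ K * pderiv_at K r1 x)"
definition tri :: "('m \<Rightarrow> 'm \<Rightarrow> real) \<Rightarrow> 'm \<Rightarrow> 'm \<Rightarrow> real ^ 'm \<Rightarrow> real" where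
  "tri A I J x = (\<Sum>K\<in>UNIV. \<Sum>L\<in>UNIV. m2.G x $ I $ K * A K L * m1.G x $ L $ J)"

lemma tri_add: "tri (\<lambda>K L. A K L + B K L) I J x = tri A I J x + tri B I J x"
  by (simp add: tri_def sum.distrib algebra_simps)

lemma tri_cmult: "tri (\<lambda>K L. c * A K L) I J x = c * tri A I J x"
  by (simp add: tri_def sum_distrib_left algebra_simps)

lemma tri_outer:
  "tri (\<lambda>K L. u K * v L) I J x = (\<Sum>K\<in>UNIV. m2.G x $ I $ K * u K) * (\<Sum>L\<in>UNIV. m1.G x $ L $ J * v L)"
  by (simp add: tri_def sum_product algebra_simps)

lemma tri_eq: "tri A I J x = (m2.G x ** (\<chi> K L. A K L) ** m1.G x) $ I $ J"
  unfolding matrix_matrix_mult_def tri_def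
  by (simp add: sum_distrib_right) (rule sum.swap)

lemma tri_metric: "x \<in> W \<Longrightarrow> tri (\<lambda>K L. hessian r1 x $ K $ L) I J x = m2.G x $ I $ J"
  unfolding tri_eq m1.G_def using matrix_inv_cancel[OF m1.det_nz]
  by (simp add: matrix_mul_assoc[symmetric])

lemma G2_eq:
  assumes "x \<in> W"
  shows "m2.G x $ I $ J = m1.G x $ I $ J
    - tri (\<lambda>K L. hessian (\<lambda>y. \<phi> y * r1 y ^ (a + 2)) x $ K $ L) I J x"
proof -
  let ?B = "hessian (\<lambda>y. \<phi> y * r1 y ^ (a + 2)) x"
  have h: "hessian r2 x = hessian r1 x + ?B"
    by (rule hessian_r2[OF \<phi>_smooth \<phi>_homog r2_eq assms])
  have "m1.G x = m2.G x ** hessian r2 x ** m1.G x"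
    unfolding m2.G_def matrix_inv_cancel[OF m2.det_nz[OF assms]] by simp
  also have "\<dots> = m2.G x ** hessian r1 x ** m1.G x + m2.G x ** ?B ** m1.G x"
    by (simp only: h matrix_add_ldistrib matrix_add_rdistrib)
  also have "m2.G x ** hessian r1 x ** m1.G x = m2.G x"
    unfolding m1.G_def using matrix_inv_cancel[OF m1.det_nz[OF assms]] by (simp add: matrix_mul_assoc[symmetric])
  finally have "m1.G x $ I $ J = (m2.G x + m2.G x ** ?B ** m1.G x) $ I $ J" by (rule arg_cong)
  then show ?thesis by (simp only: tri_eq vec_lambda_eta vector_add_component)
qed

lemma dr2: "x \<in> W \<Longrightarrow> pderiv_at K r2 x =
    (1 + real (a + 2) * \<phi> x * r1 x ^ (a + 1)) * pderiv_at K r1 x + r1 x ^ (a + 2) * pderiv_at K \<phi> x"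
proof -
  assume x: "x \<in> W"
  have s: "smooth_on W (\<lambda>y. \<phi> y * r1 y ^ Suc (Suc a))" by (intro m1.smooth \<phi>_smooth m1.r_smooth)
  have "pderiv_at K r2 x = pderiv_at K (\<lambda>y. r1 y + \<phi> y * r1 y ^ Suc (Suc a)) x"
    by (rule pderiv_cong[OF m1.W x]) (simp add: r2_eq)
  also have "\<dots> = pderiv_at K r1 x + pderiv_at K (\<lambda>y. \<phi> y * r1 y ^ Suc (Suc a)) x"
    by (rule m1.pderiv_add[OF m1.r_smooth s x])
  finally show ?thesis
    unfolding m1.pderiv_mult_power[OF \<phi>_smooth x] by (simp add: algebra_simps)
qed

lemma P2_eq: "x \<in> W \<Longrightarrow> P2 I x = x $ I
    - r1 x ^ (a + 1) * (real (a + 2) * \<phi> x * P2 I x + r1 x * Y2 I x)"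
proof -
  assume x: "x \<in> W"
  have "x $ I = (1 + real (a + 2) * \<phi> x * r1 x ^ (a + 1)) * P2 I x + r1 x ^ (a + 2) * Y2 I x"
    unfolding m2.G_dr[OF x, of I, symmetric] dr2[OF x] P2_def Y2_def
    by (simp add: sum.distrib sum_distrib_left algebra_simps)
  then show ?thesis by (simp add: algebra_simps)
qed

lemmas smooths = m1.smooth \<phi>_smooth m1.r_smooth m2.r_smooth m1.G_smooth m2.G_smooth

lemma Y_smooth: "smooth_on W (Y I)" and Y2_smooth: "smooth_on W (Y2 I)" and P2_smooth: "smooth_on W (P2 I)"
  unfolding Y_def[abs_def] Y2_def[abs_def] P2_def[abs_def] by (intro smooths)+

definition Z where "Z I J x = tri (\<lambda>K L. hessian \<phi> x $ K $ L) I J x"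

lemma Z_smooth: "smooth_on W (Z I J)"
  unfolding Z_def[abs_def] tri_def by (intro smooths m1.hessian_smooth)

lemma G2_expansion:
  assumes x: "x \<in> W"
  shows "m2.G x $ I $ J = m1.G x $ I $ J
    - (real (a + 2) * real (a + 1) * \<phi> x * r1 x ^ a * (P2 I x * x $ J)
      + real (a + 2) * r1 x ^ (a + 1) * (\<phi> x * m2.G x $ I $ J + (Y2 I x * x $ J + P2 I x * Y J x))
      + r1 x ^ (a + 2) * Z I J x)"
proof -
  have r: "(\<Sum>L\<in>UNIV. m1.G x $ L $ J * pderiv_at L r1 x) = x $ J"
    using m1.G_dr[OF x, of J] by (simp add: m1.G_sym[OF x, of _ J])
  have y: "(\<Sum>L\<in>UNIV. m1.G x $ L $ J * pderiv_at L \<phi> x) = Y J x"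
    by (simp add: m1.G_sym[OF x, of _ J] Y_def)
  have e: "(\<lambda>K L. hessian (\<lambda>y. \<phi> y * r1 y ^ (a + 2)) x $ K $ L) =
    (\<lambda>K L. real (a + 2) * real (a + 1) * \<phi> x * r1 x ^ a * (pderiv_at K r1 x * pderiv_at L r1 x)
    + real (a + 2) * r1 x ^ (a + 1) * (\<phi> x * hessian r1 x $ K $ L
        + (pderiv_at K \<phi> x * pderiv_at L r1 x + pderiv_at K r1 x * pderiv_at L \<phi> x))
    + r1 x ^ (a + 2) * hessian \<phi> x $ K $ L)"
    unfolding m1.hessian_nth[of "\<lambda>y. \<phi> y * r1 y ^ (a + 2)"]
    by (intro ext) (rule m1.hessian_mult_power[OF \<phi>_smooth x])
  show ?thesis
    by (subst G2_eq[OF x], unfold e tri_add tri_cmult tri_outer tri_metric[OF x] r y)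
      (simp only: P2_def Y2_def Z_def)
qed

lemma V_P2: "V (a + 1) (\<lambda>x. P2 I x - x $ I)"
proof (rule m1.vanishI)
  show "P2 I x - x $ I = r1 x ^ (a + 1) * (- (real (a + 2) * \<phi> x * P2 I x + r1 x * Y2 I x))" if "x \<in> W" for x
    using P2_eq[OF that, of I] by linarith
qed (intro smooths P2_smooth Y2_smooth)

lemma V_G2: "V a (\<lambda>x. m2.G x $ I $ J - m1.G x $ I $ J)"
proof (rule m1.vanishI)
  show "m2.G x $ I $ J - m1.G x $ I $ J = r1 x ^ a * (- (real (a + 2) * real (a + 1) * \<phi> x * (P2 I x * x $ J)
      + real (a + 2) * r1 x * (\<phi> x * m2.G x $ I $ J + (Y2 I x * x $ J + P2 I x * Y J x))
      + r1 x ^ 2 * Z I J x))" if "x \<in> W" for x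
    by (subst G2_expansion[OF that]) (simp add: algebra_simps power2_eq_square)
qed (intro smooths P2_smooth Y2_smooth Y_smooth Z_smooth)

lemma V_Y2: "V a (\<lambda>x. Y2 I x - Y I x)"
proof (rule m1.vanish_cong)
  show "V a (\<lambda>x. \<Sum>K\<in>UNIV. pderiv_at K \<phi> x * (m2.G x $ I $ K - m1.G x $ I $ K))"
    by (intro m1.vanish_sum m1.vanish_smult V_G2 smooths)
qed (simp add: Y2_def Y_def sum_subtractf algebra_simps)

definition G2_error where
  "G2_error I J x = m2.G x $ I $ J - (m1.G x $ I $ J
    - (real (a + 2) * real (a + 1) * \<phi> x * r1 x ^ a * (x $ I * x $ J)
      + real (a + 2) * r1 x ^ (a + 1) * (\<phi> x * m1.G x $ I $ J + (Y I x * x $ J + x $ I * Y J x))))"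

lemma V_G2_error: "V (a + 2) (G2_error I J)"
proof (rule m1.vanish_cong)
  have 1: "V (a + 2) (\<lambda>x. r1 x ^ a * (P2 I x - x $ I))"
    by (rule m1.vanish_mono[OF m1.vanish_mult[OF m1.vanish_r V_P2]]) (use m1.a_pos in simp)
  have 2: "V (a + 2) (\<lambda>x. r1 x ^ (a + 1) * (m2.G x $ I $ J - m1.G x $ I $ J))"
    by (rule m1.vanish_mono[OF m1.vanish_mult[OF m1.vanish_r V_G2]]) (use m1.a_pos in simp)
  have 3: "V (a + 2) (\<lambda>x. r1 x ^ (a + 1) * (Y2 I x - Y I x))"
    by (rule m1.vanish_mono[OF m1.vanish_mult[OF m1.vanish_r V_Y2]]) (use m1.a_pos in simp)
  have 4: "V (a + 2) (\<lambda>x. r1 x ^ (a + 1) * (P2 I x - x $ I))"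
    by (rule m1.vanish_mono[OF m1.vanish_mult[OF m1.vanish_r V_P2]]) simp
  have 5: "V (a + 2) (\<lambda>x. r1 x ^ (a + 2) * Z I J x)"
    by (rule m1.vanishI[OF Z_smooth refl])
  show "V (a + 2) (\<lambda>x. - ((real (a + 2) * real (a + 1) * \<phi> x * x $ J) * (r1 x ^ a * (P2 I x - x $ I))
      + ((real (a + 2) * \<phi> x) * (r1 x ^ (a + 1) * (m2.G x $ I $ J - m1.G x $ I $ J))
        + ((real (a + 2) * x $ J) * (r1 x ^ (a + 1) * (Y2 I x - Y I x))
        + (real (a + 2) * Y J x) * (r1 x ^ (a + 1) * (P2 I x - x $ I))))
      + r1 x ^ (a + 2) * Z I J x))"
    by (intro m1.vanish_minus m1.vanish_add m1.vanish_smult 1 2 3 4 5 smooths Y_smooth)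
  show "- ((real (a + 2) * real (a + 1) * \<phi> x * x $ J) * (r1 x ^ a * (P2 I x - x $ I))
      + ((real (a + 2) * \<phi> x) * (r1 x ^ (a + 1) * (m2.G x $ I $ J - m1.G x $ I $ J))
        + ((real (a + 2) * x $ J) * (r1 x ^ (a + 1) * (Y2 I x - Y I x))
        + (real (a + 2) * Y J x) * (r1 x ^ (a + 1) * (P2 I x - x $ I))))
      + r1 x ^ (a + 2) * Z I J x) = G2_error I J x" if "x \<in> W" for x
    unfolding G2_error_def
    using G2_expansion[OF that, of I J] by (simp only: algebra_simps)
qed

lemma flat_lap_difference:
  assumes f: "smooth_on W f" "homog_on W s f"
  shows "V (a + 2) (\<lambda>x. m2.flat_lap f x - m1.flat_lap f x
    + (real (a + 2) * real (a + 1) * (s * (s - 1)) * (r1 x ^ a * (\<phi> x * f x))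
    + real (a + 2) * (r1 x ^ (a + 1) * (\<phi> x * m1.flat_lap f x + 2 * (s - 1) * m1.ip \<phi> f x))))"
proof (rule m1.vanish_cong)
  let ?f = "\<lambda>I J x. pderiv_at I (pderiv_at J f) x"
  show "V (a + 2) (\<lambda>x. \<Sum>I\<in>UNIV. \<Sum>J\<in>UNIV. ?f I J x * G2_error I J x)"
    by (intro m1.vanish_sum m1.vanish_smult V_G2_error smooths f)
  fix x assume x: "x \<in> W"
  have XX: "(\<Sum>I\<in>UNIV. \<Sum>J\<in>UNIV. (x $ I * x $ J) * ?f I J x) = s * (s - 1) * f x"
  proof -
    have "(\<Sum>I\<in>UNIV. \<Sum>J\<in>UNIV. (x $ I * x $ J) * ?f I J x) = (\<Sum>I\<in>UNIV. x $ I * (\<Sum>J\<in>UNIV. ?f I J x * x $ J))"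
      by (simp add: sum_distrib_left algebra_simps)
    also have "\<dots> = (s - 1) * (\<Sum>I\<in>UNIV. x $ I * pderiv_at I f x)"
      unfolding m1.hessian_euler[OF f x] by (simp add: sum_distrib_left algebra_simps)
    finally show ?thesis by (simp add: m1.euler[OF f x])
  qed
  have YX: "(\<Sum>I\<in>UNIV. \<Sum>J\<in>UNIV. (Y I x * x $ J) * ?f I J x) = (s - 1) * m1.ip \<phi> f x"
  proof -
    have "(\<Sum>I\<in>UNIV. \<Sum>J\<in>UNIV. (Y I x * x $ J) * ?f I J x) = (\<Sum>I\<in>UNIV. Y I x * (\<Sum>J\<in>UNIV. ?f I J x * x $ J))"
      by (simp add: sum_distrib_left algebra_simps)
    also have "\<dots> = (s - 1) * (\<Sum>I\<in>UNIV. pderiv_at I f x * Y I x)"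
      unfolding m1.hessian_euler[OF f x] by (simp add: sum_distrib_left algebra_simps)
    also have "(\<Sum>I\<in>UNIV. pderiv_at I f x * Y I x) = m1.ip f \<phi> x"
      by (simp add: m1.ip_def tr2_outer Y_def)
    finally show ?thesis by (simp add: m1.ip_sym[OF x])
  qed
  have XY: "(\<Sum>I\<in>UNIV. \<Sum>J\<in>UNIV. (x $ I * Y J x) * ?f I J x) = (s - 1) * m1.ip \<phi> f x"
    unfolding YX[symmetric] by (subst sum.swap) (simp add: m1.pderiv_commute[OF f(1) x] mult.commute)
  define c1 where "c1 = real (a + 2) * real (a + 1) * \<phi> x * r1 x ^ a"
  define c2 where "c2 = real (a + 2) * r1 x ^ (a + 1)"
  have "(\<Sum>I\<in>UNIV. \<Sum>J\<in>UNIV. ?f I J x * G2_error I J x) =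
      (\<Sum>I\<in>UNIV. \<Sum>J\<in>UNIV. m2.G x $ I $ J * ?f I J x - m1.G x $ I $ J * ?f I J x
        + (c1 * ((x $ I * x $ J) * ?f I J x) + c2 * (\<phi> x * (m1.G x $ I $ J * ?f I J x)
         + ((Y I x * x $ J) * ?f I J x + (x $ I * Y J x) * ?f I J x))))"
    unfolding G2_error_def c1_def[symmetric] c2_def[symmetric] by (intro sum.cong refl) (simp add: algebra_simps)
  also have "\<dots> = m2.flat_lap f x - m1.flat_lap f x + (c1 * (s * (s - 1) * f x)
      + c2 * (\<phi> x * m1.flat_lap f x + ((s - 1) * m1.ip \<phi> f x + (s - 1) * m1.ip \<phi> f x)))"
    unfolding sum.distrib sum_subtractf sum_distrib_left[symmetric] XX XY YX
    by (simp only: m1.flat_lap_def m2.flat_lap_def tr2_def)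
  finally show "(\<Sum>I\<in>UNIV. \<Sum>J\<in>UNIV. ?f I J x * G2_error I J x) = m2.flat_lap f x - m1.flat_lap f x
    + (real (a + 2) * real (a + 1) * (s * (s - 1)) * (r1 x ^ a * (\<phi> x * f x))
    + real (a + 2) * (r1 x ^ (a + 1) * (\<phi> x * m1.flat_lap f x + 2 * (s - 1) * m1.ip \<phi> f x)))"
    by (simp add: c1_def c2_def algebra_simps)
qed

lemma one_plus_power: "(1 + z) ^ n - 1 = z * (\<Sum>k<n. (1 + z) ^ k)" for z :: real
  using one_diff_power_eq[of "1 + z" n] by (simp add: algebra_simps)

lemma r2_power_eq: "x \<in> W \<Longrightarrow> r2 x ^ n = r1 x ^ n * (1 + \<phi> x * r1 x ^ (a + 1)) ^ n"
  unfolding power_mult_distrib[symmetric] by (simp add: r2_eq algebra_simps)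

lemma V_power: "V (a + 1) (\<lambda>x. (1 + \<phi> x * r1 x ^ (a + 1)) ^ n - 1)"
  unfolding one_plus_power
proof (rule m1.vanishI)
  show "smooth_on W (\<lambda>x. \<phi> x * (\<Sum>k<n. (1 + \<phi> x * r1 x ^ (a + 1)) ^ k))" by (intro smooths)
qed (simp only: mult.commute mult.left_commute)

lemma V_drift2: "V a (m2.drift K)"
proof -
  obtain h where h: "smooth_on W h" "\<And>x. x \<in> W \<Longrightarrow> m2.drift K x = r2 x ^ a * h x"
    using m2.drift_vanish[of K] by (auto simp: m2.vanish_def)
  show ?thesis
    by (rule m1.vanishI[of "\<lambda>x. (1 + \<phi> x * r1 x ^ (a + 1)) ^ a * h x"])
      (intro smooths h, simp only: h(2) r2_power_eq mult.assoc)
qed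

lemma V_lap_difference:
  assumes f: "smooth_on W f" "homog_on W s f"
  shows "V a (\<lambda>x. m2.lap f x - m1.lap f x)"
proof (rule m1.vanish_cong)
  let ?e = "\<lambda>x. m2.flat_lap f x - m1.flat_lap f x
    + (real (a + 2) * real (a + 1) * (s * (s - 1)) * (r1 x ^ a * (\<phi> x * f x))
    + real (a + 2) * (r1 x ^ (a + 1) * (\<phi> x * m1.flat_lap f x + 2 * (s - 1) * m1.ip \<phi> f x)))"
  have 1: "V a ?e" by (rule m1.vanish_mono[OF flat_lap_difference[OF f]]) simp
  have 2: "V a (\<lambda>x. r1 x ^ a * (\<phi> x * f x))" by (rule m1.vanishI[of "\<lambda>x. \<phi> x * f x"]) (intro smooths f, simp)
  have 3: "V a (\<lambda>x. r1 x ^ (a + 1) * (\<phi> x * m1.flat_lap f x + 2 * (s - 1) * m1.ip \<phi> f x))"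
    by (rule m1.vanishI[of "\<lambda>x. r1 x * (\<phi> x * m1.flat_lap f x + 2 * (s - 1) * m1.ip \<phi> f x)"])
      (intro smooths m1.flat_lap_smooth m1.ip_smooth f, simp)
  show "V a (\<lambda>x. (\<Sum>K\<in>UNIV. pderiv_at K f x * m2.drift K x) - (\<Sum>K\<in>UNIV. pderiv_at K f x * m1.drift K x)
     - (?e x - (real (a + 2) * real (a + 1) * (s * (s - 1)) * (r1 x ^ a * (\<phi> x * f x))
    + real (a + 2) * (r1 x ^ (a + 1) * (\<phi> x * m1.flat_lap f x + 2 * (s - 1) * m1.ip \<phi> f x)))))"
    by (intro m1.vanish_diff m1.vanish_add m1.vanish_cmult m1.vanish_sum m1.vanish_smult 1 2 3 V_drift2 m1.drift_vanish m1.smooth f)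
qed (simp add: m1.lap_eq m2.lap_eq mult.commute)

end

locale strict_pair = contact_pair W r1 r2 \<theta>1 \<theta>2 a \<phi>
  for W :: "(real ^ 'm::finite) set" and r1 r2 \<theta>1 \<theta>2 a \<phi> +
  assumes strict1: "x \<in> W \<Longrightarrow> r1 x = 0 \<Longrightarrow> m1.lap \<theta>1 x = 0"
    and strict2: "x \<in> W \<Longrightarrow> r1 x = 0 \<Longrightarrow> m2.lap \<theta>2 x = 0"
begin

lemma V_\<theta>: "V 2 (\<lambda>x. \<theta>2 x - \<theta>1 x)"
  and V_det: "V (a + 2) (\<lambda>x. det (hessian r2 x) - det (hessian r1 x))"
  and flat_lap_\<phi>: "x \<in> W \<Longrightarrow> r1 x = 0 \<Longrightarrow> m1.flat_lap \<phi> x = 0"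
proof -
  note [intro] = m1.\<theta>_smooth m2.\<theta>_smooth
  let ?z = "\<lambda>x. \<phi> x * r1 x ^ (a + 1)"
  have zh: "homog_on W 0 ?z"
    using m1.homog_mult[OF \<phi>_homog m1.homog_power[OF m1.r_homog, of "a + 1"]] by simp
  have \<Theta>_eq: "\<Theta> \<phi> a = (\<lambda>y. \<theta>2 y * (1 + ?z y) ^ (a + 1) - \<theta>1 y)"
    by (simp add: \<Theta>_def[OF \<phi>_smooth \<phi>_homog r2_eq])
  have \<Theta>s: "smooth_on W (\<Theta> \<phi> a)"
    unfolding \<Theta>_eq by (intro smooths m1.\<theta>_smooth m2.\<theta>_smooth)
  have "homog_on W (- real (2 * a + 2) + real (a + 1) * 0) (\<lambda>x. \<theta>2 x * (1 + ?z x) ^ (a + 1))"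
    by (intro m1.homog_mult m2.\<theta>_homog m1.homog_power m1.homog_add m1.homog_const zh)
  then have \<Theta>h: "homog_on W (- real (2 * a + 2)) (\<Theta> \<phi> a)"
    unfolding \<Theta>_eq by (intro m1.homog_diff m1.\<theta>_homog) simp
  have "\<Theta> \<phi> a x = 0" if "x \<in> W" "r1 x = 0" for x
    using \<Theta>_limits(1)[OF \<phi>_smooth \<phi>_homog r2_eq that] by simp
  then obtain \<eta> where \<eta>: "smooth_on W \<eta>" "homog_on W (- real (2 * a + 2) - 2) \<eta>"
    "\<And>x. x \<in> W \<Longrightarrow> \<Theta> \<phi> a x = r1 x * \<eta> x"
    using division[OF \<Theta>s \<Theta>h] by blast
  have err: "V 2 (\<lambda>x. - (\<theta>2 x * ((1 + ?z x) ^ (a + 1) - 1)))"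
    by (intro m1.vanish_minus m1.vanish_smult m2.\<theta>_smooth m1.vanish_mono[OF V_power]) (use m1.a_pos in simp)
  have \<theta>eq: "\<theta>2 x - \<theta>1 x = r1 x * \<eta> x + - (\<theta>2 x * ((1 + ?z x) ^ (a + 1) - 1))" if "x \<in> W" for x
    unfolding \<eta>(3)[OF that, symmetric] \<Theta>_eq by (simp add: algebra_simps)
  have \<eta>0: "\<eta> x = 0" if x: "x \<in> W" "r1 x = 0" for x
  proof -
    have "m2.lap \<theta>2 x - m1.lap \<theta>2 x = 0"
      by (rule m1.vanish_eq_0[OF V_lap_difference[OF m2.\<theta>_smooth m2.\<theta>_homog] _ x]) (use m1.a_pos in simp)
    then have "m1.lap \<theta>2 x + m1.lap (\<lambda>x. - 1 * \<theta>1 x) x = 0"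
      unfolding m1.lap_cmult[OF m1.\<theta>_smooth x(1)] using strict1[OF x] strict2[OF x] by simp
    then have "m1.lap (\<lambda>x. \<theta>2 x + - 1 * \<theta>1 x) x = 0"
      by (subst m1.lap_add) (auto intro!: smooths x)
    moreover have "m1.lap (\<lambda>x. \<theta>2 x + - 1 * \<theta>1 x) x = m1.lap (\<lambda>x. r1 x * \<eta> x + - (\<theta>2 x * ((1 + ?z x) ^ (a + 1) - 1))) x"
      by (rule m1.lap_cong[OF _ x(1)]) (use \<theta>eq in simp)
    moreover have "\<dots> = m1.lap (\<lambda>x. r1 x * \<eta> x) x + m1.lap (\<lambda>x. - (\<theta>2 x * ((1 + ?z x) ^ (a + 1) - 1))) x"
      by (intro m1.lap_add smooths \<eta> m2.\<theta>_smooth x)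
    moreover have "m1.lap (\<lambda>x. - (\<theta>2 x * ((1 + ?z x) ^ (a + 1) - 1))) x = 0"
      by (rule m1.vanish_eq_0[OF m1.vanish_lap[of 1] _ x]) (use err in \<open>simp_all add: numeral_2_eq_2\<close>)
    moreover have "m1.lap (\<lambda>x. r1 x * \<eta> x) x = (2 * real a + 6) * \<eta> x"
      unfolding m1.lap_r_mult[OF \<eta>(1,2) x(1)] using x(2) by (simp add: algebra_simps)
    ultimately have "(2 * real a + 6) * \<eta> x = 0" by simp
    then show ?thesis by (simp add: add_nonneg_eq_0_iff)
  qed
  show "m1.flat_lap \<phi> x = 0" if x: "x \<in> W" "r1 x = 0" for x
    using \<Theta>_limits(2)[OF \<phi>_smooth \<phi>_homog r2_eq x order_refl refl \<eta>(1) \<eta>(3)] \<eta>0[OF x] by simp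
  obtain \<eta>' where \<eta>': "smooth_on W \<eta>'" "\<And>x. x \<in> W \<Longrightarrow> \<eta> x = r1 x * \<eta>' x"
    using division[OF \<eta>(1,2) \<eta>0] by blast
  have 1: "V 2 (\<lambda>x. r1 x * \<eta> x)"
    by (rule m1.vanishI[OF \<eta>'(1)]) (simp add: \<eta>' power2_eq_square)
  show "V 2 (\<lambda>x. \<theta>2 x - \<theta>1 x)"
    by (rule m1.vanish_cong[OF m1.vanish_add[OF 1 err]]) (rule \<theta>eq[symmetric])
  show "V (a + 2) (\<lambda>x. det (hessian r2 x) - det (hessian r1 x))"
    by (rule m1.vanishI[OF \<eta>(1)]) (simp add: det_difference[OF \<phi>_smooth \<phi>_homog r2_eq] \<eta>(3))
qed

lemma V_drift: "V (a + 2) (\<lambda>x. m2.drift K x - m1.drift K x)"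
proof (rule m1.vanish_cong)
  define S1 where "S1 = (\<lambda>x. \<Sum>L\<in>UNIV. m1.G x $ K $ L * pderiv_at L \<theta>1 x)"
  define S2 where "S2 = (\<lambda>x. \<Sum>L\<in>UNIV. m2.G x $ K $ L * pderiv_at L \<theta>2 x)"
  define c where "c = real (a + 1)"
  define D1 where "D1 = (\<lambda>x. det (hessian r1 x))"
  define D2 where "D2 = (\<lambda>x. det (hessian r2 x))"
  define A1 where "A1 = (\<lambda>x. c * (\<theta>1 x * x $ K) + r1 x * S1 x)"
  define A2 where "A2 = (\<lambda>x. c * (\<theta>2 x * x $ K) + r2 x * S2 x)"
  note sm = smooths m1.\<theta>_smooth m2.\<theta>_smooth smooth_on_det[OF m1.W] m1.hessian_smooth smooth_on_divide[OF m1.W]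
  have S: "smooth_on W S1" "smooth_on W S2" unfolding S1_def S2_def by (intro sm)+
  have A: "smooth_on W A1" "smooth_on W A2" unfolding A1_def A2_def by (intro sm S)+
  have D: "smooth_on W D1" "smooth_on W D2" unfolding D1_def D2_def by (intro sm)+
  have D0: "D1 x \<noteq> 0" "D2 x \<noteq> 0" if "x \<in> W" for x
    using that m1.det_nz m2.det_nz by (auto simp: D1_def D2_def)
  have "V 1 (\<lambda>x. (\<Sum>L\<in>UNIV. pderiv_at L \<theta>2 x * (m2.G x $ K $ L - m1.G x $ K $ L))
      + (\<Sum>L\<in>UNIV. m1.G x $ K $ L * pderiv_at L (\<lambda>x. \<theta>2 x - \<theta>1 x) x))"
    by (intro m1.vanish_add m1.vanish_sum m1.vanish_smult sm m1.vanish_mono[OF V_G2 m1.a_pos] m1.vanish_pderiv)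
      (use V_\<theta> in \<open>simp add: numeral_2_eq_2\<close>)
  then have SS: "V 1 (\<lambda>x. S2 x - S1 x)"
    by (rule m1.vanish_cong)
      (simp add: S1_def S2_def m1.pderiv_diff[OF m2.\<theta>_smooth m1.\<theta>_smooth] algebra_simps sum.distrib sum_subtractf)
  have rr: "V 2 (\<lambda>x. r2 x - r1 x)"
    by (rule m1.vanishI[of "\<lambda>x. \<phi> x * r1 x ^ a"]) (intro sm, simp add: r2_eq power2_eq_square)
  have "V (1 + 1) (\<lambda>x. r1 x ^ 1 * (S2 x - S1 x))" by (intro m1.vanish_mult m1.vanish_r SS)
  then have rS: "V 2 (\<lambda>x. r1 x ^ 1 * (S2 x - S1 x))" by (simp only: one_add_one)
  have "V 2 (\<lambda>x. c * (x $ K * (\<theta>2 x - \<theta>1 x)) + (S2 x * (r2 x - r1 x) + r1 x ^ 1 * (S2 x - S1 x)))"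
    by (rule m1.vanish_add[OF _ m1.vanish_add[OF m1.vanish_smult[OF S(2) rr] rS]])
      (intro m1.vanish_cmult m1.vanish_smult sm V_\<theta>)
  then have AA: "V 2 (\<lambda>x. A2 x - A1 x)"
    by (rule m1.vanish_cong) (simp add: A1_def A2_def algebra_simps)
  have i: "smooth_on W (\<lambda>x. 1 / (2 * D2 x))" "smooth_on W (\<lambda>x. A2 x / (2 * D2 x))"
    "smooth_on W (\<lambda>x. r1 x ^ a * A1 x / (2 * D1 x * D2 x))"
    using D0 by (intro sm A D; simp)+
  have 1: "V (a + 2) (\<lambda>x. r1 x ^ a * ((1 + \<phi> x * r1 x ^ (a + 1)) ^ a - 1))"
    by (rule m1.vanish_mono[OF m1.vanish_mult[OF m1.vanish_r V_power]]) (use m1.a_pos in simp)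
  have VD: "V (a + 2) (\<lambda>x. D2 x - D1 x)" unfolding D1_def D2_def by (rule V_det)
  have 2: "V (a + 2) (\<lambda>x. r1 x ^ a * (A2 x - A1 x))" by (intro m1.vanish_mult m1.vanish_r AA)
  show "V (a + 2) (\<lambda>x. A2 x / (2 * D2 x) * (r1 x ^ a * ((1 + \<phi> x * r1 x ^ (a + 1)) ^ a - 1))
      + (1 / (2 * D2 x) * (r1 x ^ a * (A2 x - A1 x)) - r1 x ^ a * A1 x / (2 * D1 x * D2 x) * (D2 x - D1 x)))"
    by (rule m1.vanish_add[OF m1.vanish_smult[OF i(2) 1] m1.vanish_diff[OF m1.vanish_smult[OF i(1) 2]
        m1.vanish_smult[OF i(3) VD]]])
  fix x assume x: "x \<in> W"
  have e1: "m1.drift K x = r1 x ^ a * (A1 x / (2 * D1 x))"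
    by (simp add: m1.drift_def A1_def D1_def S1_def c_def)
  have e2: "m2.drift K x = r1 x ^ a * (1 + \<phi> x * r1 x ^ (a + 1)) ^ a * (A2 x / (2 * D2 x))"
    unfolding r2_power_eq[OF x, symmetric] by (simp add: m2.drift_def A2_def D2_def S2_def c_def)
  show "A2 x / (2 * D2 x) * (r1 x ^ a * ((1 + \<phi> x * r1 x ^ (a + 1)) ^ a - 1))
      + (1 / (2 * D2 x) * (r1 x ^ a * (A2 x - A1 x)) - r1 x ^ a * A1 x / (2 * D1 x * D2 x) * (D2 x - D1 x))
      = m2.drift K x - m1.drift K x"
    unfolding e1 e2 using D0[OF x] by (simp add: field_simps)
qed

lemma lap_difference:
  assumes f: "smooth_on W f" "homog_on W s f"
  shows "V (a + 2) (\<lambda>x. m2.lap f x - m1.lap f x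
    - (real (a + 2) * real (a + 1) * (s * (s - 1)) * (r1 x ^ a * (\<phi> x * f x))
    + real (a + 2) * (r1 x ^ (a + 1) * (\<phi> x * m1.flat_lap f x + 2 * (s - 1) * m1.ip \<phi> f x))))"
proof (rule m1.vanish_cong)
  show "V (a + 2) (\<lambda>x. (\<Sum>K\<in>UNIV. pderiv_at K f x * (m2.drift K x - m1.drift K x)) - 
    (m2.flat_lap f x - m1.flat_lap f x
    + (real (a + 2) * real (a + 1) * (s * (s - 1)) * (r1 x ^ a * (\<phi> x * f x))
    + real (a + 2) * (r1 x ^ (a + 1) * (\<phi> x * m1.flat_lap f x + 2 * (s - 1) * m1.ip \<phi> f x)))))"
    by (intro m1.vanish_diff m1.vanish_sum m1.vanish_smult V_drift flat_lap_difference m1.smooth f)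
qed (simp add: m1.lap_eq m2.lap_eq algebra_simps sum_subtractf)

text \<open>The Laplacians differ by terms of order \<open>a\<close>, and each Laplacian lowers the order by one. In
  weight 0 the leading term of the difference vanishes, so only the difference applied to \<open>f\<close> itself
  contributes to the power \<open>a + 2\<close> on the zero set.\<close>

lemma lap_pow_telescope:
  assumes f: "smooth_on W f" "homog_on W 2 f"
  shows "i \<le> a + 1 \<Longrightarrow> V (a + 2 - i) (\<lambda>x. (m2.lap ^^ Suc i) f x - ((m1.lap ^^ Suc i) f x
      + (m1.lap ^^ i) (\<lambda>y. m2.lap f y - m1.lap f y) x))"
proof (induction i)
  case 0
  show ?case by (simp add: m1.vanish_zero)
next
  case (Suc i)
  let ?E = "\<lambda>y. m2.lap f y - m1.lap f y"
  let ?R = "\<lambda>x. (m2.lap ^^ Suc i) f x - ((m1.lap ^^ Suc i) f x + (m1.lap ^^ i) ?E x)"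
  have Es: "smooth_on W ?E" by (intro m1.smooth m2.lap_smooth m1.lap_smooth f)
  have s1: "smooth_on W ((m1.lap ^^ Suc i) f)" "smooth_on W ((m1.lap ^^ i) ?E)"
    by (intro m1.lap_pow_smooth f Es)+
  have s2: "smooth_on W ((m2.lap ^^ Suc i) f)" "homog_on W (2 - 2 * real (Suc i)) ((m2.lap ^^ Suc i) f)"
    by (intro m2.lap_pow_smooth m2.lap_pow_homog f)+
  have e: "Suc (a + 2 - Suc i) = a + 2 - i" using Suc.prems by simp
  have "V (Suc (a + 2 - Suc i)) ?R" unfolding e by (rule Suc.IH) (use Suc.prems in simp)
  then have R: "V (a + 2 - Suc i) (m1.lap ?R)" by (rule m1.vanish_lap)
  have E: "V (a + 2 - Suc i) (\<lambda>x. m2.lap ((m2.lap ^^ Suc i) f) x - m1.lap ((m2.lap ^^ Suc i) f) x)"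
  proof (cases i)
    case 0
    let ?g = "(m2.lap ^^ Suc i) f"
    have g: "smooth_on W ?g" "homog_on W 0 ?g" using s2 0 by simp_all
    have 1: "V (a + 1) (\<lambda>x. m2.lap ?g x - m1.lap ?g x
        - (real (a + 2) * real (a + 1) * (0 * (0 - 1)) * (r1 x ^ a * (\<phi> x * ?g x))
        + real (a + 2) * (r1 x ^ (a + 1) * (\<phi> x * m1.flat_lap ?g x + 2 * (0 - 1) * m1.ip \<phi> ?g x))))"
      by (rule m1.vanish_mono[OF lap_difference[OF g]]) simp
    have 2: "V (a + 1) (\<lambda>x. real (a + 2) * (r1 x ^ (a + 1) * (\<phi> x * m1.flat_lap ?g x + 2 * (0 - 1) * m1.ip \<phi> ?g x)))"
      by (intro m1.vanish_cmult m1.vanishI[OF _ refl]) (intro m1.smooth \<phi>_smooth m1.flat_lap_smooth m1.ip_smooth g)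
    show ?thesis using m1.vanish_add[OF 1 2] 0 by simp
  next
    case (Suc j)
    show ?thesis by (rule m1.vanish_mono[OF V_lap_difference[OF s2]]) (use Suc in simp)
  qed
  show ?case
  proof (rule m1.vanish_cong[OF m1.vanish_add[OF E R]])
    fix x assume x: "x \<in> W"
    have "m1.lap ?R x = m1.lap (\<lambda>x. (m2.lap ^^ Suc i) f x + - 1 * ((m1.lap ^^ Suc i) f x + (m1.lap ^^ i) ?E x)) x"
      by (simp only: mult_minus1 diff_conv_add_uminus)
    also have "\<dots> = m1.lap ((m2.lap ^^ Suc i) f) x + m1.lap (\<lambda>x. - 1 * ((m1.lap ^^ Suc i) f x + (m1.lap ^^ i) ?E x)) x"
      by (intro m1.lap_add m1.smooth s1 s2 x)
    also have "m1.lap (\<lambda>x. - 1 * ((m1.lap ^^ Suc i) f x + (m1.lap ^^ i) ?E x)) x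
        = - 1 * m1.lap (\<lambda>x. (m1.lap ^^ Suc i) f x + (m1.lap ^^ i) ?E x) x"
      by (intro m1.lap_cmult m1.smooth s1 x)
    also have "m1.lap (\<lambda>x. (m1.lap ^^ Suc i) f x + (m1.lap ^^ i) ?E x) x
        = m1.lap ((m1.lap ^^ Suc i) f) x + m1.lap ((m1.lap ^^ i) ?E) x"
      by (intro m1.lap_add s1 x)
    finally show "m2.lap ((m2.lap ^^ Suc i) f) x - m1.lap ((m2.lap ^^ Suc i) f) x + m1.lap ?R x
        = (m2.lap ^^ Suc (Suc i)) f x - ((m1.lap ^^ Suc (Suc i)) f x + (m1.lap ^^ Suc i) ?E x)"
      by simp
  qed
qed

lemma lap_pow_difference_eq_0:
  assumes f: "smooth_on W f" "homog_on W 2 f" and x: "x \<in> W" "r1 x = 0"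
  shows "(m1.lap ^^ (a + 1)) (\<lambda>y. m2.lap f y - m1.lap f y) x = 0"
proof -
  let ?c = "real (a + 2) * real (a + 1)"
  let ?w = "\<lambda>y. \<phi> y * f y" and ?v = "\<lambda>y. \<phi> y * m1.flat_lap f y + 2 * m1.ip \<phi> f y"
  let ?t1 = "\<lambda>y. ?c * 2 * (r1 y ^ a * ?w y)" and ?t2 = "\<lambda>y. real (a + 2) * (r1 y ^ (a + 1) * ?v y)"
  let ?P = "\<Prod>i=1..a. m1.ladder_coeff i (- 2 * real (a + 1))"
  define R where "R = (\<lambda>y. m2.lap f y - m1.lap f y - (?t1 y + ?t2 y))"
  have R: "V (a + 2) R" unfolding R_def by (rule m1.vanish_cong[OF lap_difference[OF f]]) (simp add: algebra_simps)
  have ws: "smooth_on W ?w" by (intro m1.smooth \<phi>_smooth f)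
  have vs: "smooth_on W ?v" by (intro m1.smooth \<phi>_smooth f m1.flat_lap_smooth m1.ip_smooth)
  have wh: "homog_on W (- 2 * real a) ?w" using m1.homog_mult[OF \<phi>_homog f(2)] by simp
  have "homog_on W (0 + ((- 2 * real (a + 1) - 1) + (2 - 1))) (\<lambda>y. m1.G y $ I $ J * (pderiv_at I \<phi> y * pderiv_at J f y))" for I J
    by (intro m1.homog_mult m1.G_homog m1.homog_pderiv \<phi>_smooth \<phi>_homog f)
  then have "homog_on W (- 2 * real (a + 1)) (m1.ip \<phi> f)"
    unfolding m1.ip_def[abs_def] tr2_def by (intro m1.homog_sum) simp
  moreover have "homog_on W (- 2 * real (a + 1) + (2 - 2)) (\<lambda>y. \<phi> y * m1.flat_lap f y)"
    by (intro m1.homog_mult \<phi>_homog m1.flat_lap_homog f)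
  ultimately have vh: "homog_on W (- 2 * real (a + 1)) ?v"
    by (intro m1.homog_add m1.homog_cmult) simp_all
  have t1s: "smooth_on W ?t1" and t2s: "smooth_on W ?t2"
    by (intro m1.smooth m1.r_smooth \<phi>_smooth f m1.flat_lap_smooth m1.ip_smooth)+
  have Rs: "smooth_on W R" by (rule m1.vanish_smooth[OF R])
  have "(m1.lap ^^ (a + 1)) (\<lambda>y. m2.lap f y - m1.lap f y) x = (m1.lap ^^ (a + 1)) (\<lambda>y. R y + (?t1 y + ?t2 y)) x"
    by (rule m1.lap_pow_cong[OF _ x(1)]) (simp add: R_def)
  also have "\<dots> = (m1.lap ^^ (a + 1)) R x + ((m1.lap ^^ (a + 1)) ?t1 x + (m1.lap ^^ (a + 1)) ?t2 x)"
    by (simp only: m1.lap_pow_add[OF Rs m1.smooth(2)[OF t1s t2s] x(1)] m1.lap_pow_add[OF t1s t2s x(1)])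
  also have "(m1.lap ^^ (a + 1)) R x = 0"
    by (rule m1.vanish_eq_0[OF m1.vanish_lap_pow[of _ 1] _ x]) (use R in simp_all)
  also have "(m1.lap ^^ (a + 1)) ?t2 x = real (a + 2) * ((\<Prod>i=1..a + 1. m1.ladder_coeff i (- 2 * real (a + 1))) * ?v x)"
    by (subst m1.lap_pow_cmult[OF _ x(1)])
      (intro m1.smooth m1.r_smooth vs, simp only: m1.lap_pow_ladder[OF vs vh x])
  also have "(\<Prod>i=1..a + 1. m1.ladder_coeff i (- 2 * real (a + 1))) = ?P * (2 * real (a + 1))"
    by (simp add: m1.ladder_coeff_def algebra_simps)
  also have "(m1.lap ^^ (a + 1)) ?t1 x = ?c * 2 * (m1.lap ^^ (a + 1)) (\<lambda>y. r1 y ^ a * ?w y) x"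
    by (rule m1.lap_pow_cmult[OF _ x(1)]) (intro m1.smooth m1.r_smooth ws)
  also have "(m1.lap ^^ (a + 1)) (\<lambda>y. r1 y ^ a * ?w y) x = (m1.lap ^^ a) (m1.lap (\<lambda>y. r1 y ^ a * ?w y)) x"
    by (simp only: Suc_eq_plus1[symmetric] funpow_Suc_right o_apply)
  also have "\<dots> = (m1.lap ^^ a) (\<lambda>y. r1 y ^ a * m1.lap ?w y) x"
  proof (rule m1.lap_pow_cong[OF _ x(1)])
    fix y assume "y \<in> W"
    then show "m1.lap (\<lambda>y. r1 y ^ a * ?w y) y = r1 y ^ a * m1.lap ?w y"
      using m1.lap_power_mult[OF ws wh, of y "a - 1"] m1.a_pos by (simp add: m1.ladder_coeff_def)
  qed
  also have "\<dots> = ?P * m1.lap ?w x"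
  proof -
    have "- 2 * real a - 2 = - 2 * real (a + 1)" by simp
    with m1.lap_homog[OF ws wh] have "homog_on W (- 2 * real (a + 1)) (m1.lap ?w)" by metis
    from m1.lap_pow_ladder[OF m1.lap_smooth[OF ws] this x, of a] show ?thesis .
  qed
  also have "m1.lap ?w x = - ?v x"
  proof -
    have "m1.drift K x = 0" for K
      using m1.vanish_eq_0[OF m1.drift_vanish _ x] m1.a_pos by simp
    then have "m1.lap ?w x = - m1.flat_lap ?w x" by (simp add: m1.lap_eq[OF x(1)])
    then show ?thesis by (simp add: m1.flat_lap_mult[OF \<phi>_smooth f(1) x(1)] flat_lap_\<phi>[OF x])
  qed
  finally show ?thesis by (simp add: algebra_simps)
qed

theorem lap_pow_eq:
  assumes f: "smooth_on W f" "homog_on W 2 f" and x: "x \<in> W" "r1 x = 0"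
  shows "(m1.lap ^^ (a + 2)) f x = (m2.lap ^^ (a + 2)) f x"
  using m1.vanish_eq_0[OF lap_pow_telescope[OF f, of "a + 1"] _ x] lap_pow_difference_eq_0[OF f x]
  by simp

end

section \<open>Charts and the ambient space\<close>

context
  fixes A :: "('a::topological_space, 'k::finite) chart set"
  assumes A: "oriented_manifold UNIV A"
begin

lemma chart_on_UNIV: "c \<in> A \<Longrightarrow> chart_on UNIV c"
  and charts_compatible: "c \<in> A \<Longrightarrow> c' \<in> A \<Longrightarrow> compatible c c'"
  using A unfolding oriented_manifold_def by blast+

lemma jac_pos: "c \<in> A \<Longrightarrow> c' \<in> A \<Longrightarrow> p \<in> fst c \<Longrightarrow> p \<in> fst c' \<Longrightarrow> jac c c' p > 0"
  using charts_compatible unfolding compatible_def by blast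

lemma transition_smooth: "c \<in> A \<Longrightarrow> c' \<in> A \<Longrightarrow> smooth_on (overlap c c') (transition c c')"
  using charts_compatible unfolding compatible_def by blast

lemma chart_open: "c \<in> A \<Longrightarrow> open (fst c)" and chart_image_open: "c \<in> A \<Longrightarrow> open (snd c ` fst c)"
  using chart_on_UNIV by (auto simp: chart_on_def)

lemma chart_homeomorphism:
  assumes "c \<in> A"
  shows "homeomorphism (fst c) (snd c ` fst c) (snd c) (coord_inv c)"
proof -
  obtain g where g: "homeomorphism (fst c) (snd c ` fst c) (snd c) g"
    using chart_on_UNIV[OF assms] by (auto simp: chart_on_def)
  have inj: "inj_on (snd c) (fst c)"
    using g by (metis homeomorphism_apply1 inj_on_inverseI)
  have "coord_inv c x = g x" if "x \<in> snd c ` fst c" for x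
    using that homeomorphism_apply1[OF g] by (auto simp: coord_inv_def inv_into_f_f[OF inj])
  then show ?thesis by (intro homeomorphism_cong[OF g]) simp_all
qed

lemma coord_inv_left: "c \<in> A \<Longrightarrow> p \<in> fst c \<Longrightarrow> coord_inv c (snd c p) = p"
  using chart_homeomorphism homeomorphism_apply1 by blast

lemma coord_inv_right: "c \<in> A \<Longrightarrow> x \<in> snd c ` fst c \<Longrightarrow> snd c (coord_inv c x) = x"
  using chart_homeomorphism homeomorphism_apply2 by blast

lemma coord_inv_mem: "c \<in> A \<Longrightarrow> x \<in> snd c ` fst c \<Longrightarrow> coord_inv c x \<in> fst c"
  by (simp add: coord_inv_def inv_into_into)

lemma chart_continuous: "c \<in> A \<Longrightarrow> continuous_on (fst c) (snd c)"
  using chart_homeomorphism homeomorphism_cont1 by blast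

lemma coord_inv_continuous: "c \<in> A \<Longrightarrow> continuous_on (snd c ` fst c) (coord_inv c)"
  using chart_homeomorphism homeomorphism_cont2 by blast

lemma chart_image_open_subset:
  assumes "c \<in> A" "open U" "U \<subseteq> fst c"
  shows "open (snd c ` U)"
proof -
  have "open (snd c ` fst c \<inter> coord_inv c -` U)"
    by (rule continuous_open_preimage[OF coord_inv_continuous chart_image_open]) (use assms in auto)
  also have "snd c ` fst c \<inter> coord_inv c -` U = snd c ` U"
  proof (intro set_eqI iffI)
    fix x assume "x \<in> snd c ` U"
    then obtain q where "q \<in> U" "x = snd c q" by blast
    then show "x \<in> snd c ` fst c \<inter> coord_inv c -` U"
      using assms coord_inv_left[OF assms(1), of q] by auto
  next
    fix x assume x: "x \<in> snd c ` fst c \<inter> coord_inv c -` U"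
    then have "snd c (coord_inv c x) = x" using coord_inv_right[OF assms(1)] by blast
    then show "x \<in> snd c ` U" using x by (metis IntD2 image_eqI vimageE)
  qed
  finally show ?thesis .
qed

lemma chart_preimage_open:
  assumes "c \<in> A" "open X"
  shows "open {q \<in> fst c. snd c q \<in> X}"
proof -
  have "open (fst c \<inter> snd c -` X)"
    by (rule continuous_open_preimage[OF chart_continuous chart_open]) (use assms in auto)
  also have "fst c \<inter> snd c -` X = {q \<in> fst c. snd c q \<in> X}" by auto
  finally show ?thesis .
qed

lemma proj_densityD:
  assumes "f \<in> proj_densities A w" "c \<in> A" "c' \<in> A" "p \<in> fst c" "p \<in> fst c'"
  shows "f p c = jac c c' p powr proj_exponent A w * f p c'"
  using assms unfolding proj_densities_def density_sections_def density_fibre_def by blast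

lemma scale_pos: "\<tau> \<in> scales A \<Longrightarrow> c \<in> A \<Longrightarrow> p \<in> fst c \<Longrightarrow> \<tau> p c > 0"
  by (simp add: scales_def)

lemma proj_density_smooth: "f \<in> proj_densities A w \<Longrightarrow> c \<in> A \<Longrightarrow> smooth_on (snd c ` fst c) (\<lambda>x. f (coord_inv c x) c)"
  by (simp add: proj_densities_def density_sections_def)

lemma ambient_space_iff:
  "(p, v) \<in> ambient_space A U \<longleftrightarrow>
    p \<in> U \<and> v \<in> density_fibre A (proj_exponent A (- 1)) p \<and> (\<forall>c\<in>A. p \<in> fst c \<longrightarrow> v c > 0)"
  by (simp add: ambient_space_def)

lemma ambient_fibreD:
  assumes "(p, v) \<in> ambient_space A U" "c \<in> A" "c' \<in> A" "p \<in> fst c" "p \<in> fst c'"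
  shows "v c = jac c c' p powr proj_exponent A (- 1) * v c'"
  using assms unfolding ambient_space_iff density_fibre_def by blast

lemma scaled_scale_point_mem:
  assumes \<tau>: "\<tau> \<in> scales A" and "p \<in> U" "t > 0"
  shows "(p, \<lambda>c. t * inverse (\<tau> p c)) \<in> ambient_space A U"
proof -
  have \<tau>': "\<tau> \<in> proj_densities A 1" using \<tau> by (simp add: scales_def)
  have "inverse (\<tau> p c) = jac c c' p powr proj_exponent A (- 1) * inverse (\<tau> p c')"
    if "c \<in> A" "c' \<in> A" "p \<in> fst c" "p \<in> fst c'" for c c'
  proof -
    have "proj_exponent A (- 1) = - proj_exponent A 1" by (simp add: proj_exponent_def)
    then show ?thesis
      by (simp add: proj_densityD[OF \<tau>' that] powr_minus)
  qed
  note 1 = this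
  have "\<tau> p c = 0" if "\<not> (c \<in> A \<and> p \<in> fst c)" for c
    using \<tau>' that unfolding proj_densities_def density_sections_def density_fibre_def by blast
  note 2 = this
  have "(\<lambda>c. t * inverse (\<tau> p c)) \<in> density_fibre A (proj_exponent A (- 1)) p"
    unfolding density_fibre_def mem_Collect_eq
  proof (intro conjI ballI allI impI)
    show "t * inverse (\<tau> p c) = jac c c' p powr proj_exponent A (- 1) * (t * inverse (\<tau> p c'))"
      if "c \<in> A" "c' \<in> A" "p \<in> fst c \<inter> fst c'" for c c'
      unfolding 1[OF that(1,2) IntD1[OF that(3)] IntD2[OF that(3)]] by (simp only: mult.left_commute)
  qed (simp add: 2)
  then show ?thesis
    using assms scale_pos[OF \<tau>] unfolding ambient_space_iff by simp
qed

lemma density_fun_chart: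
  assumes f: "f \<in> proj_densities A w" and z: "(p, v) \<in> ambient_space A U" and c: "c \<in> A" "p \<in> fst c"
  shows "density_fun A w f (p, v) = f p c * v c powr w"
proof -
  define c' where "c' = (SOME c. c \<in> A \<and> p \<in> fst c)"
  have c': "c' \<in> A" "p \<in> fst c'"
    using someI[of "\<lambda>c. c \<in> A \<and> p \<in> fst c" c] c by (auto simp: c'_def)
  have v: "v c > 0" using z c by (auto simp: ambient_space_def)
  have J: "jac c' c p > 0" by (rule jac_pos[OF c'(1) c(1) c'(2) c(2)])
  have "f p c' * v c' powr w = (jac c' c p powr proj_exponent A w * f p c)
      * (jac c' c p powr proj_exponent A (- 1) * v c) powr w"
    using proj_densityD[OF f c'(1) c(1) c'(2) c(2)] ambient_fibreD[OF z c'(1) c(1) c'(2) c(2)] by simp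
  also have "\<dots> = jac c' c p powr (proj_exponent A w + proj_exponent A (- 1) * w) * (f p c * v c powr w)"
    using v by (simp add: powr_mult powr_powr powr_add)
  also have "proj_exponent A w + proj_exponent A (- 1) * w = 0"
    by (simp add: proj_exponent_def)
  finally show ?thesis using J by (simp add: density_fun_def c'_def Let_def)
qed

end

definition slope :: "real ^ ('k option) \<Rightarrow> real ^ 'k::finite" where
  "slope x = (\<chi> i. x $ Some i / x $ None)"

definition cone_over :: "(real ^ 'k::finite) set \<Rightarrow> (real ^ ('k option)) set" where
  "cone_over V = {x. x $ None > 0 \<and> slope x \<in> V}"

definition cone_fun :: "real \<Rightarrow> (real ^ 'k::finite \<Rightarrow> real) \<Rightarrow> real ^ ('k option) \<Rightarrow> real" where
  "cone_fun s f x = f (slope x) * x $ None powr s"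

definition base_point :: "real ^ 'k::finite \<Rightarrow> real ^ ('k option)" where
  "base_point y = (\<chi> I. case I of None \<Rightarrow> 1 | Some i \<Rightarrow> y $ i)"

lemma base_point_nth [simp]: "base_point y $ None = 1" "base_point y $ Some i = y $ i"
  by (simp_all add: base_point_def)

lemma slope_base_point [simp]: "slope (base_point y) = y"
  by (simp add: slope_def vec_eq_iff)

lemma slope_scaleR [simp]: "t > 0 \<Longrightarrow> slope (t *\<^sub>R x) = slope x"
  by (simp add: slope_def vec_eq_iff)

lemma base_point_slope: "x $ None > 0 \<Longrightarrow> x $ None *\<^sub>R base_point (slope x) = x"
  unfolding vec_eq_iff by (intro allI, case_tac i) (auto simp: slope_def)

lemma base_point_mem_cone_over [simp]: "base_point y \<in> cone_over V \<longleftrightarrow> y \<in> V"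
  by (simp add: cone_over_def)

lemma smooth_base_point: "open V \<Longrightarrow> smooth_on V base_point"
proof -
  assume V: "open V"
  have "smooth_on V (\<lambda>y. (case I of None \<Rightarrow> 1 | Some i \<Rightarrow> y $ i))" for I :: "'a option"
    by (cases I) (auto intro: smooth_on_const smooth_on_bounded_linear[OF V] bounded_linear_vec_nth)
  then show ?thesis
    unfolding base_point_def[abs_def] by (rule smooth_on_vec_lambda[OF V])
qed

lemma smooth_slope:
  assumes "open X" "\<And>x. x \<in> X \<Longrightarrow> x $ None > 0"
  shows "smooth_on X slope"
proof -
  interpret open_set X using assms(1) by unfold_locales
  show ?thesis
    unfolding slope_def[abs_def]
    by (intro smooth_on_vec_lambda smooth_on_divide assms(1) smooth_nth) (use assms(2) in force)
qed

lemma open_half_space_None: "open {x :: real ^ ('k::finite option). x $ None > 0}"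
  by (intro open_Collect_less continuous_intros)

lemma open_cone_over:
  assumes "open V"
  shows "open (cone_over V)"
proof -
  have "open ({x. x $ None > 0} \<inter> slope -` V)"
    by (intro continuous_open_preimage smooth_on_imp_continuous_on smooth_slope open_half_space_None assms) simp
  also have "{x. x $ None > 0} \<inter> slope -` V = cone_over V" by (auto simp: cone_over_def)
  finally show ?thesis .
qed

lemma open_cone_cone_over: "open V \<Longrightarrow> open_cone (cone_over V)"
  by unfold_locales (auto simp: open_cone_over, auto simp: cone_over_def)

lemma smooth_cone_fun:
  assumes V: "open V" "smooth_on V f"
  shows "smooth_on (cone_over V) (cone_fun s f)"
proof -
  interpret open_cone "cone_over V" by (rule open_cone_cone_over[OF V(1)])
  have pos: "x $ None > 0" "slope x \<in> V" if "x \<in> cone_over V" for x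
    using that by (auto simp: cone_over_def)
  show ?thesis
    unfolding cone_fun_def[abs_def]
    by (intro smooth smooth_on_powr W smooth_on_compose[OF W V smooth_slope[OF W]] smooth_nth pos)
qed

lemma homog_cone_fun: "homog_on (cone_over V) s (cone_fun s f)"
  by (auto simp: homog_on_def cone_fun_def cone_over_def powr_mult)

context
  fixes A :: "('a::topological_space, 'k::finite) chart set" and c :: "('a, 'k) chart"
    and \<tau> :: "'a \<Rightarrow> ('a, 'k) chart \<Rightarrow> real"
  assumes A: "oriented_manifold UNIV A" and \<tau>: "\<tau> \<in> scales A" and c: "c \<in> A"
begin

lemma inj_on_ambient_coords: "inj_on (ambient_coords c) (ambient_space A (fst c))"
proof (rule inj_onI, clarify)
  fix p v p' v'
  assume z: "(p, v) \<in> ambient_space A (fst c)" "(p', v') \<in> ambient_space A (fst c)"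
    and eq: "ambient_coords c (p, v) = ambient_coords c (p', v')"
  have pc: "p \<in> fst c" "p' \<in> fst c" using z by (auto simp: ambient_space_def)
  have pos: "v c > 0" using z c pc by (auto simp: ambient_space_def)
  have vc: "v c = v' c" using arg_cong[OF eq, of "\<lambda>x. x $ None"] by (simp add: ambient_coords_def)
  have "snd c p $ i = snd c p' $ i" for i
    using arg_cong[OF eq, of "\<lambda>x. x $ Some i"] vc pos by (simp add: ambient_coords_def)
  then have "snd c p = snd c p'" by (simp add: vec_eq_iff)
  then have p: "p = p'" using coord_inv_left[OF A c] pc by metis
  have "v c' = v' c'" for c'
  proof (cases "c' \<in> A \<and> p \<in> fst c'")
    case True
    then show ?thesis
      using ambient_fibreD[OF A z(1), of c' c] ambient_fibreD[OF A z(2), of c' c] c pc p vc by simp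
  next
    case False
    then have "v c' = 0" "v' c' = 0"
      using z p unfolding ambient_space_iff[OF A] density_fibre_def by blast+
    then show ?thesis by simp
  qed
  then show "p = p' \<and> v = v'" using p by auto
qed

lemma ambient_coords_surj:
  assumes "x \<in> cone_over (snd c ` fst c)"
  obtains v where "(coord_inv c (slope x), v) \<in> ambient_space A (fst c)"
    "ambient_coords c (coord_inv c (slope x), v) = x" "v c = x $ None"
proof -
  define q where "q = coord_inv c (slope x)"
  have x: "x $ None > 0" "slope x \<in> snd c ` fst c" using assms by (auto simp: cone_over_def)
  have q: "q \<in> fst c" "snd c q = slope x"
    using x coord_inv_mem[OF A c] coord_inv_right[OF A c] by (auto simp: q_def)
  have \<tau>q: "\<tau> q c > 0" using scale_pos[OF A \<tau> c q(1)] .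
  define v where "v = (\<lambda>c'. (x $ None * \<tau> q c) * inverse (\<tau> q c'))"
  have vc: "v c = x $ None" using \<tau>q by (simp add: v_def)
  show ?thesis
  proof (rule that[of v, folded q_def])
    show "(q, v) \<in> ambient_space A (fst c)"
      unfolding v_def using x \<tau>q q by (intro scaled_scale_point_mem[OF A \<tau>]) auto
    have "ambient_coords c (q, v) $ I = x $ I" for I
      using x by (cases I) (auto simp: ambient_coords_def vc q slope_def)
    then show "ambient_coords c (q, v) = x" by (simp add: vec_eq_iff)
  qed (rule vc)
qed

lemma ambient_expr_coords:
  "z \<in> ambient_space A (fst c) \<Longrightarrow> ambient_expr A c F (ambient_coords c z) = F z"
  by (simp add: ambient_expr_def inv_into_f_f[OF inj_on_ambient_coords])

lemma ambient_expr_density: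
  assumes f: "f \<in> proj_densities A w" and x: "x \<in> cone_over (snd c ` fst c)"
  shows "ambient_expr A c (density_fun A w f) x = cone_fun w (\<lambda>y. f (coord_inv c y) c) x"
proof -
  obtain v where v: "(coord_inv c (slope x), v) \<in> ambient_space A (fst c)"
    "ambient_coords c (coord_inv c (slope x), v) = x" "v c = x $ None"
    using ambient_coords_surj[OF x] .
  have "coord_inv c (slope x) \<in> fst c" using v(1) by (auto simp: ambient_space_def)
  then show ?thesis
    using ambient_expr_coords[OF v(1), of "density_fun A w f"] density_fun_chart[OF A f v(1) c]
    by (simp add: v(2,3) cone_fun_def)
qed

lemma scale_point_mem: "p \<in> U \<Longrightarrow> scale_point \<tau> p \<in> ambient_space A U"
  using scaled_scale_point_mem[OF A \<tau>, of p U 1] by (simp add: scale_point_def)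

lemma scale_point_coords:
  "ambient_coords c (scale_point \<tau> p) = inverse (\<tau> p c) *\<^sub>R base_point (snd c p)"
  unfolding vec_eq_iff by (intro allI, case_tac i) (auto simp: ambient_coords_def scale_point_def)

lemma density_fun_scale_point:
  assumes "f \<in> proj_densities A w" "p \<in> fst c"
  shows "density_fun A w f (scale_point \<tau> p) = f p c * inverse (\<tau> p c) powr w"
  using density_fun_chart[OF A assms(1) scale_point_mem[OF assms(2), unfolded scale_point_def] c assms(2)]
  by (simp add: scale_point_def)

end

section \<open>Reduction to affine coordinates\<close>

lemma flattening_chart:
  fixes A :: "('a::topological_space, 'n::finite option) chart set"
  assumes A: "oriented_manifold UNIV A" and \<Omega>: "smooth_domain A \<Omega>" and p: "p \<in> frontier \<Omega>"
  obtains b where "b \<in> A" "p \<in> fst b" "\<And>q. q \<in> fst b \<Longrightarrow> q \<in> frontier \<Omega> \<longleftrightarrow> snd b q $ None = 0"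
proof -
  have o: "open \<Omega>" using \<Omega> by (simp add: smooth_domain_def)
  then have fr: "frontier \<Omega> = closure \<Omega> - \<Omega>" by (simp add: frontier_def interior_open)
  obtain b where b: "b \<in> A" "p \<in> fst b" and eq: "fst b \<inter> \<Omega> = {q \<in> fst b. snd b q $ None < 0}"
    using \<Omega> p unfolding smooth_domain_def by blast
  have mem: "q \<in> \<Omega> \<longleftrightarrow> snd b q $ None < 0" if "q \<in> fst b" for q using eq that by blast
  have "q \<in> frontier \<Omega> \<longleftrightarrow> snd b q $ None = 0" if q: "q \<in> fst b" for q
  proof
    assume f: "q \<in> frontier \<Omega>"
    define X where "X = {q \<in> fst b. snd b q \<in> {x. x $ None > 0}}"
    have "open X" unfolding X_def by (rule chart_preimage_open[OF A b(1) open_half_space_None])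
    moreover have "X \<inter> \<Omega> = {}" using mem by (auto simp: X_def)
    ultimately have "X \<inter> closure \<Omega> = {}" by (simp add: open_Int_closure_eq_empty)
    then have "\<not> snd b q $ None > 0" using f q by (auto simp: fr X_def)
    moreover have "\<not> snd b q $ None < 0" using f mem[OF q] by (simp add: fr)
    ultimately show "snd b q $ None = 0" by simp
  next
    assume 0: "snd b q $ None = 0"
    have "q \<in> closure \<Omega>"
    proof (rule ccontr)
      assume nq: "q \<notin> closure \<Omega>"
      define X where "X = snd b ` (fst b \<inter> - closure \<Omega>)"
      have "open X" unfolding X_def
        by (rule chart_image_open_subset[OF A b(1)]) (use chart_open[OF A b(1)] in auto)
      moreover have "snd b q \<in> X" using q nq by (auto simp: X_def)
      ultimately obtain e where e: "e > 0" "cball (snd b q) e \<subseteq> X" using open_contains_cball by blast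
      define x where "x = snd b q - e *\<^sub>R axis None 1"
      have "x \<in> cball (snd b q) e" using e by (simp add: x_def dist_norm)
      then obtain q' where q': "q' \<in> fst b" "q' \<notin> closure \<Omega>" "x = snd b q'" using e(2) by (auto simp: X_def)
      have "snd b q' $ None < 0" using e 0 by (simp add: q'(3)[symmetric] x_def axis_def)
      then show False using mem[OF q'(1)] q'(2) closure_subset by blast
    qed
    then show "q \<in> frontier \<Omega>" using mem[OF q] 0 by (simp add: fr)
  qed
  then show ?thesis using that b by blast
qed

lemma defining_function_division:
  fixes A :: "('a::topological_space, 'n::finite option) chart set"
  assumes A: "oriented_manifold UNIV A" and \<Omega>: "smooth_domain A \<Omega>" and r: "defining_function A \<Omega> r"
    and c: "c \<in> A" and p: "p \<in> fst c \<inter> frontier \<Omega>"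
    and V0: "open V0" "snd c p \<in> V0" "V0 \<subseteq> snd c ` fst c"
  obtains V where "open V" "snd c p \<in> V" "V \<subseteq> V0"
    "\<And>f. smooth_on V f \<Longrightarrow> (\<And>y. y \<in> V \<Longrightarrow> coord_inv c y \<in> frontier \<Omega> \<Longrightarrow> f y = 0) \<Longrightarrow>
       \<exists>k. smooth_on V k \<and> (\<forall>y\<in>V. f y = r (coord_inv c y) * k y)"
proof -
  obtain b where b: "b \<in> A" "p \<in> fst b" and fr: "\<And>q. q \<in> fst b \<Longrightarrow> q \<in> frontier \<Omega> \<longleftrightarrow> snd b q $ None = 0"
    using flattening_chart[OF A \<Omega>] p by blast
  have r0: "r q = 0 \<longleftrightarrow> q \<in> frontier \<Omega>" for q using r unfolding defining_function_def by blast
  define N where "N = {q \<in> fst c. snd c q \<in> V0} \<inter> fst b"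
  have N: "open N" unfolding N_def
    by (intro open_Int chart_preimage_open[OF A c V0(1)] chart_open[OF A b(1)])
  have oN: "open (snd b ` N)" by (rule chart_image_open_subset[OF A b(1) N]) (auto simp: N_def)
  have "snd b p \<in> snd b ` N" using p b V0 by (auto simp: N_def)
  then obtain d where d: "d > 0" "ball (snd b p) d \<subseteq> snd b ` N" using oN open_contains_ball by blast
  define B where "B = ball (snd b p) d"
  have xb: "snd b p $ None = 0" using fr b p by blast
  have oB: "open B" by (simp add: B_def)
  have BsubN: "B \<subseteq> snd b ` N" using d(2) by (simp add: B_def)
  have BN: "coord_inv b x \<in> N" "snd b (coord_inv b x) = x" if "x \<in> B" for x
  proof -
    obtain q where q: "q \<in> N" "x = snd b q" using BsubN \<open>x \<in> B\<close> by blast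
    then have "coord_inv b x = q" using coord_inv_left[OF A b(1)] by (simp add: N_def)
    then show "coord_inv b x \<in> N" "snd b (coord_inv b x) = x" using q by auto
  qed
  define V where "V = snd c ` coord_inv b ` B"
  have Bset: "coord_inv b ` B = {q \<in> fst b. snd b q \<in> B}"
    using BN coord_inv_left[OF A b(1)] by (force simp: N_def image_iff)
  have "open (coord_inv b ` B)" unfolding Bset by (rule chart_preimage_open[OF A b(1) oB])
  then have oV: "open V" unfolding V_def
    by (rule chart_image_open_subset[OF A c]) (use BN in \<open>auto simp: N_def\<close>)
  have "snd b p \<in> B" using d(1) by (simp add: B_def)
  then have pV: "snd c p \<in> V"
    unfolding V_def using coord_inv_left[OF A b] by (metis imageI)
  have VV0: "V \<subseteq> V0" using BN by (auto simp: V_def N_def)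
  have tb: "transition b c x \<in> V" "coord_inv c (transition b c x) = coord_inv b x" if "x \<in> B" for x
    using that BN[OF that] coord_inv_left[OF A c] by (auto simp: transition_def V_def N_def)
  have tc: "transition c b y \<in> B" "coord_inv b (transition c b y) = coord_inv c y" "transition b c (transition c b y) = y"
    if "y \<in> V" for y
  proof -
    obtain x where x: "x \<in> B" "y = snd c (coord_inv b x)" using \<open>y \<in> V\<close> unfolding V_def by blast
    have y: "coord_inv c y = coord_inv b x" using x BN[OF x(1)] coord_inv_left[OF A c] by (simp add: N_def)
    show "transition c b y \<in> B" "coord_inv b (transition c b y) = coord_inv c y" "transition b c (transition c b y) = y"
      using x y BN[OF x(1)] by (simp_all add: transition_def)
  qed
  have ov: "open (overlap b c)" "open (overlap c b)"
    unfolding overlap_def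
    by (rule chart_image_open_subset[OF A b(1)], use chart_open[OF A b(1)] chart_open[OF A c] in auto)
      (rule chart_image_open_subset[OF A c], use chart_open[OF A b(1)] chart_open[OF A c] in auto)
  have tbs: "smooth_on B (transition b c)"
    by (rule smooth_on_subset[OF ov(1) _ transition_smooth[OF A b(1) c]])
      (use BsubN in \<open>auto simp: N_def overlap_def\<close>)
  have tcs: "smooth_on V (transition c b)"
    by (rule smooth_on_subset[OF ov(2) _ transition_smooth[OF A c b(1)]])
      (use BN in \<open>auto simp: V_def N_def overlap_def\<close>)
  have frB: "coord_inv b x \<in> frontier \<Omega> \<longleftrightarrow> x $ None = 0" if "x \<in> B" for x
    using fr[of "coord_inv b x"] BN[OF that] by (simp add: N_def)
  have Rs: "smooth_on B (r \<circ> coord_inv b)"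
  proof (rule smooth_on_subset[OF chart_image_open[OF A b(1)]])
    show "smooth_on (snd b ` fst b) (r \<circ> coord_inv b)"
      using r b(1) by (simp add: defining_function_def smooth_fun_def)
  qed (use BsubN in \<open>auto simp: N_def\<close>)
  obtain u where u: "smooth_on B u" "\<And>x. x \<in> B \<Longrightarrow> (r \<circ> coord_inv b) x = x $ None * u x"
    using smooth_division[OF xb Rs[unfolded B_def]] r0 frB unfolding B_def by (auto simp: B_def)
  have u0: "u x \<noteq> 0" if x: "x \<in> B" for x
  proof
    assume ux: "u x = 0"
    then have "r (coord_inv b x) = 0" using u(2)[OF x] by simp
    then have f: "coord_inv b x \<in> frontier \<Omega>" by (simp add: r0)
    then have x0: "x $ None = 0" using frB[OF x] by simp
    have "((\<lambda>x. x $ None * u x) has_derivative (\<lambda>v. x $ None * frechet_derivative u (at x) v + v $ None * u x)) (at x)"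
      by (intro has_derivative_mult smooth_on_has_derivative[OF oB u(1) x]
          bounded_linear_imp_has_derivative bounded_linear_vec_nth)
    then have "((\<lambda>x. x $ None * u x) has_derivative (\<lambda>v. 0)) (at x)" by (simp add: ux x0)
    then have "((r \<circ> coord_inv b) has_derivative (\<lambda>v. 0)) (at x)"
      by (rule has_derivative_transform_within_open[OF _ oB x]) (simp only: u(2))
    then have "frechet_derivative (r \<circ> coord_inv b) (at x) = (\<lambda>v. 0)" by (rule frechet_derivativeI)
    moreover have "\<exists>v. frechet_derivative (r \<circ> coord_inv b) (at (snd b (coord_inv b x))) v \<noteq> 0"
      using r b(1) f BN[OF x] unfolding defining_function_def N_def by blast
    ultimately show False using BN(2)[OF x] by simp
  qed
  show ?thesis
  proof (rule that[OF oV pV VV0])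
    fix f :: "real ^ 'n option \<Rightarrow> real"
    assume f: "smooth_on V f" "\<And>y. y \<in> V \<Longrightarrow> coord_inv c y \<in> frontier \<Omega> \<Longrightarrow> f y = 0"
    have Fs: "smooth_on B (\<lambda>x. f (transition b c x))"
      by (rule smooth_on_compose[OF oB oV f(1) tbs tb(1)])
    have "f (transition b c x) = 0" if "x \<in> B" "x $ None = 0" for x
      by (rule f(2)[OF tb(1)[OF that(1)]]) (use that tb(2)[OF that(1)] frB in auto)
    then obtain h where h: "smooth_on B h" "\<And>x. x \<in> B \<Longrightarrow> f (transition b c x) = x $ None * h x"
      using smooth_division[OF xb Fs[unfolded B_def]] unfolding B_def by blast
    have "smooth_on V (\<lambda>y. h (transition c b y) / u (transition c b y))"
      using smooth_on_compose[OF oV oB smooth_on_divide[OF oB h(1) u(1) u0] tcs tc(1)] by simp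
    moreover have "f y = r (coord_inv c y) * (h (transition c b y) / u (transition c b y))" if y: "y \<in> V" for y
      using h(2)[OF tc(1)[OF y]] u(2)[OF tc(1)[OF y]] u0[OF tc(1)[OF y]] tc(2,3)[OF y] by simp
    ultimately show "\<exists>k. smooth_on V k \<and> (\<forall>y\<in>V. f y = r (coord_inv c y) * k y)" by blast
  qed
qed

context
  fixes A :: "('a::topological_space, 'n::finite option) chart set"
    and S :: "('a, 'n option) conn set" and \<Omega> :: "'a set" and c :: "('a, 'n option) chart" and a :: nat
  assumes A: "oriented_manifold UNIV A" and c: "affine_coords A S c" and a: "CARD('n) = 2 * a"
begin

lemma cA: "c \<in> A" using c by (simp add: affine_coords_def)

abbreviation expr :: "real \<Rightarrow> ('a \<Rightarrow> ('a, 'n option) chart \<Rightarrow> real) \<Rightarrow> real ^ ('n option option) \<Rightarrow> real" where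
  "expr w f \<equiv> ambient_expr A c (density_fun A w f)"

abbreviation coeff :: "('a \<Rightarrow> ('a, 'n option) chart \<Rightarrow> real) \<Rightarrow> real ^ ('n option) \<Rightarrow> real" where
  "coeff f y \<equiv> f (coord_inv c y) c"

lemma expr_eq:
  assumes "\<sigma> \<in> scales A" "f \<in> proj_densities A w" "V \<subseteq> snd c ` fst c" "x \<in> cone_over V"
  shows "expr w f x = cone_fun w (coeff f) x"
  by (rule ambient_expr_density[OF A assms(1) cA assms(2)]) (use assms in \<open>auto simp: cone_over_def\<close>)

lemma expr_smooth_homog:
  assumes \<sigma>: "\<sigma> \<in> scales A" and f: "f \<in> proj_densities A w" and V: "open V" "V \<subseteq> snd c ` fst c"
  shows "smooth_on (cone_over V) (expr w f)" "homog_on (cone_over V) w (expr w f)"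
proof -
  interpret open_cone "cone_over V" by (rule open_cone_cone_over[OF V(1)])
  have "smooth_on V (coeff f)"
    by (rule smooth_on_subset[OF chart_image_open[OF A cA] V(2) proj_density_smooth[OF A f cA]])
  then show "smooth_on (cone_over V) (expr w f)"
    by (intro smooth_cong[OF smooth_cone_fun[OF V(1)]]) (simp_all add: expr_eq[OF \<sigma> f V(2)])
  show "homog_on (cone_over V) w (expr w f)"
    by (rule homog_cong[OF homog_cone_fun]) (simp add: expr_eq[OF \<sigma> f V(2)])
qed

lemma fefferman_local:
  assumes F: "fefferman_with A S \<Omega> \<rho> \<theta>" and \<sigma>: "\<sigma> \<in> scales A"
    and V: "open V" "V \<subseteq> snd c ` fst c" and a1: "a \<ge> 1"
    and small: "\<And>y. y \<in> V \<Longrightarrow> coeff \<theta> y * coeff \<rho> y ^ (a + 1) < 1"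
  shows "fefferman (cone_over V) (expr 2 \<rho>) (expr (- real CARD('n) - 2) \<theta>) a"
proof -
  have \<rho>: "\<rho> \<in> proj_densities A 2" and \<theta>: "\<theta> \<in> proj_densities A (- real CARD('n) - 2)"
    using F by (auto simp: fefferman_with_def defining_density_def)
  have J: "det (hessian (expr 2 \<rho>) x) = - 1 + expr (- real CARD('n) - 2) \<theta> x * expr 2 \<rho> x ^ (a + 1)"
    if x: "x \<in> cone_over V" for x
  proof -
    have "x \<in> cone_over (snd c ` fst c)" using x V(2) by (auto simp: cone_over_def)
    then obtain v where v: "(coord_inv c (slope x), v) \<in> ambient_space A (fst c)"
      "ambient_coords c (coord_inv c (slope x), v) = x"
      using ambient_coords_surj[OF A \<sigma> cA] by metis
    have e: "expr w f x = density_fun A w f (coord_inv c (slope x), v)" for w f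
      using ambient_expr_coords[OF A \<sigma> cA v(1), of "density_fun A w f"] v(2) by simp
    have "J_op A c \<rho> (coord_inv c (slope x), v) = - 1 + expr (- real CARD('n) - 2) \<theta> x * expr 2 \<rho> x ^ (CARD('n) div 2 + 1)"
      unfolding e using F c v(1) unfolding fefferman_with_def by blast
    then show ?thesis by (simp add: J_op_def ambient_metric_def v(2) a)
  qed
  have neg: "expr (- real CARD('n) - 2) \<theta> x * expr 2 \<rho> x ^ (a + 1) < 1" if x: "x \<in> cone_over V" for x
  proof -
    define t where "t = x $ None"
    have t: "t > 0" using x by (simp add: cone_over_def t_def)
    have "t powr (- real CARD('n) - 2) * (t powr 2) ^ (a + 1) = 1"
    proof -
      have "(t powr 2) ^ (a + 1) = (t powr 2) powr real (a + 1)"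
        by (rule powr_realpow[symmetric]) (use t in simp)
      then have "t powr (- real CARD('n) - 2) * (t powr 2) ^ (a + 1)
          = t powr (- real CARD('n) - 2 + 2 * real (a + 1))"
        by (simp only: powr_powr powr_add)
      also have "- real CARD('n) - 2 + 2 * real (a + 1) = 0" by (simp add: a)
      finally show ?thesis using t by simp
    qed
    moreover have "expr (- real CARD('n) - 2) \<theta> x * expr 2 \<rho> x ^ (a + 1)
       = coeff \<theta> (slope x) * coeff \<rho> (slope x) ^ (a + 1) * (t powr (- real CARD('n) - 2) * (t powr 2) ^ (a + 1))"
      unfolding expr_eq[OF \<sigma> \<rho> V(2) x] expr_eq[OF \<sigma> \<theta> V(2) x] cone_fun_def t_def power_mult_distrib
      by (simp only: mult.assoc mult.left_commute)
    moreover have "slope x \<in> V" using x by (simp add: cone_over_def)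
    ultimately show ?thesis using small[of "slope x"] by simp
  qed
  interpret open_cone "cone_over V" by (rule open_cone_cone_over[OF V(1)])
  show ?thesis
  proof unfold_locales
    show "CARD('n option option) = 2 * a + 2" by (simp add: card_option a)
    show "homog_on (cone_over V) (- real (2 * a + 2)) (expr (- real CARD('n) - 2) \<theta>)"
    proof -
      have "- real CARD('n) - 2 = - real (2 * a + 2)" by (simp add: a)
      with expr_smooth_homog(2)[OF \<sigma> \<theta> V] show ?thesis by metis
    qed
    show "det (hessian (expr 2 \<rho>) x) \<noteq> 0" if "x \<in> cone_over V" for x
      using J[OF that] neg[OF that] by linarith
    show "(0 :: real ^ 'n option option) \<notin> cone_over V" by (simp add: cone_over_def)
  qed (use expr_smooth_homog[OF \<sigma> \<rho> V] expr_smooth_homog[OF \<sigma> \<theta> V] J a1 in auto)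
qed

lemma expr_sign:
  assumes \<rho>: "\<rho> \<in> proj_densities A 2" and \<sigma>: "\<sigma> \<in> scales A"
    and d: "defining_function A \<Omega> (\<lambda>p. density_fun A 2 \<rho> (scale_point \<sigma> p))"
    and V: "V \<subseteq> snd c ` fst c" and x: "x \<in> cone_over V"
  shows "expr 2 \<rho> x < 0 \<longleftrightarrow> coord_inv c (slope x) \<in> \<Omega>"
    and "expr 2 \<rho> x = 0 \<longleftrightarrow> coord_inv c (slope x) \<in> frontier \<Omega>"
proof -
  define q where "q = coord_inv c (slope x)"
  have t: "x $ None > 0" and q: "q \<in> fst c"
    using x V coord_inv_mem[OF A cA] by (auto simp: cone_over_def q_def)
  have e: "expr 2 \<rho> x = \<rho> q c * x $ None powr 2"
    by (simp add: expr_eq[OF \<sigma> \<rho> V x] cone_fun_def q_def)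
  have f: "density_fun A 2 \<rho> (scale_point \<sigma> q) = \<rho> q c * inverse (\<sigma> q c) powr 2"
    by (rule density_fun_scale_point[OF A \<sigma> cA \<rho> q])
  have "\<sigma> q c > 0" by (rule scale_pos[OF A \<sigma> cA q])
  then have "expr 2 \<rho> x < 0 \<longleftrightarrow> density_fun A 2 \<rho> (scale_point \<sigma> q) < 0"
    "expr 2 \<rho> x = 0 \<longleftrightarrow> density_fun A 2 \<rho> (scale_point \<sigma> q) = 0"
    unfolding e f using t by (auto simp: mult_less_0_iff)
  then show "expr 2 \<rho> x < 0 \<longleftrightarrow> coord_inv c (slope x) \<in> \<Omega>"
    "expr 2 \<rho> x = 0 \<longleftrightarrow> coord_inv c (slope x) \<in> frontier \<Omega>"
    using d unfolding defining_function_def q_def by blast+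
qed

lemma strict_local:
  assumes F: "fefferman (cone_over V) (expr 2 \<rho>) (expr (- real CARD('n) - 2) \<theta>) a"
    and \<rho>: "\<rho> \<in> proj_densities A 2" and \<sigma>: "\<sigma> \<in> scales A"
    and d: "defining_function A \<Omega> (\<lambda>p. density_fun A 2 \<rho> (scale_point \<sigma> p))"
    and V: "V \<subseteq> snd c ` fst c" and \<tau>: "\<tau> \<in> scales A" and U: "frontier \<Omega> \<subseteq> U"
    and bound: "\<And>p. p \<in> fst c \<inter> U \<Longrightarrow>
       \<bar>ambient_laplacian_pow A c \<rho> 1 (density_fun A (- real CARD('n) - 2) \<theta>) (scale_point \<tau> p)\<bar>
         \<le> C * \<bar>density_fun A 2 \<rho> (scale_point \<tau> p)\<bar>"
    and x: "x \<in> cone_over V" "expr 2 \<rho> x = 0"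
  shows "laplacian (hessian (expr 2 \<rho>)) (expr (- real CARD('n) - 2) \<theta>) x = 0"
proof -
  interpret fefferman "cone_over V" "expr 2 \<rho>" "expr (- real CARD('n) - 2) \<theta>" a by (rule F)
  define q where "q = coord_inv c (slope x)"
  have t: "x $ None > 0" and V': "slope x \<in> V" and q: "q \<in> fst c" "snd c q = slope x"
    using x(1) V coord_inv_mem[OF A cA] coord_inv_right[OF A cA] by (auto simp: cone_over_def q_def)
  have qf: "q \<in> frontier \<Omega>" using expr_sign(2)[OF \<rho> \<sigma> d V x(1)] x(2) by (simp add: q_def)
  have "density_fun A 2 \<rho> (scale_point \<sigma> q) = 0" using d qf unfolding defining_function_def by blast
  then have "\<rho> q c = 0"
    using density_fun_scale_point[OF A \<sigma> cA \<rho> q(1)] scale_pos[OF A \<sigma> cA q(1)] by simp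
  then have "density_fun A 2 \<rho> (scale_point \<tau> q) = 0"
    using density_fun_scale_point[OF A \<tau> cA \<rho> q(1)] by simp
  then have "ambient_laplacian_pow A c \<rho> 1 (density_fun A (- real CARD('n) - 2) \<theta>) (scale_point \<tau> q) = 0"
    using bound[of q] q qf U by auto
  then have 0: "lap (expr (- real CARD('n) - 2) \<theta>) (inverse (\<tau> q c) *\<^sub>R base_point (slope x)) = 0"
    by (simp add: ambient_laplacian_pow_def ambient_metric_def scale_point_coords[OF A \<tau> cA] q)
  have \<tau>q: "inverse (\<tau> q c) > 0" using scale_pos[OF A \<tau> cA q(1)] by simp
  define y where "y = inverse (\<tau> q c) *\<^sub>R base_point (slope x)"
  have y: "y \<in> cone_over V" unfolding y_def by (rule cone[OF _ \<tau>q]) (simp add: V')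
  have "x = (x $ None * \<tau> q c) *\<^sub>R y"
    using scale_pos[OF A \<tau> cA q(1)] base_point_slope[OF t] by (simp add: y_def mult.assoc)
  moreover have "x $ None * \<tau> q c > 0" using t scale_pos[OF A \<tau> cA q(1)] by simp
  ultimately have "lap (expr (- real CARD('n) - 2) \<theta>) x = 
      (x $ None * \<tau> q c) powr (- real (2 * a + 2) - 2) * lap (expr (- real CARD('n) - 2) \<theta>) y"
    using homogD[OF lap_homog[OF \<theta>_smooth \<theta>_homog] y] by metis
  then show ?thesis using 0 by (simp add: y_def)
qed

lemma ambient_laplacian_pow_eq:
  assumes \<Omega>: "smooth_domain A \<Omega>" and a1: "a \<ge> 1"
    and s1: "strict_fefferman A S \<Omega> \<rho>1" and s2: "strict_fefferman A S \<Omega> \<rho>2"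
    and p: "p \<in> fst c \<inter> frontier \<Omega>" and \<tau>: "\<tau> \<in> scales A" and f: "f \<in> proj_densities A 2"
  shows "ambient_laplacian_pow A c \<rho>1 (a + 2) (density_fun A 2 f) (scale_point \<tau> p) =
    ambient_laplacian_pow A c \<rho>2 (a + 2) (density_fun A 2 f) (scale_point \<tau> p)"
proof -
  obtain \<theta>1 \<tau>1 C1 U1 where F1: "fefferman_with A S \<Omega> \<rho>1 \<theta>1" and \<tau>1: "\<tau>1 \<in> scales A" "frontier \<Omega> \<subseteq> U1"
    and b1: "\<And>p. p \<in> fst c \<inter> U1 \<Longrightarrow>
       \<bar>ambient_laplacian_pow A c \<rho>1 1 (density_fun A (- real CARD('n) - 2) \<theta>1) (scale_point \<tau>1 p)\<bar>
         \<le> C1 * \<bar>density_fun A 2 \<rho>1 (scale_point \<tau>1 p)\<bar>"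
    using s1 c unfolding strict_fefferman_def by blast
  obtain \<theta>2 \<tau>2 C2 U2 where F2: "fefferman_with A S \<Omega> \<rho>2 \<theta>2" and \<tau>2: "\<tau>2 \<in> scales A" "frontier \<Omega> \<subseteq> U2"
    and b2: "\<And>p. p \<in> fst c \<inter> U2 \<Longrightarrow>
       \<bar>ambient_laplacian_pow A c \<rho>2 1 (density_fun A (- real CARD('n) - 2) \<theta>2) (scale_point \<tau>2 p)\<bar>
         \<le> C2 * \<bar>density_fun A 2 \<rho>2 (scale_point \<tau>2 p)\<bar>"
    using s2 c unfolding strict_fefferman_def by blast
  obtain \<sigma>1 where \<rho>1: "\<rho>1 \<in> proj_densities A 2" and \<sigma>1: "\<sigma>1 \<in> scales A"
    and d1: "defining_function A \<Omega> (\<lambda>p. density_fun A 2 \<rho>1 (scale_point \<sigma>1 p))"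
    using F1 unfolding fefferman_with_def defining_density_def by blast
  obtain \<sigma>2 where \<rho>2: "\<rho>2 \<in> proj_densities A 2" and \<sigma>2: "\<sigma>2 \<in> scales A"
    and d2: "defining_function A \<Omega> (\<lambda>p. density_fun A 2 \<rho>2 (scale_point \<sigma>2 p))"
    using F2 unfolding fefferman_with_def defining_density_def by blast
  have \<theta>1: "\<theta>1 \<in> proj_densities A (- real CARD('n) - 2)" and \<theta>2: "\<theta>2 \<in> proj_densities A (- real CARD('n) - 2)"
    using F1 F2 by (auto simp: fefferman_with_def)
  define J1 where "J1 y = coeff \<theta>1 y * coeff \<rho>1 y ^ (a + 1)" for y
  define J2 where "J2 y = coeff \<theta>2 y * coeff \<rho>2 y ^ (a + 1)" for y
  define V0 where "V0 = (snd c ` fst c \<inter> J1 -` {..<1}) \<inter> (snd c ` fst c \<inter> J2 -` {..<1})"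
  note cs = smooth_on_imp_continuous_on[OF proj_density_smooth[OF A _ cA]]
  have "continuous_on (snd c ` fst c) J1" "continuous_on (snd c ` fst c) J2"
    unfolding J1_def[abs_def] J2_def[abs_def]
    by (intro continuous_on_mult continuous_on_power cs[OF \<theta>1] cs[OF \<theta>2] cs[OF \<rho>1] cs[OF \<rho>2])+
  then have oV0: "open V0"
    unfolding V0_def by (intro open_Int continuous_open_preimage chart_image_open[OF A cA] open_lessThan)
  have zero: "\<rho> p c = 0" if "\<rho> \<in> proj_densities A 2" "\<sigma> \<in> scales A"
    "defining_function A \<Omega> (\<lambda>p. density_fun A 2 \<rho> (scale_point \<sigma> p))" for \<rho> \<sigma>
  proof -
    have "density_fun A 2 \<rho> (scale_point \<sigma> p) = 0" using that(3) p unfolding defining_function_def by blast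
    then show ?thesis
      using density_fun_scale_point[OF A that(2) cA that(1)] p scale_pos[OF A that(2) cA, of p] by simp
  qed
  have "coord_inv c (snd c p) = p" using coord_inv_left[OF A cA] p by blast
  then have pV0: "snd c p \<in> V0"
    using p zero[OF \<rho>1 \<sigma>1 d1] zero[OF \<rho>2 \<sigma>2 d2] by (simp add: V0_def J1_def J2_def)
  obtain V where V: "open V" "snd c p \<in> V" "V \<subseteq> V0"
    and div: "\<And>f. smooth_on V f \<Longrightarrow> (\<And>y. y \<in> V \<Longrightarrow> coord_inv c y \<in> frontier \<Omega> \<Longrightarrow> f y = 0) \<Longrightarrow>
       \<exists>k. smooth_on V k \<and> (\<forall>y\<in>V. f y = density_fun A 2 \<rho>1 (scale_point \<sigma>1 (coord_inv c y)) * k y)"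
    using defining_function_division[OF A \<Omega> d1 cA p oV0 pV0] unfolding V0_def by blast
  have Vc: "V \<subseteq> snd c ` fst c" using V(3) by (auto simp: V0_def)
  let ?W = "cone_over V"
  let ?w = "- real CARD('n) - 2"
  interpret m1: fefferman ?W "expr 2 \<rho>1" "expr ?w \<theta>1" a
    by (rule fefferman_local[OF F1 \<sigma>1 V(1) Vc a1]) (use V(3) in \<open>auto simp: V0_def J1_def\<close>)
  interpret m2: fefferman ?W "expr 2 \<rho>2" "expr ?w \<theta>2" a
    by (rule fefferman_local[OF F2 \<sigma>2 V(1) Vc a1]) (use V(3) in \<open>auto simp: V0_def J2_def\<close>)
  note sg1 = expr_sign[OF \<rho>1 \<sigma>1 d1 Vc] and sg2 = expr_sign[OF \<rho>2 \<sigma>2 d2 Vc]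
  interpret fefferman_pair ?W "expr 2 \<rho>1" "expr 2 \<rho>2" "expr ?w \<theta>1" "expr ?w \<theta>2" a
  proof unfold_locales
    show "expr 2 \<rho>1 x = 0 \<longleftrightarrow> expr 2 \<rho>2 x = 0" if "x \<in> ?W" for x
      using sg1(2)[OF that] sg2(2)[OF that] by simp
    show "expr 2 \<rho>1 x * expr 2 \<rho>2 x \<ge> 0" if "x \<in> ?W" for x
      using sg1[OF that] sg2[OF that] by (metis linorder_not_less mult_less_0_iff order_less_imp_not_less)
    show "\<exists>h. smooth_on ?W h \<and> homog_on ?W (s - 2) h \<and> (\<forall>x\<in>?W. f x = expr 2 \<rho>1 x * h x)"
      if f: "smooth_on ?W f" "homog_on ?W s f" "\<And>x. x \<in> ?W \<Longrightarrow> expr 2 \<rho>1 x = 0 \<Longrightarrow> f x = 0" for f s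
    proof -
      have "smooth_on V (\<lambda>y. f (base_point y))"
        by (rule smooth_on_compose[OF V(1) m1.W f(1) smooth_base_point[OF V(1)]]) simp
      moreover have "f (base_point y) = 0" if "y \<in> V" "coord_inv c y \<in> frontier \<Omega>" for y
        by (rule f(3)) (use that sg1(2)[of "base_point y"] in auto)
      ultimately obtain k where k: "smooth_on V k"
        "\<And>y. y \<in> V \<Longrightarrow> f (base_point y) = density_fun A 2 \<rho>1 (scale_point \<sigma>1 (coord_inv c y)) * k y"
        using div[of "\<lambda>y. f (base_point y)"] by blast
      define l where "l y = inverse (coeff \<sigma>1 y) powr 2 * k y" for y
      have \<sigma>pos: "coeff \<sigma>1 y > 0" if "y \<in> V" for y
        by (rule scale_pos[OF A \<sigma>1 cA]) (use that Vc coord_inv_mem[OF A cA] in blast)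
      have \<sigma>1': "\<sigma>1 \<in> proj_densities A 1" using \<sigma>1 by (simp add: scales_def)
      have "smooth_on V (coeff \<sigma>1)"
        by (rule smooth_on_subset[OF chart_image_open[OF A cA] Vc proj_density_smooth[OF A \<sigma>1' cA]])
      then have l: "smooth_on V l" unfolding l_def[abs_def]
        by (intro smooth_on_mult smooth_on_powr smooth_on_inverse V(1) k(1)) (use \<sigma>pos in force)+
      have "f x = expr 2 \<rho>1 x * cone_fun (s - 2) l x" if x: "x \<in> ?W" for x
      proof -
        have t: "x $ None > 0" and y: "slope x \<in> V" using x by (auto simp: cone_over_def)
        have "f x = f (x $ None *\<^sub>R base_point (slope x))" by (simp add: base_point_slope[OF t])
        also have "\<dots> = x $ None powr s * f (base_point (slope x))"
          by (rule m1.homogD[OF f(2) _ t]) (simp add: y)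
        also have "\<dots> = x $ None powr s * (coeff \<rho>1 (slope x) * l (slope x))"
          using density_fun_scale_point[OF A \<sigma>1 cA \<rho>1, of "coord_inv c (slope x)"] y Vc coord_inv_mem[OF A cA]
          by (auto simp: k(2)[OF y] l_def)
        also have "x $ None powr s = x $ None powr 2 * x $ None powr (s - 2)" by (simp add: powr_add[symmetric])
        finally show ?thesis
          unfolding expr_eq[OF \<sigma>1 \<rho>1 Vc x] cone_fun_def by (simp only: mult.assoc mult.left_commute mult.commute)
      qed
      then show ?thesis using smooth_cone_fun[OF V(1) l] homog_cone_fun by blast
    qed
  qed
  obtain \<phi> where \<phi>: "smooth_on ?W \<phi>" "homog_on ?W (- 2 * real (a + 1)) \<phi>"
    "\<And>x. x \<in> ?W \<Longrightarrow> expr 2 \<rho>2 x = expr 2 \<rho>1 x + \<phi> x * expr 2 \<rho>1 x ^ (a + 2)"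
    using contact_order by blast
  interpret strict_pair ?W "expr 2 \<rho>1" "expr 2 \<rho>2" "expr ?w \<theta>1" "expr ?w \<theta>2" a \<phi>
  proof unfold_locales
    show "m1.lap (expr ?w \<theta>1) x = 0" if "x \<in> ?W" "expr 2 \<rho>1 x = 0" for x
      by (rule strict_local[OF m1.fefferman_axioms \<rho>1 \<sigma>1 d1 Vc \<tau>1 b1 that])
    show "m2.lap (expr ?w \<theta>2) x = 0" if "x \<in> ?W" "expr 2 \<rho>1 x = 0" for x
      by (rule strict_local[OF m2.fefferman_axioms \<rho>2 \<sigma>2 d2 Vc \<tau>2 b2 that(1)])
        (use that zero_iff in auto)
  qed (use \<phi> in auto)
  define x where "x = ambient_coords c (scale_point \<tau> p)"
  have x: "x = inverse (\<tau> p c) *\<^sub>R base_point (snd c p)"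
    unfolding x_def by (rule scale_point_coords[OF A \<tau> cA])
  have \<tau>p: "inverse (\<tau> p c) > 0" using scale_pos[OF A \<tau> cA, of p] p by simp
  have xW: "x \<in> ?W" unfolding x by (rule m1.cone[OF _ \<tau>p]) (simp add: V(2))
  have "coord_inv c (slope x) = p" unfolding x using \<tau>p coord_inv_left[OF A cA] p by simp
  then have x0: "expr 2 \<rho>1 x = 0" using sg1(2)[OF xW] p by simp
  show ?thesis
    using lap_pow_eq[OF expr_smooth_homog[OF \<sigma>1 f V(1) Vc] xW x0]
    by (simp only: ambient_laplacian_pow_def ambient_metric_def x_def)
qed

end

lemma corresponds_on_cong:
  assumes "\<And>\<tau> p. \<tau> \<in> scales A \<Longrightarrow> p \<in> U \<inter> frontier \<Omega> \<Longrightarrow> G (scale_point \<tau> p) = H (scale_point \<tau> p)"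
  shows "corresponds_on A S \<Omega> U w G g \<longleftrightarrow> corresponds_on A S \<Omega> U w H g"
proof -
  have "p \<in> frontier \<Omega>" if "y \<in> boundary_atlas A \<Omega>" "p \<in> fst y" for y p
    using that openin_subset unfolding boundary_atlas_def chart_on_def by fastforce
  then have "G (scale_point \<tau> p) = H (scale_point \<tau> p)"
    if "\<tau> \<in> scales A" "y \<in> boundary_atlas A \<Omega>" "p \<in> fst y \<inter> U" for \<tau> y p
    using assms that by blast
  then show ?thesis unfolding corresponds_on_def by (metis (no_types, lifting))
qed

theorem proposition3p5:
  fixes A :: "('a::{t2_space, second_countable_topology}, 'n::finite option) chart set"
    and S :: "('a, 'n option) conn set"
    and \<Omega> :: "'a set"
    and \<rho>\<^sub>1 \<rho>\<^sub>2 :: "'a \<Rightarrow> ('a, 'n option) chart \<Rightarrow> real"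
  assumes "even CARD('n)"
    and "oriented_manifold UNIV A"
    and "projective_structure A S"
    and "locally_flat A S"
    and "smooth_domain A \<Omega>"
    and "strictly_convex A S \<Omega>"
    and "strict_fefferman A S \<Omega> \<rho>\<^sub>1"
    and "strict_fefferman A S \<Omega> \<rho>\<^sub>2"
  shows "\<forall>f \<in> conf_densities A \<Omega> 2. gjms A S \<Omega> \<rho>\<^sub>1 f = gjms A S \<Omega> \<rho>\<^sub>2 f"
proof
  fix f assume "f \<in> conf_densities A \<Omega> 2"
  obtain a where a: "CARD('n) = 2 * a" using assms(1) by (rule evenE)
  then have a1: "a \<ge> 1" using zero_less_card_finite[where 'a = 'n] by linarith
  have "corresponds_on A S \<Omega> (fst c) w (ambient_laplacian_pow A c \<rho>\<^sub>1 (CARD('n) div 2 + 2) (density_fun A 2 F)) g \<longleftrightarrow>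
      corresponds_on A S \<Omega> (fst c) w (ambient_laplacian_pow A c \<rho>\<^sub>2 (CARD('n) div 2 + 2) (density_fun A 2 F)) g"
    if "extends A S \<Omega> 2 F f" "affine_coords A S c" for F c w g
    by (rule corresponds_on_cong)
      (use that a ambient_laplacian_pow_eq[OF assms(2) that(2) a assms(5) a1 assms(7,8)] in
        \<open>auto simp: extends_def\<close>)
  then show "gjms A S \<Omega> \<rho>\<^sub>1 f = gjms A S \<Omega> \<rho>\<^sub>2 f"
    unfolding gjms_def by (intro arg_cong[of _ _ The] ext) blast
qed

end
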